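(* Let $k$ be a field containing all roots of unity. Let $\Phi_k : \mathrm{K}_0^{sp}(\mathrm{Mod}(\langle t\rangle)_{\mathbb{F}_1}) \to \mathrm{K}_0^{sp}(\mathrm{Mod}_{k[t]})$ be the ring homomorphism determined by $[M] \mapsto [M \otimes_{\mathbb{F}_1} k]$. Then the image of $\Phi_k$ is the subring of $\mathrm{K}_0^{sp}(\mathrm{Mod}_{k[t]})$ generated by the classes $[J_n(0)]$ and $[D_n]$, $n \ge 1$.
   Context: $\langle t\rangle = \{0, 1, t, t^2, \dots\}$ is the free monoid (with absorbing zero) on one generator. A $\langle t\rangle$-module is a pointed set $(M,0_M)$ with an action of $\langle t\rangle$ fixing $0_M$, with $1$ acting as the identity and $0$ sending everything to $0_M$; equivalently, a pointed set with a basepoint-preserving self-map $t$. $\mathrm{Mod}(\langle t\rangle)_{\mathbb{F}_1}$ is the category of finite $\langle t\rangle$-modules, with morphisms the pointed maps commuting with the action. $M \oplus N$ is the wedge sum $M \vee N$ (coproduct), and $M \wedge N = (M\times N)/(M\vee N)$ is the smash product with the diagonal action $t\cdot(m,n) = (t\cdot m, t\cdot n)$. $\mathrm{K}_0^{sp}(\mathrm{Mod}(\langle t\rangle)_{\mathbb{F}_1})$ is the split Grothendieck ring: the free abelian group on isomorphism classes of finite $\langle t\rangle$-modules modulo the relations $[M\oplus N] = [M]+[N]$, with multiplication $[M]\cdot[N] = [M\wedge N]$. $\mathrm{K}_0^{sp}(\mathrm{Mod}_{k[t]})$ is the split Grothendieck ring of finite-dimensional $k[t]$-modules, defined as the free abelian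 group on isomorphism classes modulo $[V\oplus W]=[V]+[W]$, with multiplication $[V]\cdot[W] = [V\otimes_k W]$, where $t$ acts on $V\otimes_k W$ by $t\otimes t$ (coproduct $\Delta(t)=t\otimes t$). $M\otimes_{\mathbb{F}_1} k$ is the $k$-vector space with basis the non-basepoint elements of $M$, with $t$ acting $k$-linearly by extending the action on $M$ (the basepoint being sent to $0$). "$k$ contains all roots of unity" means that for each $n\ge 1$, $k$ contains a primitive $n$-th root of unity $\zeta_n$ (written $e^{2\pi i/n}$ in the paper). A square matrix of size $n$ over $k$ is regarded as the $k[t]$-module $k^n$ on which $t$ acts by that matrix. $J_n(0)$ is the $n\times n$ nilpotent Jordan block (zeros on the diagonal, ones on the superdiagonal, zeros elsewhere), and $D_n = \mathrm{diag}(\zeta_n, \zeta_n^2, \dots, \zeta_n^n)$. *)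

theory Defs
  imports
    "HOL-Algebra.Generated_Rings"
    "HOL-Algebra.QuotRing"
    "HOL-Algebra.Generated_Groups"
    "HOL-Library.Poly_Mapping"
    "Jordan_Normal_Form.VS_Connect"
    "Jordan_Normal_Form.Jordan_Normal_Form"
begin

hide_const (open) Multiset.mult Polynomial.smult Modules.module

section \<open>Finite modules over the free monoid on one generator\<close>

text \<open>The absorbing zero and the unit of the monoid act in the only possible way, so the whole
  action is given by the self-map \<open>act\<close> by which \<open>t\<close> acts.\<close>

record 'a t_module = "'a partial_object" +
  base :: 'a
  act :: "'a \<Rightarrow> 'a"

definition finite_t_module :: "'a t_module \<Rightarrow> bool" where
  "finite_t_module M \<longleftrightarrow>
     finite (carrier M) \<and> base M \<in> carrier M \<and>
     act M \<in> carrier M \<rightarrow> carrier M \<and> act M (base M) = base M"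

definition t_hom :: "'a t_module \<Rightarrow> 'b t_module \<Rightarrow> ('a \<Rightarrow> 'b) set" where
  "t_hom M N = {f \<in> carrier M \<rightarrow> carrier N.
     f (base M) = base N \<and> (\<forall>x\<in>carrier M. f (act M x) = act N (f x))}"

definition t_isomorphic :: "'a t_module \<Rightarrow> 'b t_module \<Rightarrow> bool" where
  "t_isomorphic M N \<longleftrightarrow> (\<exists>f\<in>t_hom M N. bij_betw f (carrier M) (carrier N))"

text \<open>The wedge \<open>M \<or> N\<close> is realised as the union of the two axes in \<open>M \<times> N\<close>.\<close>

definition wedge_carrier :: "'a t_module \<Rightarrow> 'b t_module \<Rightarrow> ('a \<times> 'b) set" where
  "wedge_carrier M N = carrier M \<times> {base N} \<union> {base M} \<times> carrier N"

definition wedge :: "'a t_module \<Rightarrow> 'b t_module \<Rightarrow> ('a \<times> 'b) t_module" where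
  "wedge M N =
     \<lparr>carrier = wedge_carrier M N, base = (base M, base N), act = map_prod (act M) (act N)\<rparr>"

text \<open>The smash product \<open>(M \<times> N) / (M \<or> N)\<close>: the wedge is collapsed to a point, which becomes the
  base point.\<close>

definition smash_rel :: "'a t_module \<Rightarrow> 'b t_module \<Rightarrow> (('a \<times> 'b) \<times> ('a \<times> 'b)) set" where
  "smash_rel M N =
     Id_on (carrier M \<times> carrier N) \<union> wedge_carrier M N \<times> wedge_carrier M N"

definition smash :: "'a t_module \<Rightarrow> 'b t_module \<Rightarrow> ('a \<times> 'b) set t_module" where
  "smash M N =
     \<lparr>carrier = (carrier M \<times> carrier N) // smash_rel M N,
      base = wedge_carrier M N,
      act = (\<lambda>X. smash_rel M N `` (map_prod (act M) (act N) ` X))\<rparr>"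

text \<open>Every finite module is isomorphic to one whose elements are natural numbers. The isomorphism
  class of a module over an arbitrary type is therefore represented by the set of all modules on
  natural numbers isomorphic to it; this set is never empty.\<close>

type_synonym t_class = "nat t_module set"

definition t_class_of :: "'a t_module \<Rightarrow> t_class" where
  "t_class_of M = {N. finite_t_module N \<and> t_isomorphic M N}"

definition t_classes :: "t_class set" where
  "t_classes = t_class_of ` {M :: nat t_module. finite_t_module M}"

definition t_class_mult :: "t_class \<Rightarrow> t_class \<Rightarrow> t_class" where
  "t_class_mult X Y = (\<Union>M\<in>X. \<Union>N\<in>Y. t_class_of (smash M N))"

text \<open>The pointed set \<open>{0, 1}\<close> with trivial action, the unit of the smash product.\<close>

definition t_unit :: "nat t_module" where
  "t_unit = \<lparr>carrier = {0, 1}, base = 0, act = (\<lambda>x. x)\<rparr>"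


section \<open>Finite-dimensional modules over a polynomial ring\<close>

text \<open>A \<open>k[t]\<close>-module is a module over \<open>class_ring :: 'k poly ring\<close>.\<close>

definition restrict_scalars :: "('k::field poly, 'v) module \<Rightarrow> ('k, 'v) module" where
  "restrict_scalars M =
     \<lparr>carrier = carrier M, mult = mult M, one = one M, zero = zero M, add = add M,
      smult = (\<lambda>c v. [:c:] \<odot>\<^bsub>M\<^esub> v)\<rparr>"

definition t_op :: "('k::field poly, 'v) module \<Rightarrow> 'v \<Rightarrow> 'v" where
  "t_op M v = [:0, 1:] \<odot>\<^bsub>M\<^esub> v"

definition finite_kt_module :: "('k::field poly, 'v) module \<Rightarrow> bool" where
  "finite_kt_module M \<longleftrightarrow>
     Module.module class_ring M \<and> vectorspace.fin_dim class_ring (restrict_scalars M)"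

definition kt_isomorphic ::
    "('k::field poly, 'v) module \<Rightarrow> ('k poly, 'w) module \<Rightarrow> bool" where
  "kt_isomorphic M N \<longleftrightarrow>
     (\<exists>f\<in>module_hom class_ring M N. bij_betw f (carrier M) (carrier N))"

text \<open>The \<open>k[t]\<close>-module on the vector space \<open>V\<close> on which \<open>t\<close> acts by the linear map \<open>T\<close>.\<close>

definition kt_module :: "('k::field, 'v) module \<Rightarrow> ('v \<Rightarrow> 'v) \<Rightarrow> ('k poly, 'v) module" where
  "kt_module V T =
     \<lparr>carrier = carrier V, mult = mult V, one = one V, zero = zero V, add = add V,
      smult = (\<lambda>p v. \<Oplus>\<^bsub>V\<^esub>i\<in>{..degree p}. coeff p i \<odot>\<^bsub>V\<^esub> (T ^^ i) v)\<rparr>"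

definition matrix_module :: "'k::field mat \<Rightarrow> ('k poly, 'k vec) module" where
  "matrix_module A = kt_module (module_vec TYPE('k) (dim_row A)) (\<lambda>v. A *\<^sub>v v)"

text \<open>The vector space with basis \<open>S\<close>. A formal linear combination is a finitely supported function
  and \<open>single x 1\<close> is the basis vector of \<open>x\<close>.\<close>

definition pm_scale :: "'k::field \<Rightarrow> ('b \<Rightarrow>\<^sub>0 'k) \<Rightarrow> ('b \<Rightarrow>\<^sub>0 'k)" where
  "pm_scale c f = Poly_Mapping.map ((*) c) f"

definition free_space :: "'b set \<Rightarrow> ('k::field, 'b \<Rightarrow>\<^sub>0 'k) module" where
  "free_space S =
     \<lparr>carrier = {f. Poly_Mapping.keys f \<subseteq> S}, mult = undefined, one = undefined,
      zero = 0, add = (+), smult = pm_scale\<rparr>"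

definition linear_extension ::
    "('b \<Rightarrow> ('c \<Rightarrow>\<^sub>0 'k::field)) \<Rightarrow> ('b \<Rightarrow>\<^sub>0 'k) \<Rightarrow> ('c \<Rightarrow>\<^sub>0 'k)" where
  "linear_extension g f =
     (\<Sum>x\<in>Poly_Mapping.keys f. pm_scale (Poly_Mapping.lookup f x) (g x))"

definition quotient_space ::
    "('k::field, 'v) module \<Rightarrow> 'v set \<Rightarrow> ('k, 'v set) module" where
  "quotient_space V U =
     \<lparr>carrier = a_rcosets\<^bsub>V\<^esub> U, mult = undefined, one = undefined,
      zero = U, add = set_add V, smult = (\<lambda>c X. \<Union>x\<in>X. U +>\<^bsub>V\<^esub> (c \<odot>\<^bsub>V\<^esub> x))\<rparr>"

text \<open>The tensor product over \<open>k\<close> is the quotient of the free space on \<open>V \<times> W\<close> by the bilinearity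
  relations.\<close>

definition tensor_relations ::
    "('k::field, 'v) module \<Rightarrow> ('k, 'w) module \<Rightarrow> ('v \<times> 'w \<Rightarrow>\<^sub>0 'k) set" where
  "tensor_relations V W =
     {Poly_Mapping.single (v \<oplus>\<^bsub>V\<^esub> v', w) 1 - Poly_Mapping.single (v, w) 1
        - Poly_Mapping.single (v', w) 1 | v v' w.
        v \<in> carrier V \<and> v' \<in> carrier V \<and> w \<in> carrier W} \<union>
     {Poly_Mapping.single (v, w \<oplus>\<^bsub>W\<^esub> w') 1 - Poly_Mapping.single (v, w) 1
        - Poly_Mapping.single (v, w') 1 | v w w'.
        v \<in> carrier V \<and> w \<in> carrier W \<and> w' \<in> carrier W} \<union>
     {Poly_Mapping.single (c \<odot>\<^bsub>V\<^esub> v, w) 1 - Poly_Mapping.single (v, w) c | c v w.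
        v \<in> carrier V \<and> w \<in> carrier W} \<union>
     {Poly_Mapping.single (v, c \<odot>\<^bsub>W\<^esub> w) 1 - Poly_Mapping.single (v, w) c | c v w.
        v \<in> carrier V \<and> w \<in> carrier W}"

definition tensor_kernel ::
    "('k::field, 'v) module \<Rightarrow> ('k, 'w) module \<Rightarrow> ('v \<times> 'w \<Rightarrow>\<^sub>0 'k) set" where
  "tensor_kernel V W =
     LinearCombinations.module.span class_ring
       (free_space (carrier V \<times> carrier W)) (tensor_relations V W)"

definition tensor_space ::
    "('k::field, 'v) module \<Rightarrow> ('k, 'w) module \<Rightarrow> ('k, ('v \<times> 'w \<Rightarrow>\<^sub>0 'k) set) module" where
  "tensor_space V W =
     quotient_space (free_space (carrier V \<times> carrier W)) (tensor_kernel V W)"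

text \<open>The linear map with \<open>v \<otimes> w \<mapsto> S v \<otimes> T w\<close>.\<close>

definition tensor_map ::
    "('k::field, 'v) module \<Rightarrow> ('k, 'w) module \<Rightarrow> ('v \<Rightarrow> 'v) \<Rightarrow> ('w \<Rightarrow> 'w) \<Rightarrow>
      ('v \<times> 'w \<Rightarrow>\<^sub>0 'k) set \<Rightarrow> ('v \<times> 'w \<Rightarrow>\<^sub>0 'k) set" where
  "tensor_map V W S T X =
     (\<Union>x\<in>X. tensor_kernel V W +>\<^bsub>free_space (carrier V \<times> carrier W)\<^esub>
        linear_extension (\<lambda>(v, w). Poly_Mapping.single (S v, T w) 1) x)"

text \<open>The tensor product over \<open>k\<close>, on which \<open>t\<close> acts by \<open>t \<otimes> t\<close>.\<close>

definition kt_tensor ::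
    "('k::field poly, 'v) module \<Rightarrow> ('k poly, 'w) module \<Rightarrow>
      ('k poly, ('v \<times> 'w \<Rightarrow>\<^sub>0 'k) set) module" where
  "kt_tensor M N =
     kt_module (tensor_space (restrict_scalars M) (restrict_scalars N))
       (tensor_map (restrict_scalars M) (restrict_scalars N) (t_op M) (t_op N))"

text \<open>Every finite-dimensional \<open>k[t]\<close>-module is isomorphic to one whose elements are column vectors,
  so that again isomorphism classes of modules over arbitrary types live in a single type.\<close>

type_synonym 'k kt_class = "('k poly, 'k vec) module set"

definition kt_class_of :: "('k::field poly, 'v) module \<Rightarrow> 'k kt_class" where
  "kt_class_of M = {N. finite_kt_module N \<and> kt_isomorphic M N}"

definition kt_classes :: "'k::field kt_class set" where
  "kt_classes = kt_class_of ` {M :: ('k poly, 'k vec) module. finite_kt_module M}"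

definition kt_class_mult :: "'k::field kt_class \<Rightarrow> 'k kt_class \<Rightarrow> 'k kt_class" where
  "kt_class_mult X Y = (\<Union>M\<in>X. \<Union>N\<in>Y. kt_class_of (kt_tensor M N))"

text \<open>The unit is \<open>k\<close> with \<open>t\<close> acting as the identity.\<close>

definition kt_unit :: "('k::field poly, 'k vec) module" where
  "kt_unit = matrix_module (1\<^sub>m 1)"


section \<open>Split Grothendieck rings\<close>

text \<open>The free abelian group on a set \<open>C\<close> of isomorphism classes, with the biadditive extension of a
  multiplication of classes.\<close>

definition free_ring_on :: "'c set \<Rightarrow> ('c \<Rightarrow> 'c \<Rightarrow> 'c) \<Rightarrow> 'c \<Rightarrow> ('c \<Rightarrow>\<^sub>0 int) ring" where
  "free_ring_on C m u =
     \<lparr>carrier = {f. Poly_Mapping.keys f \<subseteq> C},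
      mult = (\<lambda>f g. frag_extend (\<lambda>X. frag_extend (\<lambda>Y. frag_of (m X Y)) g) f),
      one = frag_of u, zero = 0, add = (+)\<rparr>"

definition free_ring_F1 :: "(t_class \<Rightarrow>\<^sub>0 int) ring" where
  "free_ring_F1 = free_ring_on t_classes t_class_mult (t_class_of t_unit)"

text \<open>The subgroup generated by the relations \<open>[M \<oplus> N] = [M] + [N]\<close>; it is an ideal because the
  product distributes over \<open>\<oplus>\<close>.\<close>

definition split_ideal_F1 :: "(t_class \<Rightarrow>\<^sub>0 int) set" where
  "split_ideal_F1 = generate (add_monoid free_ring_F1)
     {frag_of (t_class_of (wedge M N)) - frag_of (t_class_of M) - frag_of (t_class_of N) |
        (M :: nat t_module) (N :: nat t_module). finite_t_module M \<and> finite_t_module N}"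

definition K0_F1 :: "(t_class \<Rightarrow>\<^sub>0 int) set ring" where
  "K0_F1 = free_ring_F1 Quot split_ideal_F1"

definition K0_F1_class :: "'a t_module \<Rightarrow> (t_class \<Rightarrow>\<^sub>0 int) set" where
  "K0_F1_class M = split_ideal_F1 +>\<^bsub>free_ring_F1\<^esub> frag_of (t_class_of M)"

definition free_ring_kt :: "('k::field kt_class \<Rightarrow>\<^sub>0 int) ring" where
  "free_ring_kt = free_ring_on kt_classes kt_class_mult (kt_class_of kt_unit)"

definition split_ideal_kt :: "('k::field kt_class \<Rightarrow>\<^sub>0 int) set" where
  "split_ideal_kt = generate (add_monoid free_ring_kt)
     {frag_of (kt_class_of (direct_sum M N)) - frag_of (kt_class_of M) - frag_of (kt_class_of N) |
        (M :: ('k poly, 'k vec) module) (N :: ('k poly, 'k vec) module).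
        finite_kt_module M \<and> finite_kt_module N}"

definition K0_kt :: "('k::field kt_class \<Rightarrow>\<^sub>0 int) set ring" where
  "K0_kt = free_ring_kt Quot split_ideal_kt"

definition K0_kt_class :: "('k::field poly, 'v) module \<Rightarrow> ('k kt_class \<Rightarrow>\<^sub>0 int) set" where
  "K0_kt_class M = split_ideal_kt +>\<^bsub>free_ring_kt\<^esub> frag_of (kt_class_of M)"


section \<open>Base change\<close>

definition base_change :: "'a t_module \<Rightarrow> ('k::field poly, 'a \<Rightarrow>\<^sub>0 'k) module" where
  "base_change M =
     kt_module (free_space (carrier M - {base M}))
       (linear_extension
          (\<lambda>x. if act M x = base M then 0 else Poly_Mapping.single (act M x) 1))"

definition is_base_change_hom ::
    "((t_class \<Rightarrow>\<^sub>0 int) set \<Rightarrow> ('k::field kt_class \<Rightarrow>\<^sub>0 int) set) \<Rightarrow> bool" where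
  "is_base_change_hom \<Phi> \<longleftrightarrow>
     ring_hom_ring K0_F1 K0_kt \<Phi> \<and>
     (\<forall>M :: nat t_module. finite_t_module M \<longrightarrow>
        \<Phi> (K0_F1_class M) = K0_kt_class (base_change M :: ('k poly, nat \<Rightarrow>\<^sub>0 'k) module))"

definition primitive_root_of_unity :: "nat \<Rightarrow> 'k::field \<Rightarrow> bool" where
  "primitive_root_of_unity n z \<longleftrightarrow> z ^ n = 1 \<and> (\<forall>m. 0 < m \<and> m < n \<longrightarrow> z ^ m \<noteq> 1)"

text \<open>For a primitive \<open>n\<close>-th root of unity \<open>z\<close>, the matrix \<open>diag(z, z\<^sup>2, \<dots>, z\<^sup>n)\<close>; matrix
  indices start at 0.\<close>

definition root_matrix :: "nat \<Rightarrow> 'k::field \<Rightarrow> 'k mat" where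
  "root_matrix n z = mat n n (\<lambda>(i, j). if i = j then z ^ Suc i else 0)"

end

theory Submission
  imports Defs "HOL-Algebra.Free_Abelian_Groups"
begin

text \<open>
  After a choice of bases both rings have a matrix description. A finite \<open>\<langle>t\<rangle>\<close>-module is a finite
  set with a partial self-map, the wedge sum is the disjoint union and the smash product is the
  cartesian product; a finite-dimensional \<open>k[t]\<close>-module is a finite index set with a square matrix,
  the direct sum is the block sum and the tensor product is the Kronecker product. Base change sends
  a partial map to its 0-1 matrix. The ring axioms and the existence of \<open>\<Phi>\<^sub>k\<close> thus reduce to
  bijections between index sets.

  A path with \<open>n\<close> vertices gives \<open>J\<^sub>n(0)\<close>. A cycle of length \<open>n\<close> gives \<open>D\<^sub>n\<close> by the discrete Fourier
  transform, as \<open>n\<close> is invertible in \<open>k\<close> (in characteristic \<open>p\<close> there is no primitive \<open>p\<close>-th root of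
  unity). Conversely, if \<open>x \<noteq> y\<close> have the same image under a partial self-map, then one of them, say
  \<open>x\<close>, is not periodic and the longest chain ending in it is matched by a chain ending in \<open>y\<close>.
  Subtracting the latter from the tree of ancestors of \<open>x\<close> is a change of basis that deletes the
  edge leaving \<open>x\<close>. Repeating this leaves a disjoint union of paths and cycles.
\<close>

section \<open>Split Grothendieck rings of commutative semirings\<close>

text \<open>Base change forgets information: deleting an edge changes the isomorphism class of a
  partial map but, in the situation of the overview, not that of its matrix. The reduction to paths
  and cycles therefore takes place among matrix classes, never among classes of pointed modules.

  The change of basis must reach all ancestors of \<open>x\<close> and must be invertible. A chain
  ending in \<open>y\<close> that is as long as the longest one ending in \<open>x\<close> supplies
  a partner at every distance. This is why two non-periodic vertices are compared by the length of
  their longest chains, and why a periodic \<open>y\<close>, with chains of every length on its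
  cycle, is always a good choice. No partner is itself an ancestor of \<open>x\<close>, so the
  correction \<open>N\<close> has square zero and \<open>1 + N\<close> has the inverse
  \<open>1 - N\<close> in every characteristic.

  Isomorphism classes are sets of representatives, and their operations are unions over
  representatives. Hence each class has to be shown inhabited and each operation independent of
  representatives before index sets with partial maps or matrices can take the place of
  modules.\<close>

lemma frag_extend_fun_add:
  "frag_extend (\<lambda>x. f x + g x) a = frag_extend f a + frag_extend g a"
  by (simp add: frag_extend_def frag_cmul_distrib2 sum.distrib)

lemma frag_extend_fun_diff:
  "frag_extend (\<lambda>x. f x - g x) a = frag_extend f a - frag_extend g a"
proof -
  have "frag_cmul c (u - v) = frag_cmul c u - frag_cmul c v" for c and u v :: "'c \<Rightarrow>\<^sub>0 int"
    by (metis add_diff_cancel diff_add_cancel frag_cmul_distrib2)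
  note * = this
  show ?thesis
    unfolding frag_extend_def * by (rule sum_subtractf)
qed

text \<open>The homomorphism theorem: \<open>h\<close> is constant on each coset of
  \<open>I\<close>, so the image of a coset is a singleton and \<open>the_elem\<close> reads off its
  value.\<close>

lemma quotient_ring_hom_exists:
  assumes "ring_hom_ring R S h" and "ideal I R" and I: "\<And>x. x \<in> I \<Longrightarrow> h x = \<zero>\<^bsub>S\<^esub>"
  shows "\<exists>\<Psi>. ring_hom_ring (R Quot I) S \<Psi> \<and> (\<forall>x\<in>carrier R. \<Psi> (I +>\<^bsub>R\<^esub> x) = h x)"
proof -
  interpret h: ring_hom_ring R S h by fact
  interpret I: ideal I R by fact
  define \<Psi> where "\<Psi> Z = the_elem (h ` Z)" for Z
  have \<Psi>: "\<Psi> (I +>\<^bsub>R\<^esub> x) = h x" if "x \<in> carrier R" for x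
  proof -
    have "h y = h x" if "y \<in> I +>\<^bsub>R\<^esub> x" for y
    proof -
      obtain i where i: "i \<in> I" "y = i \<oplus>\<^bsub>R\<^esub> x"
        using \<open>y \<in> I +>\<^bsub>R\<^esub> x\<close> by (auto simp: a_r_coset_def')
      then show ?thesis
        using \<open>x \<in> carrier R\<close> I I.a_Hcarr by simp
    qed
    moreover have "x \<in> I +>\<^bsub>R\<^esub> x"
      by (rule I.a_rcos_self[OF that])
    ultimately have "h ` (I +>\<^bsub>R\<^esub> x) = {h x}" by blast
    then show ?thesis by (simp add: \<Psi>_def)
  qed
  have carr: "\<exists>x\<in>carrier R. Z = I +>\<^bsub>R\<^esub> x" if "Z \<in> carrier (R Quot I)" for Z
    using that by (auto simp: FactRing_def A_RCOSETS_def')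
  have "ring_hom_ring (R Quot I) S \<Psi>"
  proof (rule ring_hom_ringI)
    show "ring (R Quot I)" by (rule I.quotient_is_ring)
    show "ring S" by (rule h.S.ring_axioms)
    fix Z assume "Z \<in> carrier (R Quot I)"
    then show "\<Psi> Z \<in> carrier S" using carr \<Psi> by force
  next
    fix Z W assume "Z \<in> carrier (R Quot I)" "W \<in> carrier (R Quot I)"
    then obtain x y where xy: "x \<in> carrier R" "Z = I +>\<^bsub>R\<^esub> x" "y \<in> carrier R" "W = I +>\<^bsub>R\<^esub> y"
      using carr by meson
    show "\<Psi> (Z \<otimes>\<^bsub>R Quot I\<^esub> W) = \<Psi> Z \<otimes>\<^bsub>S\<^esub> \<Psi> W"
      using xy by (simp add: FactRing_def I.rcoset_mult_add \<Psi>)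
    show "\<Psi> (Z \<oplus>\<^bsub>R Quot I\<^esub> W) = \<Psi> Z \<oplus>\<^bsub>S\<^esub> \<Psi> W"
      using xy by (simp add: FactRing_def I.a_rcos_sum \<Psi>)
  next
    show "\<Psi> \<one>\<^bsub>R Quot I\<^esub> = \<one>\<^bsub>S\<^esub>"
      by (simp add: FactRing_def \<Psi>)
  qed
  with \<Psi> show ?thesis by blast
qed

section \<open>The free ring on a commutative semiring of classes and its quotient\<close>

lemma free_ring_on_simps [simp]:
  "carrier (free_ring_on C m u) = {f. Poly_Mapping.keys f \<subseteq> C}"
  "\<one>\<^bsub>free_ring_on C m u\<^esub> = frag_of u"
  "\<zero>\<^bsub>free_ring_on C m u\<^esub> = 0"
  "x \<oplus>\<^bsub>free_ring_on C m u\<^esub> y = x + y"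
  "x \<otimes>\<^bsub>free_ring_on C m u\<^esub> y =
     frag_extend (\<lambda>X. frag_extend (\<lambda>Y. frag_of (m X Y)) y) x"
  by (simp_all add: free_ring_on_def)

text \<open>Both Grothendieck rings are instances: \<open>C\<close> consists of isomorphism classes,
  with product \<open>m\<close>, sum \<open>s\<close> and unit \<open>u\<close>. The sum enters
  through the relations that are divided out, and distributivity makes the additive subgroup that
  they generate an ideal.\<close>

locale split_grothendieck =
  fixes C :: "'c set" and m s :: "'c \<Rightarrow> 'c \<Rightarrow> 'c" and u :: 'c
  assumes m_closed: "X \<in> C \<Longrightarrow> Y \<in> C \<Longrightarrow> m X Y \<in> C"
    and s_closed: "X \<in> C \<Longrightarrow> Y \<in> C \<Longrightarrow> s X Y \<in> C"
    and u_closed: "u \<in> C"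
    and m_assoc: "X \<in> C \<Longrightarrow> Y \<in> C \<Longrightarrow> Z \<in> C \<Longrightarrow> m (m X Y) Z = m X (m Y Z)"
    and m_comm: "X \<in> C \<Longrightarrow> Y \<in> C \<Longrightarrow> m X Y = m Y X"
    and m_unit: "X \<in> C \<Longrightarrow> m u X = X"
    and m_distrib: "X \<in> C \<Longrightarrow> Y \<in> C \<Longrightarrow> Z \<in> C \<Longrightarrow> m X (s Y Z) = s (m X Y) (m X Z)"
begin

definition F :: "('c \<Rightarrow>\<^sub>0 int) ring" where
  "F = free_ring_on C m u"

definition relations :: "('c \<Rightarrow>\<^sub>0 int) set" where
  "relations = {frag_of (s X Y) - frag_of X - frag_of Y | X Y. X \<in> C \<and> Y \<in> C}"

definition I :: "('c \<Rightarrow>\<^sub>0 int) set" where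
  "I = generate (add_monoid F) relations"

definition cls :: "'c \<Rightarrow> ('c \<Rightarrow>\<^sub>0 int) set" where
  "cls X = I +>\<^bsub>F\<^esub> frag_of X"

lemma carrier_F: "carrier F = {x. Poly_Mapping.keys x \<subseteq> C}"
  by (simp add: F_def)

lemma F_simps [simp]:
  "\<one>\<^bsub>F\<^esub> = frag_of u" "\<zero>\<^bsub>F\<^esub> = 0" "x \<oplus>\<^bsub>F\<^esub> y = x + y"
  by (simp_all add: F_def)

lemma F_closed [simp]:
  "0 \<in> carrier F" "X \<in> C \<Longrightarrow> frag_of X \<in> carrier F"
  "x \<in> carrier F \<Longrightarrow> - x \<in> carrier F"
  "x \<in> carrier F \<Longrightarrow> y \<in> carrier F \<Longrightarrow> x + y \<in> carrier F"
  "x \<in> carrier F \<Longrightarrow> y \<in> carrier F \<Longrightarrow> x - y \<in> carrier F"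
  using keys_add[of x y] keys_diff[of x y] by (auto simp: carrier_F)

text \<open>A free abelian group is reached from \<open>0\<close> and its basis by differences, so a
  single case does the work of sums and negatives. The ring laws of \<open>F\<close> are linear in
  each variable and reduce to classes by this rule.\<close>

lemma F_induct [consumes 1, case_names zero diff of]:
  assumes "x \<in> carrier F" and "P 0"
    and "\<And>x y. x \<in> carrier F \<Longrightarrow> y \<in> carrier F \<Longrightarrow> P x \<Longrightarrow> P y \<Longrightarrow> P (x - y)"
    and "\<And>X. X \<in> C \<Longrightarrow> P (frag_of X)"
  shows "P x"
  using assms free_Abelian_group_induct[of x C P] by (simp add: carrier_F)

lemma F_mult_add:
  "(x + y) \<otimes>\<^bsub>F\<^esub> z = x \<otimes>\<^bsub>F\<^esub> z + y \<otimes>\<^bsub>F\<^esub> z"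
  "(x - y) \<otimes>\<^bsub>F\<^esub> z = x \<otimes>\<^bsub>F\<^esub> z - y \<otimes>\<^bsub>F\<^esub> z"
  "z \<otimes>\<^bsub>F\<^esub> (x + y) = z \<otimes>\<^bsub>F\<^esub> x + z \<otimes>\<^bsub>F\<^esub> y"
  "z \<otimes>\<^bsub>F\<^esub> (x - y) = z \<otimes>\<^bsub>F\<^esub> x - z \<otimes>\<^bsub>F\<^esub> y"
  "0 \<otimes>\<^bsub>F\<^esub> x = 0" "x \<otimes>\<^bsub>F\<^esub> 0 = 0" "- x \<otimes>\<^bsub>F\<^esub> z = - (x \<otimes>\<^bsub>F\<^esub> z)"
  by (simp_all add: F_def frag_extend_add frag_extend_diff frag_extend_fun_add
      frag_extend_fun_diff frag_extend_eq_0 frag_extend_minus)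

lemma F_mult_of: "frag_of X \<otimes>\<^bsub>F\<^esub> frag_of Y = frag_of (m X Y)"
  by (simp add: F_def)

lemma F_mult_closed [simp]:
  assumes "x \<in> carrier F" and y: "y \<in> carrier F"
  shows "x \<otimes>\<^bsub>F\<^esub> y \<in> carrier F"
  using assms(1)
proof (induction x rule: F_induct)
  case (of X)
  show ?case using y
    by (induction y rule: F_induct) (use of in \<open>auto simp: F_mult_add F_mult_of m_closed\<close>)
qed (auto simp: F_mult_add)

lemma F_mult_comm:
  assumes "x \<in> carrier F" and y: "y \<in> carrier F"
  shows "x \<otimes>\<^bsub>F\<^esub> y = y \<otimes>\<^bsub>F\<^esub> x"
  using assms(1)
proof (induction x rule: F_induct)
  case (of X)
  show ?case using y
    by (induction y rule: F_induct) (use of in \<open>auto simp: F_mult_add F_mult_of m_comm\<close>)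
qed (auto simp: F_mult_add)

lemma F_mult_assoc:
  assumes "x \<in> carrier F" and y: "y \<in> carrier F" and z: "z \<in> carrier F"
  shows "(x \<otimes>\<^bsub>F\<^esub> y) \<otimes>\<^bsub>F\<^esub> z = x \<otimes>\<^bsub>F\<^esub> (y \<otimes>\<^bsub>F\<^esub> z)"
  using assms(1)
proof (induction x rule: F_induct)
  case (of X)
  show ?case using y
  proof (induction y rule: F_induct)
    case (of Y)
    show ?case using z
      by (induction z rule: F_induct)
        (use of \<open>X \<in> C\<close> in \<open>auto simp: F_mult_add F_mult_of m_assoc\<close>)
  qed (simp_all add: F_mult_add)
qed (simp_all add: F_mult_add)

lemma F_mult_one:
  assumes "x \<in> carrier F"
  shows "frag_of u \<otimes>\<^bsub>F\<^esub> x = x"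
  using assms by (induction x rule: F_induct) (simp_all add: F_mult_add F_mult_of m_unit)

lemma F_cring: "cring F"
proof (rule cringI)
  show "abelian_group F"
  proof (rule abelian_groupI)
    fix x assume "x \<in> carrier F"
    then show "\<exists>y\<in>carrier F. y \<oplus>\<^bsub>F\<^esub> x = \<zero>\<^bsub>F\<^esub>"
      by (intro bexI[of _ "- x"]) auto
  qed (auto simp: add_ac)
  show "Group.comm_monoid F"
    by (rule comm_monoidI)
      (use F_mult_closed F_mult_assoc F_mult_comm F_mult_one u_closed in \<open>auto simp: F_simps\<close>)
qed (simp add: F_mult_add)

sublocale F: cring F
  by (rule F_cring)

lemma F_a_inv: "x \<in> carrier F \<Longrightarrow> \<ominus>\<^bsub>F\<^esub> x = - x"
  by (rule F.add.inv_equality) auto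

lemma F_a_minus: "x \<in> carrier F \<Longrightarrow> y \<in> carrier F \<Longrightarrow> x \<ominus>\<^bsub>F\<^esub> y = x - y"
  by (simp add: a_minus_def F_a_inv)

lemma relations_carrier: "relations \<subseteq> carrier F"
  by (auto simp: relations_def s_closed)

lemma I_subgroup: "subgroup I (add_monoid F)"
  unfolding I_def by (rule F.add.generate_is_subgroup) (use relations_carrier in simp)

text \<open>Multiplying the relation for \<open>X\<close>, \<open>Y\<close> by a class
  \<open>Z\<close> gives the relation for \<open>m Z X\<close>, \<open>m Z Y\<close>. Linearity
  extends this from \<open>Z\<close> to all of \<open>F\<close>, induction over the generated
  subgroup extends it from relations to \<open>I\<close>, and commutativity supplies the other
  side.\<close>

lemma I_ideal: "ideal I F"
proof -
  have rel: "a \<otimes>\<^bsub>F\<^esub> x \<in> I" if "a \<in> relations" "x \<in> carrier F" for a x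
  proof -
    obtain X Y where XY: "X \<in> C" "Y \<in> C" "a = frag_of (s X Y) - frag_of X - frag_of Y"
      using \<open>a \<in> relations\<close> by (auto simp: relations_def)
    show ?thesis using that(2)
    proof (induction x rule: F_induct)
      case zero
      show ?case
        using subgroup.one_closed[OF I_subgroup] by (simp add: F_mult_add)
    next
      case (diff x y)
      have "a \<otimes>\<^bsub>F\<^esub> x \<oplus>\<^bsub>F\<^esub> \<ominus>\<^bsub>F\<^esub> (a \<otimes>\<^bsub>F\<^esub> y) \<in> I"
        using diff subgroup.m_closed[OF I_subgroup] subgroup.m_inv_closed[OF I_subgroup]
        by (simp add: a_inv_def)
      moreover have "a \<in> carrier F" using relations_carrier that by blast
      ultimately show ?case
        using diff by (simp add: F_mult_add F_a_inv)
    next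
      case (of Z)
      have "a \<otimes>\<^bsub>F\<^esub> frag_of Z = frag_of (s (m Z X) (m Z Y)) - frag_of (m Z X) - frag_of (m Z Y)"
        using XY of m_distrib[of Z X Y] m_comm[of Z]
        by (simp add: F_mult_add F_mult_of s_closed)
      also have "\<dots> \<in> relations"
        using XY of m_closed by (auto simp: relations_def)
      finally show ?case by (simp add: I_def generate.incl)
    qed
  qed
  have right: "a \<otimes>\<^bsub>F\<^esub> x \<in> I" if "a \<in> I" "x \<in> carrier F" for a x
    using \<open>a \<in> I\<close> unfolding I_def
  proof (induction a rule: generate.induct)
    case one
    show ?case
      unfolding I_def[symmetric] using subgroup.one_closed[OF I_subgroup] by (simp add: F_mult_add)
  next
    case (incl h)
    then show ?case using rel[OF incl that(2)] unfolding I_def by blast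
  next
    case (inv h)
    have "h \<in> carrier F" using inv relations_carrier by blast
    then have "inv\<^bsub>add_monoid F\<^esub> h \<otimes>\<^bsub>F\<^esub> x = \<ominus>\<^bsub>F\<^esub> (h \<otimes>\<^bsub>F\<^esub> x)"
      using F_a_inv[of h] F_a_inv[of "h \<otimes>\<^bsub>F\<^esub> x"] that
          by (simp only: a_inv_def F_mult_add F_mult_closed)
    also have "\<dots> \<in> I"
      using subgroup.m_inv_closed[OF I_subgroup rel[OF inv that(2)]] by (simp add: a_inv_def)
    finally show ?case unfolding I_def .
  next
    case (eng h1 h2)
    then show ?case
      unfolding I_def[symmetric]
      using subgroup.m_closed[OF I_subgroup, of "h1 \<otimes>\<^bsub>F\<^esub> x" "h2 \<otimes>\<^bsub>F\<^esub> x"]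
      by (simp add: F_mult_add)
  qed
  show ?thesis
  proof (rule idealI)
    fix a x assume "a \<in> I" "x \<in> carrier F"
    moreover from this have "a \<in> carrier F"
      using subgroup.subset[OF I_subgroup] by auto
    ultimately show "x \<otimes>\<^bsub>F\<^esub> a \<in> I"
      using right[of a x] F_mult_comm[of x a] by simp
  next
    show "subgroup I (add_monoid F)" by (rule I_subgroup)
  qed (simp_all add: right F.ring_axioms)
qed

lemma Q_ring: "ring (F Quot I)"
  by (rule ideal.quotient_is_ring[OF I_ideal])

lemma cls_closed: "X \<in> C \<Longrightarrow> cls X \<in> carrier (F Quot I)"
  unfolding cls_def FactRing_def by (auto simp: A_RCOSETS_def')

lemma cls_mult: "X \<in> C \<Longrightarrow> Y \<in> C \<Longrightarrow> cls (m X Y) = cls X \<otimes>\<^bsub>F Quot I\<^esub> cls Y"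
  unfolding cls_def by (simp add: FactRing_def ideal.rcoset_mult_add[OF I_ideal] F_mult_of)

lemma cls_one: "cls u = \<one>\<^bsub>F Quot I\<^esub>"
  unfolding cls_def by (simp add: FactRing_def)

lemma cls_add:
  assumes "X \<in> C" "Y \<in> C"
  shows "cls (s X Y) = cls X \<oplus>\<^bsub>F Quot I\<^esub> cls Y"
proof -
  interpret I: ideal I F by (rule I_ideal)
  have "frag_of (s X Y) \<ominus>\<^bsub>F\<^esub> (frag_of X + frag_of Y) \<in> I"
  proof -
    have "frag_of (s X Y) - frag_of X - frag_of Y \<in> I"
      using assms unfolding I_def by (intro generate.incl) (auto simp: relations_def)
    then show ?thesis
      using assms by (simp add: F_a_minus s_closed diff_diff_eq)
  qed
  then have "I +>\<^bsub>F\<^esub> frag_of (s X Y) = I +>\<^bsub>F\<^esub> (frag_of X + frag_of Y)"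
    using assms F.quotient_eq_iff_same_a_r_cos[OF I_ideal] by (simp add: s_closed)
  then show ?thesis
    using assms unfolding cls_def by (simp add: FactRing_def I.a_rcos_sum)
qed

lemma quotient_induct [consumes 1, case_names zero diff cls]:
  assumes "Z \<in> carrier (F Quot I)"
    and zero: "P \<zero>\<^bsub>F Quot I\<^esub>"
    and "\<And>x y. x \<in> carrier (F Quot I) \<Longrightarrow> y \<in> carrier (F Quot I) \<Longrightarrow> P x \<Longrightarrow> P y
      \<Longrightarrow> P (x \<ominus>\<^bsub>F Quot I\<^esub> y)"
    and "\<And>X. X \<in> C \<Longrightarrow> P (cls X)"
  shows "P Z"
proof -
  interpret \<pi>: ring_hom_ring F "F Quot I" "(+>\<^bsub>F\<^esub>) I"
    by (rule ideal.rcos_ring_hom_ring[OF I_ideal])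
  obtain x where x: "x \<in> carrier F" "Z = I +>\<^bsub>F\<^esub> x"
    using assms(1) by (auto simp: FactRing_def A_RCOSETS_def')
  from x(1) have "P (I +>\<^bsub>F\<^esub> x)"
  proof (induction x rule: F_induct)
    case zero
    show ?case using assms(2) \<pi>.hom_zero by simp
  next
    case (diff x y)
    have "I +>\<^bsub>F\<^esub> (x \<ominus>\<^bsub>F\<^esub> y) = (I +>\<^bsub>F\<^esub> x) \<ominus>\<^bsub>F Quot I\<^esub> (I +>\<^bsub>F\<^esub> y)"
      using diff by (simp add: a_minus_def del: F_simps)
    then show ?case
      using diff assms(3)[of "I +>\<^bsub>F\<^esub> x" "I +>\<^bsub>F\<^esub> y"] by (simp add: F_a_minus)
  next
    case (of X)
    then show ?case using assms(4) by (simp add: cls_def)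
  qed
  then show ?thesis using x by simp
qed

section \<open>Universal property of the split Grothendieck ring\<close>

lemma hom_unique:
  assumes "ring_hom_ring (F Quot I) R f" "ring_hom_ring (F Quot I) R g"
    and "\<And>X. X \<in> C \<Longrightarrow> f (cls X) = g (cls X)" and "Z \<in> carrier (F Quot I)"
  shows "f Z = g Z"
proof -
  interpret f: ring_hom_ring "F Quot I" R f by fact
  interpret g: ring_hom_ring "F Quot I" R g by fact
  from assms(4) show ?thesis
  proof (induction rule: quotient_induct)
    case (diff x y)
    then show ?case by (simp add: a_minus_def)
  qed (use assms(3) in simp_all)
qed

text \<open>The universal property of the free abelian group gives an additive extension
  \<open>h'\<close> of \<open>h\<close>. It is multiplicative because it is so on classes, it
  vanishes on the relations because \<open>h\<close> respects \<open>s\<close>, and so it factors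
  through the quotient.\<close>

lemma hom_exists:
  assumes "ring R" and h: "h \<in> C \<rightarrow> carrier R"
    and mult: "\<And>X Y. X \<in> C \<Longrightarrow> Y \<in> C \<Longrightarrow> h (m X Y) = h X \<otimes>\<^bsub>R\<^esub> h Y"
    and add: "\<And>X Y. X \<in> C \<Longrightarrow> Y \<in> C \<Longrightarrow> h (s X Y) = h X \<oplus>\<^bsub>R\<^esub> h Y"
    and one: "h u = \<one>\<^bsub>R\<^esub>"
  obtains \<Psi> where "ring_hom_ring (F Quot I) R \<Psi>" "\<And>X. X \<in> C \<Longrightarrow> \<Psi> (cls X) = h X"
proof -
  interpret R: ring R by fact
  have "comm_group (add_monoid R)" by (rule R.a_comm_group)
  then obtain h' where h': "h' \<in> hom (free_Abelian_group C) (add_monoid R)"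
      and h'_of: "\<And>X. X \<in> C \<Longrightarrow> h' (frag_of X) = h X"
    using comm_group.free_Abelian_group_universal[of "add_monoid R" h C] h by auto
  have closed [simp]: "h' x \<in> carrier R" if "x \<in> carrier F" for x
    using h' that by (auto simp: hom_def carrier_F)
  have h'_add: "h' (x + y) = h' x \<oplus>\<^bsub>R\<^esub> h' y" if "x \<in> carrier F" "y \<in> carrier F" for x y
    using h' that by (simp add: hom_def carrier_F)
  have h'_0: "h' 0 = \<zero>\<^bsub>R\<^esub>"
    using h'_add[of 0 0] closed[of 0] by simp
  have h'_diff: "h' (x - y) = h' x \<ominus>\<^bsub>R\<^esub> h' y" if "x \<in> carrier F" "y \<in> carrier F" for x y
  proof -
    have "h' x = h' (x - y) \<oplus>\<^bsub>R\<^esub> h' y"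
      using h'_add[of "x - y" y] that by simp
    then show ?thesis
      using that by (simp add: a_minus_def R.a_assoc R.r_neg)
  qed
  have hom: "ring_hom_ring F R h'"
  proof (rule ring_hom_ringI)
    fix x y assume x: "x \<in> carrier F" and y: "y \<in> carrier F"
    from x show "h' (x \<otimes>\<^bsub>F\<^esub> y) = h' x \<otimes>\<^bsub>R\<^esub> h' y"
    proof (induction x rule: F_induct)
      case zero
      then show ?case using y by (simp add: F_mult_add h'_0)
    next
      case (diff a b)
      then show ?case
        using y by (simp add: F_mult_add h'_diff R.minus_eq R.l_distr R.l_minus)
    next
      case (of X)
      show ?case using y
      proof (induction y rule: F_induct)
        case zero
        then show ?case using of by (simp add: F_mult_add h'_0)
      next
        case (diff a b)
        then show ?case
          using of by (simp add: F_mult_add h'_diff R.minus_eq R.r_distr R.r_minus)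
      next
        case (of Y)
        then show ?case using \<open>X \<in> C\<close> by (simp add: F_mult_of h'_of m_closed mult)
      qed
    qed
  next
    show "h' \<one>\<^bsub>F\<^esub> = \<one>\<^bsub>R\<^esub>" using h'_of u_closed one by simp
  qed (simp_all add: h'_add F.ring_axioms assms(1))
  then interpret h': ring_hom_ring F R h' .
  have rel: "h' x = \<zero>\<^bsub>R\<^esub>" if "x \<in> relations" for x
  proof -
    obtain X Y where XY: "X \<in> C" "Y \<in> C" "x = frag_of (s X Y) - frag_of X - frag_of Y"
      using \<open>x \<in> relations\<close> unfolding relations_def by blast
    have hXY: "h X \<in> carrier R" "h Y \<in> carrier R" using h XY by auto
    have "h' x = h Y \<oplus>\<^bsub>R\<^esub> h X \<ominus>\<^bsub>R\<^esub> h X \<ominus>\<^bsub>R\<^esub> h Y"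
      using XY hXY by (simp add: h'_diff h'_of s_closed add R.a_comm)
    also have "\<dots> = \<zero>\<^bsub>R\<^esub>"
      using hXY by (simp add: R.minus_eq R.a_assoc R.r_neg)
    finally show ?thesis .
  qed
  have ker: "h' x = \<zero>\<^bsub>R\<^esub>" if "x \<in> I" for x
    using that unfolding I_def
  proof (induction x rule: generate.induct)
    case one
    then show ?case by (simp add: h'_0)
  next
    case (incl x)
    then show ?case by (rule rel)
  next
    case (inv x)
    then have "x \<in> carrier F" using relations_carrier by blast
    then have "h' (\<ominus>\<^bsub>F\<^esub> x) = \<zero>\<^bsub>R\<^esub>" using rel[OF inv] by simp
    then show ?case by (simp add: a_inv_def)
  next
    case (eng x y)
    then have "x \<in> carrier F" "y \<in> carrier F"
      using subgroup.subset[OF I_subgroup] unfolding I_def by auto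
    then show ?case using eng h'_add by simp
  qed
  obtain \<Psi> where "ring_hom_ring (F Quot I) R \<Psi>"
    and \<Psi>: "\<forall>x\<in>carrier F. \<Psi> (I +>\<^bsub>F\<^esub> x) = h' x"
    using quotient_ring_hom_exists[OF hom I_ideal ker] by blast
  show thesis
  proof (rule that)
    show "ring_hom_ring (F Quot I) R \<Psi>" by fact
    fix X assume "X \<in> C"
    then show "\<Psi> (cls X) = h X"
      using bspec[OF \<Psi>, of "frag_of X"] by (simp add: cls_def h'_of)
  qed
qed

end

section \<open>Finite pointed sets with a self-map\<close>

lemma t_isomorphic_sym:
  assumes "finite_t_module M" "t_isomorphic M N"
  shows "t_isomorphic N M"
proof -
  obtain f where f: "f \<in> t_hom M N" "bij_betw f (carrier M) (carrier N)"
    using assms(2) by (auto simp: t_isomorphic_def)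
  have inv: "inv_into (carrier M) f (f x) = x" if "x \<in> carrier M" for x
    using bij_betw_inv_into_left[OF f(2)] that by simp
  have "inv_into (carrier M) f \<in> t_hom N M"
    unfolding t_hom_def
  proof (intro CollectI conjI ballI)
    show "inv_into (carrier M) f \<in> carrier N \<rightarrow> carrier M"
      using bij_betw_inv_into[OF f(2)] by (auto simp: bij_betw_def)
    show "inv_into (carrier M) f (base N) = base M"
      using f(1) inv[of "base M"] assms(1) by (auto simp: t_hom_def finite_t_module_def)
    fix y assume "y \<in> carrier N"
    then obtain x where x: "x \<in> carrier M" "y = f x"
      using f(2) by (auto simp: bij_betw_def)
    have "act M x \<in> carrier M" using x assms(1) by (auto simp: finite_t_module_def)
    then show "inv_into (carrier M) f (act N y) = act M (inv_into (carrier M) f y)"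
      using x f(1) inv[of "act M x"] inv[of x] by (auto simp: t_hom_def)
  qed
  then show ?thesis
    using bij_betw_inv_into[OF f(2)] by (auto simp: t_isomorphic_def)
qed

lemma t_isomorphic_trans:
  assumes "t_isomorphic L M" "t_isomorphic M N"
  shows "t_isomorphic L N"
proof -
  obtain f g where fg: "f \<in> t_hom L M" "bij_betw f (carrier L) (carrier M)"
      "g \<in> t_hom M N" "bij_betw g (carrier M) (carrier N)"
    using assms by (auto simp: t_isomorphic_def)
  have "g \<circ> f \<in> t_hom L N"
    using fg(1,3) by (auto simp: t_hom_def)
  then show ?thesis
    using bij_betw_trans[OF fg(2,4)] by (auto simp: t_isomorphic_def)
qed

lemma t_class_of_eqI:
  assumes "finite_t_module M" "t_isomorphic M N"
  shows "t_class_of M = t_class_of N"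
  using t_isomorphic_sym[OF assms] assms(2)
  by (auto simp: t_class_of_def intro: t_isomorphic_trans)

text \<open>An enumeration of the carrier transports the structure to natural numbers. Products and
  sums of classes are unions over representatives, and an empty class would make them empty.\<close>

lemma t_class_of_inhabited:
  assumes M: "finite_t_module M"
  obtains N where "N \<in> t_class_of M"
proof -
  obtain f where f: "bij_betw f (carrier M) {0..<card (carrier M)}"
    using M ex_bij_betw_finite_nat by (auto simp: finite_t_module_def)
  define g where "g = inv_into (carrier M) f"
  define N where "N = \<lparr>carrier = {0..<card (carrier M)}, base = f (base M), act = (\<lambda>n. f (act M (g
      n)))\<rparr>"
  have g: "g (f x) = x" if "x \<in> carrier M" for x
    unfolding g_def using bij_betw_inv_into_left[OF f] that by simp
  have g': "g n \<in> carrier M" if "n < card (carrier M)" for n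
    unfolding g_def using bij_betw_inv_into[OF f] that by (auto simp: bij_betw_def)
  have f': "f x < card (carrier M)" if "x \<in> carrier M" for x
    using f that by (auto simp: bij_betw_def)
  have "finite_t_module N"
    using M by (auto simp: finite_t_module_def N_def g g' f' Pi_def)
  moreover have "f \<in> t_hom M N"
    using M by (auto simp: t_hom_def N_def g f' finite_t_module_def)
  ultimately have "N \<in> t_class_of M"
    using f by (auto simp: t_class_of_def t_isomorphic_def N_def)
  then show thesis by (rule that)
qed

lemma t_class_of_member:
  assumes "finite_t_module M" "N \<in> t_class_of M"
  shows "finite_t_module N" "t_class_of N = t_class_of M"
  using assms t_class_of_eqI[of M N] by (auto simp: t_class_of_def)

lemma t_class_of_in_classes:
  assumes "finite_t_module M"
  shows "t_class_of M \<in> t_classes"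
proof -
  obtain N where "N \<in> t_class_of M" using t_class_of_inhabited[OF assms] .
  then show ?thesis
    using t_class_of_member[OF assms] by (force simp: t_classes_def)
qed

text \<open>A finite pointed set with a self-map is the same as a finite set with a partial self-map,
  the base point playing the role of \<open>None\<close>.\<close>

definition partial_map :: "'b set \<Rightarrow> ('b \<Rightarrow> 'b option) \<Rightarrow> bool" where
  "partial_map B s \<longleftrightarrow> finite B \<and> (\<forall>b\<in>B. \<forall>c. s b = Some c \<longrightarrow> c \<in> B)"

definition opt_module :: "'b set \<Rightarrow> ('b \<Rightarrow> 'b option) \<Rightarrow> 'b option t_module" where
  "opt_module B s =
     \<lparr>carrier = insert None (Some ` B), base = None, act = (\<lambda>x. Option.bind x s)\<rparr>"

definition t_cls :: "'b set \<Rightarrow> ('b \<Rightarrow> 'b option) \<Rightarrow> t_class" where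
  "t_cls B s = t_class_of (opt_module B s)"

definition to_partial_map :: "'a t_module \<Rightarrow> 'a \<Rightarrow> 'a option" where
  "to_partial_map M x = (if act M x = base M then None else Some (act M x))"

text \<open>Undefined as soon as one factor is: a pair with one coordinate at the base point is
  collapsed to the base point of the smash product.\<close>

definition prod_map :: "('b \<Rightarrow> 'b option) \<Rightarrow> ('c \<Rightarrow> 'c option) \<Rightarrow> 'b \<times> 'c \<Rightarrow> ('b \<times> 'c) option" where
  "prod_map s r = (\<lambda>(b, c). Option.bind (s b) (\<lambda>b'. map_option (Pair b') (r c)))"

definition sum_map :: "('b \<Rightarrow> 'b option) \<Rightarrow> ('c \<Rightarrow> 'c option) \<Rightarrow> 'b + 'c \<Rightarrow> ('b + 'c) option" where
  "sum_map s r = case_sum (\<lambda>b. map_option Inl (s b)) (\<lambda>c. map_option Inr (r c))"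

lemma finite_opt_module: "partial_map B s \<Longrightarrow> finite_t_module (opt_module B s)"
  by (auto simp: partial_map_def finite_t_module_def opt_module_def image_iff split_option_ex)
    (metis option.exhaust)

lemma partial_map_prod: "partial_map B s \<Longrightarrow> partial_map C r \<Longrightarrow> partial_map (B \<times> C) (prod_map s r)"
  by (auto simp: partial_map_def prod_map_def bind_eq_Some_conv)

lemma partial_map_sum: "partial_map B s \<Longrightarrow> partial_map C r \<Longrightarrow> partial_map (Sum_Type.Plus B C) (sum_map
    s r)"
  by (auto simp: partial_map_def sum_map_def)

lemma partial_map_to_partial_map:
  "finite_t_module M \<Longrightarrow> partial_map (carrier M - {base M}) (to_partial_map M)"
  by (auto simp: partial_map_def to_partial_map_def finite_t_module_def split: if_splits)

lemma t_isomorphic_opt_module: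
  assumes "finite_t_module M"
  shows "t_isomorphic M (opt_module (carrier M - {base M}) (to_partial_map M))"
proof -
  let ?f = "\<lambda>x. if x = base M then None else Some x"
  have "?f \<in> t_hom M (opt_module (carrier M - {base M}) (to_partial_map M))"
    using assms by (auto simp: t_hom_def opt_module_def to_partial_map_def finite_t_module_def)
  moreover have "bij_betw ?f (carrier M) (carrier (opt_module (carrier M - {base M}) (to_partial_map
      M)))"
    by (rule bij_betwI[where g = "\<lambda>x. case x of None \<Rightarrow> base M | Some y \<Rightarrow> y"])
      (use assms in \<open>auto simp: opt_module_def finite_t_module_def\<close>)
  ultimately show ?thesis by (auto simp: t_isomorphic_def)
qed

lemma t_class_of_eq_t_cls:
  "finite_t_module M \<Longrightarrow> t_class_of M = t_cls (carrier M - {base M}) (to_partial_map M)"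
  unfolding t_cls_def by (intro t_class_of_eqI t_isomorphic_opt_module)

lemma t_cls_in_classes: "partial_map B s \<Longrightarrow> t_cls B s \<in> t_classes"
  unfolding t_cls_def by (intro t_class_of_in_classes finite_opt_module)

lemma t_classesE:
  assumes "X \<in> t_classes"
  obtains B :: "nat set" and s where "partial_map B s" "X = t_cls B s"
proof -
  obtain M :: "nat t_module" where "finite_t_module M" "X = t_class_of M"
    using assms by (auto simp: t_classes_def)
  then show thesis
    using that partial_map_to_partial_map t_class_of_eq_t_cls by metis
qed

text \<open>The tool for identities between classes of pointed modules: it suffices to give a
  bijection of index sets that carries one partial map to the other.\<close>

lemma t_cls_reindex:
  assumes "partial_map B s" "bij_betw g B B'" "\<And>b. b \<in> B \<Longrightarrow> s' (g b) = map_option g (s b)"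
  shows "t_cls B s = t_cls B' s'"
  unfolding t_cls_def
proof (rule t_class_of_eqI[OF finite_opt_module[OF assms(1)]])
  have "map_option g \<in> t_hom (opt_module B s) (opt_module B' s')"
    using assms by (auto simp: t_hom_def opt_module_def bij_betw_def)
  moreover have "bij_betw (map_option g) (carrier (opt_module B s)) (carrier (opt_module B' s'))"
    using assms(2) by (force simp: opt_module_def bij_betw_def inj_on_def image_iff)
  ultimately show "t_isomorphic (opt_module B s) (opt_module B' s')"
    by (auto simp: t_isomorphic_def)
qed

text \<open>The map \<open>\<chi>\<close> sends a pair to its two coordinates, and to
  \<open>None\<close> exactly on the wedge. Hence \<open>smash_rel\<close> is the relation of having
  the same value under \<open>\<chi>\<close>, its classes are the fibres \<open>cl v\<close>, and
  \<open>cl\<close> is an isomorphism from the module of \<open>prod_map s r\<close> onto the smash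
  product.\<close>

lemma t_class_of_smash:
  assumes M: "finite_t_module M" and N: "finite_t_module N"
    and B: "partial_map B s" and C: "partial_map C r"
    and MB: "t_isomorphic M (opt_module B s)" and NC: "t_isomorphic N (opt_module C r)"
  shows "t_class_of (smash M N) = t_cls (B \<times> C) (prod_map s r)"
proof -
  obtain f where f: "f \<in> t_hom M (opt_module B s)" "bij_betw f (carrier M) (insert None (Some ` B))"
    using MB by (auto simp: t_isomorphic_def opt_module_def)
  obtain g where g: "g \<in> t_hom N (opt_module C r)" "bij_betw g (carrier N) (insert None (Some ` C))"
    using NC by (auto simp: t_isomorphic_def opt_module_def)
  define \<chi> where "\<chi> = (\<lambda>(x, y). Option.bind (f x) (\<lambda>b. map_option (Pair b) (g y)))"
  define P where "P = carrier M \<times> carrier N"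
  define cl where "cl v = {q \<in> P. \<chi> q = v}" for v
  have fb: "f (base M) = None" and gb: "g (base N) = None"
    using f(1) g(1) by (auto simp: t_hom_def opt_module_def)
  have f_inj: "f x = f y \<Longrightarrow> x = y" if "x \<in> carrier M" "y \<in> carrier M" for x y
    using that f(2) by (auto simp: bij_betw_def inj_on_def)
  have g_inj: "g x = g y \<Longrightarrow> x = y" if "x \<in> carrier N" "y \<in> carrier N" for x y
    using that g(2) by (auto simp: bij_betw_def inj_on_def)
  have f_None: "f x = None \<longleftrightarrow> x = base M" if "x \<in> carrier M" for x
    using that f_inj[of x "base M"] fb M by (auto simp: finite_t_module_def)
  have g_None: "g x = None \<longleftrightarrow> x = base N" if "x \<in> carrier N" for x
    using that g_inj[of x "base N"] gb N by (auto simp: finite_t_module_def)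
  have \<chi>_None: "\<chi> q = None \<longleftrightarrow> q \<in> wedge_carrier M N" if "q \<in> P" for q
    using that f_None g_None M N
    by (auto simp: \<chi>_def P_def wedge_carrier_def bind_eq_None_conv finite_t_module_def split:
        Option.bind_splits)
  have W: "wedge_carrier M N \<subseteq> P"
    using M N by (auto simp: wedge_carrier_def P_def finite_t_module_def)
  have \<chi>_Some: "\<chi> (x, y) = Some (b, c) \<longleftrightarrow> f x = Some b \<and> g y = Some c" for x y b c
    by (auto simp: \<chi>_def bind_eq_Some_conv)
  have \<chi>_inj: "p = q" if pq: "p \<in> P" "q \<in> P" "\<chi> p = \<chi> q" "\<chi> p \<noteq> None" for p q
  proof -
    obtain x y x' y' b c where *: "p = (x, y)" "q = (x', y')" "\<chi> p = Some (b, c)"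
      using pq by (metis surj_pair option.exhaust)
    then have "f x = f x'" "g y = g y'"
      using pq(3) \<chi>_Some[of x y b c] \<chi>_Some[of x' y' b c] by simp_all
    then show ?thesis
      using * pq(1,2) f_inj[of x x'] g_inj[of y y'] by (simp add: P_def)
  qed
  have rel: "(p, q) \<in> smash_rel M N \<longleftrightarrow> p \<in> P \<and> q \<in> P \<and> \<chi> p = \<chi> q" for p q
  proof -
    have "x \<in> wedge_carrier M N \<longleftrightarrow> x \<in> P \<and> \<chi> x = None" for x using \<chi>_None W by blast
    then show ?thesis using \<chi>_inj[of p q] unfolding smash_rel_def P_def[symmetric]
      by (cases "\<chi> p = None") (auto simp: Id_on_def)
  qed
  have \<chi>_surj: "\<chi> ` P = insert None (Some ` (B \<times> C))"
  proof (intro equalityI subsetI)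
    fix v assume "v \<in> \<chi> ` P"
    then show "v \<in> insert None (Some ` (B \<times> C))"
    proof -
      obtain x y where xy: "x \<in> carrier M" "y \<in> carrier N" "v = \<chi> (x, y)"
        using \<open>v \<in> \<chi> ` P\<close> by (auto simp: P_def)
      then have "f x \<in> insert None (Some ` B)" "g y \<in> insert None (Some ` C)"
        using f(2) g(2) by (auto simp: bij_betw_def)
      then show ?thesis using xy by (auto simp: \<chi>_def)
    qed
  next
    fix v assume v: "v \<in> insert None (Some ` (B \<times> C))"
    show "v \<in> \<chi> ` P"
    proof (cases v)
      case None
      then show ?thesis using fb M N
          by (auto simp: P_def \<chi>_def finite_t_module_def intro!: image_eqI[of _ _ "(base M, base
              N)"])
    next
      case (Some w)
      obtain b c where bc: "w = (b, c)" "b \<in> B" "c \<in> C" using Some v by auto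
      have "Some b \<in> f ` carrier M" "Some c \<in> g ` carrier N"
        using f(2) g(2) bc by (simp_all add: bij_betw_def)
      then obtain x y where "x \<in> carrier M" "f x = Some b" "y \<in> carrier N" "g y = Some c"
        by (metis imageE)
      then show ?thesis using Some bc by (auto simp: P_def \<chi>_def intro!: image_eqI[of _ _ "(x, y)"])
    qed
  qed
  have \<chi>_act: "\<chi> (map_prod (act M) (act N) q) = Option.bind (\<chi> q) (prod_map s r)" if "q \<in> P" for q
  proof -
    obtain x y where q: "q = (x, y)" "x \<in> carrier M" "y \<in> carrier N"
      using \<open>q \<in> P\<close> by (auto simp: P_def)
    then have "f (act M x) = Option.bind (f x) s" "g (act N y) = Option.bind (g y) r"
      using f(1) g(1) by (auto simp: t_hom_def opt_module_def)
    then show ?thesis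
      by (cases "f x"; cases "g y") (simp_all add: q \<chi>_def prod_map_def)
  qed
  have P_act: "map_prod (act M) (act N) q \<in> P" if "q \<in> P" for q
    using that M N by (auto simp: P_def finite_t_module_def)
  have carrier: "carrier (smash M N) = cl ` insert None (Some ` (B \<times> C))"
  proof -
    have "smash_rel M N `` {q} = cl (\<chi> q)" if "q \<in> P" for q
      using that by (auto simp: rel cl_def)
    then show ?thesis
      unfolding smash_def quotient_def \<chi>_surj[symmetric]
          by (auto simp: P_def[symmetric] image_image)
  qed
  have "base (smash M N) = cl None"
  proof -
    have "x \<in> wedge_carrier M N \<longleftrightarrow> x \<in> P \<and> \<chi> x = None" for x using \<chi>_None W by blast
    then show ?thesis unfolding smash_def cl_def by (simp add: Set.set_eq_iff)
  qed
  moreover have "act (smash M N) (cl v) = cl (Option.bind v (prod_map s r))"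
    if v: "v \<in> insert None (Some ` (B \<times> C))" for v
  proof -
    have "v \<in> \<chi> ` P" using v unfolding \<chi>_surj .
    then obtain p where "p \<in> P" "\<chi> p = v" by (metis imageE)
    \<comment> \<open>The action takes the image of a class, which need not fill a class, and then
      saturates it. The element \<open>p\<close> shows that the fibre is not empty, so the
      saturation is all of the target fibre.\<close>
    have "smash_rel M N `` (map_prod (act M) (act N) ` cl v) = cl (Option.bind v (prod_map s r))"
    proof (intro equalityI subsetI)
      fix q assume "q \<in> smash_rel M N `` (map_prod (act M) (act N) ` cl v)"
      then obtain p'' where p'': "p'' \<in> map_prod (act M) (act N) ` cl v" "(p'', q) \<in> smash_rel M N"
        by (rule ImageE)
      from p''(1) obtain p' where "p'' = map_prod (act M) (act N) p'" "p' \<in> cl v"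
        by (rule imageE)
      then have "p' \<in> cl v" "(map_prod (act M) (act N) p', q) \<in> smash_rel M N"
        using p''(2) by simp_all
      then show "q \<in> cl (Option.bind v (prod_map s r))"
        unfolding rel cl_def using \<chi>_act[of p'] by simp
    next
      fix q assume "q \<in> cl (Option.bind v (prod_map s r))"
      then have "(map_prod (act M) (act N) p, q) \<in> smash_rel M N"
        unfolding rel cl_def using \<chi>_act[OF \<open>p \<in> P\<close>] P_act[OF \<open>p \<in> P\<close>] \<open>\<chi> p = v\<close> by simp
      moreover have "p \<in> cl v" using \<open>p \<in> P\<close> \<open>\<chi> p = v\<close> by (simp add: cl_def)
      ultimately show "q \<in> smash_rel M N `` (map_prod (act M) (act N) ` cl v)"
        by (rule ImageI[OF _ imageI])
    qed
    then show ?thesis by (simp add: smash_def)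
  qed
  ultimately have hom: "cl \<in> t_hom (opt_module (B \<times> C) (prod_map s r)) (smash M N)"
    unfolding t_hom_def opt_module_def carrier by simp
  have "inj_on cl (insert None (Some ` (B \<times> C)))"
  proof (rule inj_onI)
    fix v w assume "v \<in> insert None (Some ` (B \<times> C))" and eq: "cl v = cl w"
    then have "v \<in> \<chi> ` P" unfolding \<chi>_surj by simp
    then obtain p where "p \<in> P" "\<chi> p = v" by (metis imageE)
    then have "p \<in> cl w" using eq by (auto simp: cl_def)
    then show "v = w" using \<open>\<chi> p = v\<close> by (simp add: cl_def)
  qed
  then have "t_isomorphic (opt_module (B \<times> C) (prod_map s r)) (smash M N)"
    using hom unfolding t_isomorphic_def bij_betw_def carrier by (auto simp: opt_module_def)
  then show ?thesis
    unfolding t_cls_def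
    by (intro t_class_of_eqI[symmetric] finite_opt_module partial_map_prod B C)
qed

text \<open>On the wedge at least one coordinate is the base point, so \<open>\<chi>\<close> may
  read the first coordinate and fall back on the second without losing anything.\<close>

lemma t_class_of_wedge:
  assumes M: "finite_t_module M" and N: "finite_t_module N"
    and B: "partial_map B s" and C: "partial_map C r"
    and MB: "t_isomorphic M (opt_module B s)" and NC: "t_isomorphic N (opt_module C r)"
  shows "t_class_of (wedge M N) = t_cls (Sum_Type.Plus B C) (sum_map s r)"
proof -
  obtain f where f: "f \<in> t_hom M (opt_module B s)" "bij_betw f (carrier M) (insert None (Some ` B))"
    using MB by (auto simp: t_isomorphic_def opt_module_def)
  obtain g where g: "g \<in> t_hom N (opt_module C r)" "bij_betw g (carrier N) (insert None (Some ` C))"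
    using NC by (auto simp: t_isomorphic_def opt_module_def)
  define \<chi> where "\<chi> = (\<lambda>(x, y). case f x of Some b \<Rightarrow> Some (Inl b) | None \<Rightarrow> map_option Inr (g y))"
  have fb: "f (base M) = None" and gb: "g (base N) = None"
    using f(1) g(1) by (auto simp: t_hom_def opt_module_def)
  have f_inj: "f x = f y \<Longrightarrow> x = y" if "x \<in> carrier M" "y \<in> carrier M" for x y
    using that f(2) by (auto simp: bij_betw_def inj_on_def)
  have g_inj: "g x = g y \<Longrightarrow> x = y" if "x \<in> carrier N" "y \<in> carrier N" for x y
    using that g(2) by (auto simp: bij_betw_def inj_on_def)
  have bM: "base M \<in> carrier M" "act M (base M) = base M"
      and bN: "base N \<in> carrier N" "act N (base N) = base N"
    using M N by (auto simp: finite_t_module_def)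
  have fin: "finite_t_module (wedge M N)"
    using M N by (auto simp: finite_t_module_def wedge_def wedge_carrier_def)
  have hom: "\<chi> \<in> t_hom (wedge M N) (opt_module (Sum_Type.Plus B C) (sum_map s r))"
  proof -
    have "\<chi> q \<in> insert None (Some ` (Sum_Type.Plus B C))" if "q \<in> wedge_carrier M N" for q
    proof -
      have "f x \<in> insert None (Some ` B)" if "x \<in> carrier M" for x using f(2) that
          by (auto simp: bij_betw_def)
      moreover have "g x \<in> insert None (Some ` C)" if "x \<in> carrier N" for x using g(2) that
          by (auto simp: bij_betw_def)
      ultimately show ?thesis
        using that bM bN by (cases q) (fastforce simp: \<chi>_def wedge_carrier_def fb gb split:
            option.splits)
    qed
    moreover have "\<chi> (map_prod (act M) (act N) q) = Option.bind (\<chi> q) (sum_map s r)"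
      if "q \<in> wedge_carrier M N" for q
      using that f(1) g(1) bM bN unfolding t_hom_def \<chi>_def opt_module_def sum_map_def
          wedge_carrier_def
      by (auto simp: fb gb map_option_case split: Option.bind_splits option.splits)
    ultimately show ?thesis
      by (auto simp: t_hom_def wedge_def opt_module_def \<chi>_def fb gb)
  qed
  have "bij_betw \<chi> (carrier (wedge M N)) (insert None (Some ` (Sum_Type.Plus B C)))"
  proof (rule bij_betw_imageI)
    show "inj_on \<chi> (carrier (wedge M N))"
    proof (rule inj_onI)
      fix p q assume "p \<in> carrier (wedge M N)" "q \<in> carrier (wedge M N)" and eq: "\<chi> p = \<chi> q"
      then have pq: "p \<in> wedge_carrier M N" "q \<in> wedge_carrier M N" by (auto simp: wedge_def)
      obtain x y x' y' where [simp]: "p = (x, y)" "q = (x', y')" by (cases p, cases q)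
      have *: "x \<in> carrier M" "x' \<in> carrier M" "y \<in> carrier N" "y' \<in> carrier N"
        using pq bM bN by (auto simp: wedge_carrier_def)
      have "f x = f x' \<and> g y = g y'"
        using pq eq fb gb by (auto simp: \<chi>_def wedge_carrier_def map_option_case split:
            option.splits)
      then show "p = q" using f_inj g_inj * by auto
    qed
    show "\<chi> ` carrier (wedge M N) = insert None (Some ` (Sum_Type.Plus B C))"
    proof
      show "\<chi> ` carrier (wedge M N) \<subseteq> insert None (Some ` (Sum_Type.Plus B C))"
        using hom by (auto simp: t_hom_def opt_module_def)
      show "insert None (Some ` (Sum_Type.Plus B C)) \<subseteq> \<chi> ` carrier (wedge M N)"
      proof
        fix v assume v: "v \<in> insert None (Some ` (Sum_Type.Plus B C))"
        consider "v = None" | b where "b \<in> B" "v = Some (Inl b)" | c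
            where "c \<in> C" "v = Some (Inr c)"
          using v by auto
        then show "v \<in> \<chi> ` carrier (wedge M N)"
        proof cases
          case 1
          then show ?thesis using bM bN
            by (intro image_eqI[of _ _ "(base M, base N)"]) (auto simp: \<chi>_def fb gb wedge_def
                wedge_carrier_def)
        next
          case (2 b)
          then obtain x where "x \<in> carrier M" "f x = Some b"
            using f(2) unfolding bij_betw_def by (metis imageE imageI insertI2)
          then show ?thesis using 2
            by (intro image_eqI[of _ _ "(x, base N)"]) (auto simp: \<chi>_def fb gb wedge_def
                wedge_carrier_def)
        next
          case (3 c)
          then obtain x where "x \<in> carrier N" "g x = Some c"
            using g(2) unfolding bij_betw_def by (metis imageE imageI insertI2)
          then show ?thesis using 3
            by (intro image_eqI[of _ _ "(base M, x)"]) (auto simp: \<chi>_def fb gb wedge_def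
                wedge_carrier_def)
        qed
      qed
    qed
  qed
  then have "t_isomorphic (wedge M N) (opt_module (Sum_Type.Plus B C) (sum_map s r))"
    using hom by (auto simp: t_isomorphic_def opt_module_def)
  then show ?thesis
    unfolding t_cls_def by (rule t_class_of_eqI[OF fin])
qed

text \<open>The defining relations of the ring mention sums of modules only. This operation on
  classes, built like \<open>t_class_mult\<close>, brings them into the form of
  \<open>split_grothendieck\<close>.\<close>

definition t_class_add :: "t_class \<Rightarrow> t_class \<Rightarrow> t_class" where
  "t_class_add X Y = (\<Union>M\<in>X. \<Union>N\<in>Y. t_class_of (wedge M N))"

lemma t_cls_member:
  assumes "partial_map B s" "M \<in> t_cls B s"
  shows "finite_t_module M" "t_isomorphic M (opt_module B s)"
  using assms t_isomorphic_sym[of "opt_module B s" M] finite_opt_module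
  by (auto simp: t_cls_def t_class_of_def)

lemma t_cls_nonempty: "partial_map B s \<Longrightarrow> t_cls B s \<noteq> {}"
  using t_class_of_inhabited finite_opt_module unfolding t_cls_def by fastforce

text \<open>By \<open>t_class_of_smash\<close> all representatives give the same class, so the union
  over them collapses to it, classes being inhabited.\<close>

lemma t_class_mult_cls:
  assumes "partial_map B s" "partial_map C r"
  shows "t_class_mult (t_cls B s) (t_cls C r) = t_cls (B \<times> C) (prod_map s r)"
proof -
  have "t_class_of (smash M N) = t_cls (B \<times> C) (prod_map s r)" if "M \<in> t_cls B s" "N \<in> t_cls C r"
      for M N
    using that assms by (intro t_class_of_smash t_cls_member)
  then show ?thesis
    using t_cls_nonempty[OF assms(1)] t_cls_nonempty[OF assms(2)] by (simp add: t_class_mult_def)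
qed

lemma t_class_add_cls:
  assumes "partial_map B s" "partial_map C r"
  shows "t_class_add (t_cls B s) (t_cls C r) = t_cls (Sum_Type.Plus B C) (sum_map s r)"
proof -
  have "t_class_of (wedge M N) = t_cls (Sum_Type.Plus B C) (sum_map s r)"
      if "M \<in> t_cls B s" "N \<in> t_cls C r" for M N
    using that assms by (intro t_class_of_wedge t_cls_member)
  then show ?thesis
    using t_cls_nonempty[OF assms(1)] t_cls_nonempty[OF assms(2)] by (simp add: t_class_add_def)
qed

lemma t_class_of_t_unit: "t_class_of t_unit = t_cls {1::nat} Some"
proof -
  have "finite_t_module t_unit" by (auto simp: finite_t_module_def t_unit_def)
  then have "t_class_of t_unit = t_cls {1::nat} (to_partial_map t_unit)"
    using t_class_of_eq_t_cls[of t_unit] by (auto simp: t_unit_def)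
  also have "\<dots> = t_cls {1::nat} Some"
    by (rule t_cls_reindex[where g = id]) (auto simp: partial_map_def to_partial_map_def t_unit_def)
  finally show ?thesis .
qed

definition assoc_map :: "('b \<times> 'c) \<times> 'd \<Rightarrow> 'b \<times> ('c \<times> 'd)" where
  "assoc_map = (\<lambda>((x, y), z). (x, (y, z)))"

definition distrib_map :: "'b \<times> ('c + 'd) \<Rightarrow> ('b \<times> 'c) + ('b \<times> 'd)" where
  "distrib_map = (\<lambda>(x, w). case_sum (\<lambda>y. Inl (x, y)) (\<lambda>z. Inr (x, z)) w)"

lemma bij_assoc_map: "bij_betw assoc_map ((B \<times> C) \<times> D) (B \<times> (C \<times> D))"
  by (rule bij_betwI[where g = "\<lambda>(x, (y, z)). ((x, y), z)"]) (auto simp: assoc_map_def)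

lemma bij_distrib_map:
  "bij_betw distrib_map (B \<times> Sum_Type.Plus C D) (Sum_Type.Plus (B \<times> C) (B \<times> D))"
  by (rule bij_betwI[where g = "case_sum (\<lambda>(x, y). (x, Inl y)) (\<lambda>(x, z). (x, Inr z))"])
    (auto simp: distrib_map_def)

lemma prod_map_Pair:
  "prod_map s r (b, c) =
     (case s b of None \<Rightarrow> None
      | Some b' \<Rightarrow> (case r c of None \<Rightarrow> None | Some c' \<Rightarrow> Some (b', c')))"
  by (simp add: prod_map_def split: option.split)

interpretation F1: split_grothendieck t_classes t_class_mult t_class_add "t_class_of t_unit"
proof
  note pm = partial_map_prod partial_map_sum
  fix X assume "X \<in> t_classes"
  then obtain B :: "nat set" and s where B: "partial_map B s" "X = t_cls B s" by (rule t_classesE)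
  have u: "partial_map {1::nat} Some" by (simp add: partial_map_def)
  show "t_class_mult (t_class_of t_unit) X = X"
    unfolding t_class_of_t_unit B(2) t_class_mult_cls[OF u B(1)]
    by (rule t_cls_reindex[OF pm(1)[OF u B(1)], where g = snd])
      (auto simp: bij_betw_def inj_on_def prod_map_Pair map_option_case split: option.splits)
  fix Y assume "Y \<in> t_classes"
  then obtain C :: "nat set" and r where C: "partial_map C r" "Y = t_cls C r" by (rule t_classesE)
  show "t_class_mult X Y \<in> t_classes" "t_class_add X Y \<in> t_classes"
    using B C by (simp_all add: t_class_mult_cls t_class_add_cls t_cls_in_classes pm)
  show "t_class_mult X Y = t_class_mult Y X"
    unfolding B(2) C(2) t_class_mult_cls[OF B(1) C(1)] t_class_mult_cls[OF C(1) B(1)]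
    by (rule t_cls_reindex[OF pm(1)[OF B(1) C(1)], where g = prod.swap])
      (auto simp: bij_betw_def inj_on_def prod_map_Pair map_option_case product_swap split:
          option.splits)
  fix Z assume "Z \<in> t_classes"
  then obtain D :: "nat set" and q where D: "partial_map D q" "Z = t_cls D q" by (rule t_classesE)
  show "t_class_mult (t_class_mult X Y) Z = t_class_mult X (t_class_mult Y Z)"
    unfolding B(2) C(2) D(2) t_class_mult_cls[OF B(1) C(1)] t_class_mult_cls[OF C(1) D(1)]
      t_class_mult_cls[OF pm(1)[OF B(1) C(1)] D(1)] t_class_mult_cls[OF B(1) pm(1)[OF C(1) D(1)]]
    by (rule t_cls_reindex[OF pm(1)[OF pm(1)[OF B(1) C(1)] D(1)] bij_assoc_map])
      (auto simp: assoc_map_def prod_map_Pair map_option_case split: option.splits)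
  show "t_class_mult X (t_class_add Y Z) = t_class_add (t_class_mult X Y) (t_class_mult X Z)"
    unfolding B(2) C(2) D(2) t_class_mult_cls[OF B(1) C(1)] t_class_mult_cls[OF B(1) D(1)]
      t_class_add_cls[OF C(1) D(1)] t_class_mult_cls[OF B(1) pm(2)[OF C(1) D(1)]]
      t_class_add_cls[OF pm(1)[OF B(1) C(1)] pm(1)[OF B(1) D(1)]]
    by (rule t_cls_reindex[OF pm(1)[OF B(1) pm(2)[OF C(1) D(1)]] bij_distrib_map])
      (auto simp: distrib_map_def prod_map_Pair sum_map_def map_option_case
        split: option.splits sum.splits)
qed (auto intro: t_class_of_in_classes simp: finite_t_module_def t_unit_def)

section \<open>Coordinates\<close>

text \<open>The coordinate space of \<open>B\<close>. The value 0 off \<open>B\<close> makes two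
  functions equal as soon as they agree on \<open>B\<close>, so coordinates can be compared by plain
  equality.\<close>

definition fun_on :: "'b set \<Rightarrow> ('b \<Rightarrow> 'k::zero) set" where
  "fun_on B = {f. \<forall>x. x \<notin> B \<longrightarrow> f x = 0}"

text \<open>Row vectors times a matrix, so that products of matrices are read from left to right in
  \<open>mat_app_comp\<close>. The value 0 off \<open>C\<close> keeps the result in
  \<open>fun_on C\<close>.\<close>

definition mat_app :: "'b set \<Rightarrow> 'c set \<Rightarrow> ('b \<Rightarrow> 'c \<Rightarrow> 'k::comm_ring_1) \<Rightarrow> ('b \<Rightarrow> 'k) \<Rightarrow> 'c \<Rightarrow> 'k" where
  "mat_app B C a f = (\<lambda>c. if c \<in> C then (\<Sum>b\<in>B. f b * a b c) else 0)"

definition unit_fun :: "'b \<Rightarrow> 'b \<Rightarrow> 'k::comm_ring_1" where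
  "unit_fun b = (\<lambda>x. if x = b then 1 else 0)"

text \<open>Only closure and compatibility of \<open>\<phi>\<close> with the operations are
  demanded; the vector space axioms are consequences. This is how the quotient that defines the
  tensor space is shown to be a vector space.\<close>

definition coords :: "('k::field, 'v) module \<Rightarrow> 'b set \<Rightarrow> ('v \<Rightarrow> 'b \<Rightarrow> 'k) \<Rightarrow> bool" where
  "coords V B \<phi> \<longleftrightarrow>
     finite B \<and> bij_betw \<phi> (carrier V) (fun_on B) \<and> \<zero>\<^bsub>V\<^esub> \<in> carrier V \<and> \<phi> \<zero>\<^bsub>V\<^esub> = (\<lambda>x. 0) \<and>
     (\<forall>v\<in>carrier V. \<forall>w\<in>carrier V. v \<oplus>\<^bsub>V\<^esub> w \<in> carrier V \<and> \<phi> (v \<oplus>\<^bsub>V\<^esub> w) = (\<lambda>x. \<phi> v x + \<phi> w x)) \<and>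
     (\<forall>c. \<forall>v\<in>carrier V. c \<odot>\<^bsub>V\<^esub> v \<in> carrier V \<and> \<phi> (c \<odot>\<^bsub>V\<^esub> v) = (\<lambda>x. c * \<phi> v x))"

lemma mat_app_fun_on: "mat_app B C a f \<in> fun_on C"
  by (simp add: mat_app_def fun_on_def)

lemma mat_app_add: "mat_app B C a (\<lambda>x. f x + g x) = (\<lambda>x. mat_app B C a f x + mat_app B C a g x)"
  by (auto simp: mat_app_def sum.distrib algebra_simps)

lemma mat_app_scale: "mat_app B C a (\<lambda>x. c * f x) = (\<lambda>x. c * mat_app B C a f x)"
  by (auto simp: mat_app_def sum_distrib_left algebra_simps)

lemma mat_app_zero: "mat_app B C a (\<lambda>x. 0) = (\<lambda>x. 0)"
  by (auto simp: mat_app_def)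

lemma mat_app_comp:
  "mat_app C D q (mat_app B C p f) = mat_app B D (\<lambda>b d. \<Sum>c\<in>C. p b c * q c d) f"
proof
  fix d
  have "(\<Sum>c\<in>C. (\<Sum>b\<in>B. f b * p b c) * q c d) = (\<Sum>b\<in>B. f b * (\<Sum>c\<in>C. p b c * q c d))"
    unfolding sum_distrib_left sum_distrib_right by (subst sum.swap) (simp add: mult.assoc)
  then show "mat_app C D q (mat_app B C p f) d = mat_app B D (\<lambda>b d. \<Sum>c\<in>C. p b c * q c d) f d"
    by (simp add: mat_app_def)
qed

lemma mat_app_cong:
  "(\<And>b c. b \<in> B \<Longrightarrow> c \<in> C \<Longrightarrow> a b c = a' b c) \<Longrightarrow> mat_app B C a f = mat_app B C a' f"
  by (auto simp: mat_app_def intro!: sum.cong ext)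

lemma mat_app_id:
  assumes "finite B" "f \<in> fun_on B"
  shows "mat_app B B unit_fun f = f"
  using assms by (auto simp: mat_app_def fun_on_def unit_fun_def if_distrib cong: if_cong)

lemma unit_fun_in: "b \<in> B \<Longrightarrow> unit_fun b \<in> fun_on B"
  by (auto simp: unit_fun_def fun_on_def)

lemma class_cring: "cring (class_ring :: 'a::comm_ring_1 ring)"
  by (rule class_cring.cring_axioms)

lemma coordsD:
  assumes "coords V B \<phi>"
  shows "finite B" "inj_on \<phi> (carrier V)" "\<phi> ` carrier V = fun_on B" "bij_betw \<phi> (carrier V) (fun_on
      B)"
    "\<zero>\<^bsub>V\<^esub> \<in> carrier V" "\<phi> \<zero>\<^bsub>V\<^esub> = (\<lambda>x. 0)"
    "\<And>v w. v \<in> carrier V \<Longrightarrow> w \<in> carrier V \<Longrightarrow> v \<oplus>\<^bsub>V\<^esub> w \<in> carrier V"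
    "\<And>v w. v \<in> carrier V \<Longrightarrow> w \<in> carrier V \<Longrightarrow> \<phi> (v \<oplus>\<^bsub>V\<^esub> w) = (\<lambda>x. \<phi> v x + \<phi> w x)"
    "\<And>c v. v \<in> carrier V \<Longrightarrow> c \<odot>\<^bsub>V\<^esub> v \<in> carrier V"
    "\<And>c v. v \<in> carrier V \<Longrightarrow> \<phi> (c \<odot>\<^bsub>V\<^esub> v) = (\<lambda>x. c * \<phi> v x)"
  using assms by (simp_all add: coords_def bij_betw_def)

lemma coords_fun_on: "coords V B \<phi> \<Longrightarrow> v \<in> carrier V \<Longrightarrow> \<phi> v \<in> fun_on B"
  using coordsD(3) by blast

text \<open>Injectivity of \<open>\<phi>\<close> turns each axiom into a pointwise identity in
  \<open>fun_on B\<close>; scaling by -1 gives the negatives.\<close>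

lemma coords_abelian_group:
  assumes "coords V B \<phi>"
  shows "abelian_group V"
proof -
  note C = coordsD[OF assms]
  have eq: "v = w" if "v \<in> carrier V" "w \<in> carrier V" "\<phi> v = \<phi> w" for v w
    using C(2) that by (simp add: inj_on_def)
  show ?thesis
  proof (rule abelian_groupI)
    fix v w u assume vwu: "v \<in> carrier V" "w \<in> carrier V" "u \<in> carrier V"
    show "(v \<oplus>\<^bsub>V\<^esub> w) \<oplus>\<^bsub>V\<^esub> u = v \<oplus>\<^bsub>V\<^esub> (w \<oplus>\<^bsub>V\<^esub> u)"
      by (rule eq) (simp_all add: C vwu add.assoc)
    show "v \<oplus>\<^bsub>V\<^esub> w = w \<oplus>\<^bsub>V\<^esub> v"
      by (rule eq) (simp_all add: C vwu add.commute)
    show "\<zero>\<^bsub>V\<^esub> \<oplus>\<^bsub>V\<^esub> v = v"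
      by (rule eq) (simp_all add: C vwu)
    show "\<exists>y\<in>carrier V. y \<oplus>\<^bsub>V\<^esub> v = \<zero>\<^bsub>V\<^esub>"
      by (rule bexI[of _ "(-1) \<odot>\<^bsub>V\<^esub> v"], rule eq) (simp_all add: C vwu)
  qed (simp_all add: C)
qed

lemma coords_module:
  assumes "coords V B \<phi>"
  shows "Module.module class_ring V"
proof -
  note C = coordsD[OF assms]
  have eq: "v = w" if "v \<in> carrier V" "w \<in> carrier V" "\<phi> v = \<phi> w" for v w
    using C(2) that by (simp add: inj_on_def)
  show ?thesis
    by (rule Module.moduleI[OF class_cring coords_abelian_group[OF assms]]; (rule eq)?)
      (simp_all add: C algebra_simps)
qed

lemma coords_vectorspace: "coords V B \<phi> \<Longrightarrow> vectorspace class_ring V"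
  by (simp add: vectorspace_def coords_module class_field)

section \<open>Bases, finite dimension and matrices of linear maps\<close>

definition basis_vec :: "('k::field, 'v) module \<Rightarrow> ('v \<Rightarrow> 'b \<Rightarrow> 'k) \<Rightarrow> 'b \<Rightarrow> 'v" where
  "basis_vec V \<phi> b = inv_into (carrier V) \<phi> (unit_fun b)"

lemma basis_vec:
  assumes "coords V B \<phi>" "b \<in> B"
  shows "basis_vec V \<phi> b \<in> carrier V" "\<phi> (basis_vec V \<phi> b) = unit_fun b"
proof -
  have "unit_fun b \<in> \<phi> ` carrier V"
    using coordsD(3)[OF assms(1)] unit_fun_in[OF assms(2)] by simp
  then show "basis_vec V \<phi> b \<in> carrier V" "\<phi> (basis_vec V \<phi> b) = unit_fun b"
    by (simp_all add: basis_vec_def inv_into_into f_inv_into_f)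
qed

lemma coords_induct [consumes 2, case_names zero step]:
  assumes co: "coords V B \<phi>" and v: "v \<in> carrier V" and zero: "P \<zero>\<^bsub>V\<^esub>"
    and step: "\<And>v b c. v \<in> carrier V \<Longrightarrow> b \<in> B \<Longrightarrow> P v \<Longrightarrow> P (v \<oplus>\<^bsub>V\<^esub> c \<odot>\<^bsub>V\<^esub> basis_vec V \<phi> b)"
  shows "P v"
proof -
  note C = coordsD[OF co]
  have eq: "v = w" if "v \<in> carrier V" "w \<in> carrier V" "\<phi> v = \<phi> w" for v w
    using C(2) that by (simp add: inj_on_def)
  have "P v" if "finite S" "S \<subseteq> B" "v \<in> carrier V" "\<phi> v \<in> fun_on S" for S v
    using that
  proof (induction S arbitrary: v rule: finite_induct)
    case empty
    then have "\<phi> v = (\<lambda>x. 0)" by (auto simp: fun_on_def)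
    then have "v = \<zero>\<^bsub>V\<^esub>" using empty C eq by simp
    then show ?case using zero by simp
  next
    case (insert b S)
    have bB: "b \<in> B" using insert by simp
    note e = basis_vec[OF co bB]
    \<comment> \<open>Removing the \<open>b\<close>-coordinate brings the support into
      \<open>S\<close>; adding it back is an instance of \<open>step\<close>.\<close>
    define w where "w = v \<oplus>\<^bsub>V\<^esub> (- \<phi> v b) \<odot>\<^bsub>V\<^esub> basis_vec V \<phi> b"
    have w: "w \<in> carrier V" by (simp add: w_def C e insert)
    have "\<phi> w \<in> fun_on S"
      using insert by (auto simp: w_def C e fun_on_def unit_fun_def)
    then have "P w" using insert w by simp
    then have "P (w \<oplus>\<^bsub>V\<^esub> \<phi> v b \<odot>\<^bsub>V\<^esub> basis_vec V \<phi> b)" by (rule step[OF w bB])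
    moreover have "w \<oplus>\<^bsub>V\<^esub> \<phi> v b \<odot>\<^bsub>V\<^esub> basis_vec V \<phi> b = v"
      by (rule eq) (simp_all add: w_def C e insert)
    ultimately show ?case by simp
  qed
  then show ?thesis using C(1) v coords_fun_on[OF co v] by blast
qed

lemma coords_fin_dim:
  assumes co: "coords V B \<phi>"
  shows "vectorspace.fin_dim class_ring V"
proof -
  note C = coordsD[OF co]
  interpret V: vectorspace class_ring V by (rule coords_vectorspace[OF co])
  let ?A = "basis_vec V \<phi> ` B"
  have A: "?A \<subseteq> carrier V" using basis_vec[OF co] by auto
  have sub: "submodule class_ring (V.span ?A) V" by (rule V.span_is_submodule[OF A])
  have "v \<in> V.span ?A" if "v \<in> carrier V" for v
    using co that
  proof (induction rule: coords_induct)
    case zero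
    then show ?case using submodule.zero_closed[OF sub] by simp
  next
    case (step v b c)
    have "basis_vec V \<phi> b \<in> V.span ?A"
      using V.in_own_span[OF A] step by auto
    then show ?case
      using step submodule.m_closed[OF sub] submodule.smult_closed[OF sub, of c] by simp
  qed
  then have "V.span ?A = carrier V"
    using submodule.subset[OF sub] by auto
  then show ?thesis
    unfolding V.fin_dim_def using A C(1) by (intro exI[of _ ?A]) simp
qed

text \<open>A basis serves as its own index set; \<open>\<psi>\<close> forms linear combinations and
  \<open>\<phi>\<close> is its inverse.\<close>

lemma fin_dim_coords:
  fixes V :: "('k::field, 'v) module"
  assumes "vectorspace class_ring V" "vectorspace.fin_dim class_ring V"
  obtains \<beta> :: "'v set" and \<phi> where "coords V \<beta> \<phi>"
proof -
  interpret V: vectorspace class_ring V by fact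
  obtain \<beta> where \<beta>: "finite \<beta>" "V.basis \<beta>"
    using V.finite_basis_exists[OF assms(2)] by blast
  then have sub: "\<beta> \<subseteq> carrier V" by (simp add: V.basis_def)
  have ex1: "\<exists>!a. a \<in> \<beta> \<rightarrow>\<^sub>E UNIV \<and> V.lincomb a \<beta> = v" if "v \<in> carrier V" for v
    using V.basis_criterion[OF \<beta>(1) sub] \<beta>(2) that by simp
  define \<psi> where "\<psi> f = V.lincomb f \<beta>" for f
  \<comment> \<open>The basis criterion yields coefficients that are unique as functions undefined
    off \<open>\<beta>\<close>, whereas \<open>fun_on\<close> asks for 0 there. Restriction mediates
    between the two conventions.\<close>
  have lc: "V.lincomb f \<beta> = V.lincomb (restrict f \<beta>) \<beta>" for f
    unfolding V.lincomb_def by (rule V.finsum_cong') (use sub in auto)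
  have bij: "bij_betw \<psi> (fun_on \<beta>) (carrier V)"
  proof (rule bij_betw_imageI)
    show "inj_on \<psi> (fun_on \<beta>)"
    proof (rule inj_onI)
      fix f g assume fg: "f \<in> fun_on \<beta>" "g \<in> fun_on \<beta>" "\<psi> f = \<psi> g"
      have "restrict f \<beta> = restrict g \<beta>"
        using ex1[of "V.lincomb f \<beta>"] fg(3) sub lc[of f] lc[of g]
        unfolding \<psi>_def by (metis V.lincomb_closed UNIV_I Pi_I partial_object.simps(1)
            restrict_PiE_iff)
      then have "f x = g x" if "x \<in> \<beta>" for x using that by (metis restrict_apply')
      then show "f = g" using fg by (force simp: fun_on_def)
    qed
    show "\<psi> ` fun_on \<beta> = carrier V"
    proof (intro equalityI subsetI)
      fix v assume "v \<in> \<psi> ` fun_on \<beta>"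
      then show "v \<in> carrier V" using sub by (auto simp: \<psi>_def)
    next
      fix v assume "v \<in> carrier V"
      then obtain a where a: "V.lincomb a \<beta> = v" using ex1 by blast
      have "\<psi> (\<lambda>x. if x \<in> \<beta> then a x else 0) = v"
        unfolding \<psi>_def a[symmetric] V.lincomb_def by (rule V.finsum_cong') (use sub in auto)
      then show "v \<in> \<psi> ` fun_on \<beta>" by (auto simp: fun_on_def)
    qed
  qed
  have \<psi>_add: "\<psi> (\<lambda>x. f x + g x) = \<psi> f \<oplus>\<^bsub>V\<^esub> \<psi> g" for f g
  proof -
    have "(\<lambda>x. f x \<odot>\<^bsub>V\<^esub> x) \<in> \<beta> \<rightarrow> carrier V" "(\<lambda>x. g x \<odot>\<^bsub>V\<^esub> x) \<in> \<beta> \<rightarrow> carrier V"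
      using sub by auto
    note V.finsum_addf[OF this]
    moreover have "\<psi> (\<lambda>x. f x + g x) = (\<Oplus>\<^bsub>V\<^esub>x\<in>\<beta>. f x \<odot>\<^bsub>V\<^esub> x \<oplus>\<^bsub>V\<^esub> g x \<odot>\<^bsub>V\<^esub> x)"
      unfolding \<psi>_def V.lincomb_def
      by (rule V.finsum_cong') (use sub V.smult_l_distr in auto)
    ultimately show ?thesis by (simp add: \<psi>_def V.lincomb_def)
  qed
  have \<psi>_scale: "\<psi> (\<lambda>x. c * f x) = c \<odot>\<^bsub>V\<^esub> \<psi> f" for c f
  proof -
    have "(\<lambda>x. f x \<odot>\<^bsub>V\<^esub> x) \<in> \<beta> \<rightarrow> carrier V" using sub by auto
    then have "c \<odot>\<^bsub>V\<^esub> \<psi> f = (\<Oplus>\<^bsub>V\<^esub>x\<in>\<beta>. c \<odot>\<^bsub>V\<^esub> (f x \<odot>\<^bsub>V\<^esub> x))"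
      unfolding \<psi>_def V.lincomb_def using V.finsum_smult_ldistr[OF \<beta>(1), of c] by simp
    moreover have "\<dots> = \<psi> (\<lambda>x. c * f x)"
      unfolding \<psi>_def V.lincomb_def
      by (rule V.finsum_cong') (use sub V.smult_assoc1 in auto)
    ultimately show ?thesis by simp
  qed
  define \<phi> where "\<phi> = inv_into (fun_on \<beta>) \<psi>"
  have \<phi>_in: "\<phi> v \<in> fun_on \<beta>" and \<psi>\<phi>: "\<psi> (\<phi> v) = v" if "v \<in> carrier V" for v
    using bij that unfolding \<phi>_def by (auto simp: bij_betw_def inv_into_into f_inv_into_f)
  have \<phi>I: "\<phi> v = f" if "\<psi> f = v" "f \<in> fun_on \<beta>" for f v
    unfolding \<phi>_def using that bij by (auto simp: bij_betw_def)
  have "coords V \<beta> \<phi>"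
    unfolding coords_def
  proof (intro conjI ballI allI)
    show "bij_betw \<phi> (carrier V) (fun_on \<beta>)"
      unfolding \<phi>_def by (rule bij_betw_inv_into[OF bij])
    show "\<phi> \<zero>\<^bsub>V\<^esub> = (\<lambda>x. 0)"
    proof (rule \<phi>I)
      have "\<psi> (\<lambda>x. 0 * 0) = 0 \<odot>\<^bsub>V\<^esub> \<psi> (\<lambda>x. 0)" by (rule \<psi>_scale)
      moreover have "\<psi> (\<lambda>x. 0) \<in> carrier V" unfolding \<psi>_def using sub by auto
      ultimately show "\<psi> (\<lambda>x. 0) = \<zero>\<^bsub>V\<^esub>" using V.smult_l_null by simp
    qed (simp add: fun_on_def)
    fix v assume v: "v \<in> carrier V"
    fix c show "c \<odot>\<^bsub>V\<^esub> v \<in> carrier V" using v by simp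
    show "\<phi> (c \<odot>\<^bsub>V\<^esub> v) = (\<lambda>x. c * \<phi> v x)"
      by (rule \<phi>I) (use \<phi>_in[OF v] in \<open>simp_all add: \<psi>_scale \<psi>\<phi> v fun_on_def\<close>)
    fix w assume w: "w \<in> carrier V"
    show "v \<oplus>\<^bsub>V\<^esub> w \<in> carrier V" using v w by simp
    show "\<phi> (v \<oplus>\<^bsub>V\<^esub> w) = (\<lambda>x. \<phi> v x + \<phi> w x)"
      by (rule \<phi>I) (use \<phi>_in[OF v] \<phi>_in[OF w] in \<open>simp_all add: \<psi>_add \<psi>\<phi> v w fun_on_def\<close>)
  qed (use \<beta> in simp_all)
  then show thesis by (rule that)
qed

text \<open>Row \<open>b\<close> of the matrix holds the coordinates of the image of the basis
  vector at \<open>b\<close>.\<close>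

lemma linear_matrix_exists:
  assumes co: "coords V B \<phi>" and T: "\<And>v. v \<in> carrier V \<Longrightarrow> T v \<in> carrier V"
    and add: "\<And>v w. v \<in> carrier V \<Longrightarrow> w \<in> carrier V \<Longrightarrow> T (v \<oplus>\<^bsub>V\<^esub> w) = T v \<oplus>\<^bsub>V\<^esub> T w"
    and scale: "\<And>c v. v \<in> carrier V \<Longrightarrow> T (c \<odot>\<^bsub>V\<^esub> v) = c \<odot>\<^bsub>V\<^esub> T v"
  shows "\<exists>a. \<forall>v\<in>carrier V. \<phi> (T v) = mat_app B B a (\<phi> v)"
proof (intro exI ballI)
  note C = coordsD[OF co]
  define a where "a b = \<phi> (T (basis_vec V \<phi> b))" for b
  fix v assume "v \<in> carrier V"
  with co show "\<phi> (T v) = mat_app B B a (\<phi> v)"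
  proof (induction rule: coords_induct)
    case zero
    have "T \<zero>\<^bsub>V\<^esub> = T (0 \<odot>\<^bsub>V\<^esub> \<zero>\<^bsub>V\<^esub>)"
      using C by (intro arg_cong[of _ _ T] inj_onD[OF C(2)]) simp_all
    also have "\<dots> = 0 \<odot>\<^bsub>V\<^esub> T \<zero>\<^bsub>V\<^esub>" by (rule scale[OF C(5)])
    finally have "\<phi> (T \<zero>\<^bsub>V\<^esub>) = \<phi> (0 \<odot>\<^bsub>V\<^esub> T \<zero>\<^bsub>V\<^esub>)" by (rule arg_cong)
    then have "\<phi> (T \<zero>\<^bsub>V\<^esub>) = (\<lambda>x. 0)" using C(10)[OF T[OF C(5)], of 0] by simp
    then show ?case by (simp add: C mat_app_zero)
  next
    case (step v b c)
    note e = basis_vec[OF co step(2)]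
    have "mat_app B B a (unit_fun b) = a b"
    proof
      fix x
      have "a b \<in> fun_on B" unfolding a_def using coords_fun_on[OF co] T e by blast
      then have "x \<notin> B \<Longrightarrow> a b x = 0" by (simp add: fun_on_def)
      moreover have "(\<Sum>y\<in>B. unit_fun b y * a y x) = a b x"
        using C(1) step(2) by (simp add: unit_fun_def if_distrib if_distribR cong: if_cong)
      ultimately show "mat_app B B a (unit_fun b) x = a b x" by (simp add: mat_app_def)
    qed
    moreover have "\<phi> (T (basis_vec V \<phi> b)) = a b" by (simp add: a_def)
    ultimately show ?case
      using step by (simp add: C e T add scale mat_app_add mat_app_scale)
  qed
qed

section \<open>Matrix presentations of modules over a polynomial ring\<close>

text \<open>\<open>kt_coords M B a \<phi>\<close>: \<open>\<phi>\<close> gives the coordinates in a basis of \<open>M\<close> indexed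
    by \<open>B\<close> on which \<open>t\<close> acts by
  \<open>t e\<^sub>b = \<Sum>c\<in>B. a b c e\<^sub>c\<close>; so \<open>a\<close> is the transpose of the usual matrix of \<open>t\<close>.\<close>

definition kt_coords ::
    "('k::field poly, 'v) module \<Rightarrow> 'b set \<Rightarrow> ('b \<Rightarrow> 'b \<Rightarrow> 'k) \<Rightarrow> ('v \<Rightarrow> 'b \<Rightarrow> 'k) \<Rightarrow> bool" where
  "kt_coords M B a \<phi> \<longleftrightarrow> Module.module class_ring M \<and> coords (restrict_scalars M) B \<phi> \<and>
     (\<forall>v\<in>carrier M. \<phi> (t_op M v) = mat_app B B a (\<phi> v))"

definition kt_pres :: "('k::field poly, 'v) module \<Rightarrow> 'b set \<Rightarrow> ('b \<Rightarrow> 'b \<Rightarrow> 'k) \<Rightarrow> bool" where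
  "kt_pres M B a \<longleftrightarrow> (\<exists>\<phi>. kt_coords M B a \<phi>)"

lemma kt_coordsD:
  assumes "kt_coords M B a \<phi>"
  shows "Module.module class_ring M" "coords (restrict_scalars M) B \<phi>"
    "\<And>v. v \<in> carrier M \<Longrightarrow> \<phi> (t_op M v) = mat_app B B a (\<phi> v)"
  using assms by (simp_all add: kt_coords_def)

text \<open>The similarity class of a matrix, as the set of all modules on column vectors that it
  presents. By \<open>kt_class_of_eq\<close> it is the isomorphism class of every module with that
  presentation.\<close>

definition kt_cls :: "'b set \<Rightarrow> ('b \<Rightarrow> 'b \<Rightarrow> 'k::field) \<Rightarrow> 'k kt_class" where
  "kt_cls B a = {N. kt_pres N B a}"

lemma restrict_scalars_simps [simp]:
  "carrier (restrict_scalars M) = carrier M" "\<zero>\<^bsub>restrict_scalars M\<^esub> = \<zero>\<^bsub>M\<^esub>"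
  "add (restrict_scalars M) = add M" "c \<odot>\<^bsub>restrict_scalars M\<^esub> v = [:c:] \<odot>\<^bsub>M\<^esub> v"
  by (simp_all add: restrict_scalars_def)

lemma kt_module_simps [simp]:
  "carrier (kt_module V T) = carrier V" "\<zero>\<^bsub>kt_module V T\<^esub> = \<zero>\<^bsub>V\<^esub>"
  "add (kt_module V T) = add V"
  by (simp_all add: kt_module_def)

lemma restrict_scalars_module:
  assumes "Module.module class_ring (M :: ('k::field poly, 'v) module)"
  shows "Module.module class_ring (restrict_scalars M)"
proof -
  interpret M: Module.module class_ring M by fact
  have "abelian_group (restrict_scalars M)"
    by (rule abelian_groupI) (auto simp: M.a_ac intro: M.l_neg bexI[OF _ M.a_inv_closed])
  moreover have "[:a + b:] \<odot>\<^bsub>M\<^esub> x = [:a:] \<odot>\<^bsub>M\<^esub> x \<oplus>\<^bsub>M\<^esub> [:b:] \<odot>\<^bsub>M\<^esub> x"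
    "[:a * b:] \<odot>\<^bsub>M\<^esub> x = [:a:] \<odot>\<^bsub>M\<^esub> ([:b:] \<odot>\<^bsub>M\<^esub> x)" "[:1:] \<odot>\<^bsub>M\<^esub> x = x" if "x \<in> carrier M" for a b x
    using M.smult_l_distr[of "[:a:]" "[:b:]" x] M.smult_assoc1[of "[:a:]" "[:b:]" x]
      M.smult_one[of x] that by (simp_all add: mult.commute flip: one_pCons)
  ultimately show ?thesis
    by (intro Module.moduleI class_cring) (simp_all add: M.smult_r_distr)
qed

lemma t_op_closed: "Module.module class_ring M \<Longrightarrow> v \<in> carrier M \<Longrightarrow> t_op M v \<in> carrier M"
  unfolding t_op_def by (rule Module.module.smult_closed, assumption) simp_all

lemma kt_pres_finite: "kt_pres M B a \<Longrightarrow> finite_kt_module M"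
  by (auto simp: kt_pres_def kt_coords_def finite_kt_module_def intro: coords_fin_dim)

lemma finite_kt_module_pres:
  fixes M :: "('k::field poly, 'v) module"
  assumes "finite_kt_module M"
  obtains \<beta> :: "'v set" and a where "kt_pres M \<beta> a"
proof -
  have M: "Module.module class_ring M" and fd: "vectorspace.fin_dim class_ring (restrict_scalars M)"
    using assms by (auto simp: finite_kt_module_def)
  interpret M: Module.module class_ring M by fact
  have "vectorspace class_ring (restrict_scalars M)"
    by (simp add: vectorspace_def restrict_scalars_module[OF M] class_field)
  then obtain \<beta> :: "'v set" and \<phi> where co: "coords (restrict_scalars M) \<beta> \<phi>"
    using fd by (rule fin_dim_coords)
  have "t_op M ([:c:] \<odot>\<^bsub>M\<^esub> v) = [:c:] \<odot>\<^bsub>M\<^esub> t_op M v" if "v \<in> carrier M" for c v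
    using that M.smult_assoc1[of "[:0, 1:]" "[:c:]" v] M.smult_assoc1[of "[:c:]" "[:0, 1:]" v]
    by (simp add: t_op_def)
  moreover have "t_op M (v \<oplus>\<^bsub>M\<^esub> w) = t_op M v \<oplus>\<^bsub>M\<^esub> t_op M w" if "v \<in> carrier M" "w \<in> carrier M"
      for v w
    using that by (simp add: t_op_def M.smult_r_distr)
  ultimately have "\<exists>a. \<forall>v\<in>carrier M. \<phi> (t_op M v) = mat_app \<beta> \<beta> a (\<phi> v)"
    using linear_matrix_exists[OF co, of "t_op M"] t_op_closed[OF M] by simp
  then show thesis using that M co unfolding kt_pres_def kt_coords_def by blast
qed

text \<open>Horner's rule, from \<open>pCons c p = c + t p\<close>; it makes statements about all
  polynomials accessible to induction on coefficients.\<close>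

lemma smult_pCons:
  assumes M: "Module.module class_ring (M :: ('k::field poly, 'v) module)" and v: "v \<in> carrier M"
  shows "pCons c p \<odot>\<^bsub>M\<^esub> v = [:c:] \<odot>\<^bsub>M\<^esub> v \<oplus>\<^bsub>M\<^esub> t_op M (p \<odot>\<^bsub>M\<^esub> v)"
proof -
  interpret M: Module.module class_ring M by fact
  have "pCons c p = [:c:] + [:0, 1:] * p" by simp
  then show ?thesis
    unfolding t_op_def
    using M.smult_l_distr[of "[:c:]" "[:0, 1:] * p" v] M.smult_assoc1[of "[:0, 1:]" p v] v by simp
qed

text \<open>Constants and \<open>t\<close> generate \<open>k[t]\<close>, and
  \<open>smult_pCons\<close> carries compatibility from these to all polynomials.\<close>

lemma poly_linearI:
  assumes M: "Module.module class_ring (M :: ('k::field poly, 'v) module)"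
    and N: "Module.module class_ring (N :: ('k poly, 'w) module)"
    and f: "\<And>v. v \<in> carrier M \<Longrightarrow> f v \<in> carrier N"
    and add: "\<And>v w. v \<in> carrier M \<Longrightarrow> w \<in> carrier M \<Longrightarrow> f (v \<oplus>\<^bsub>M\<^esub> w) = f v \<oplus>\<^bsub>N\<^esub> f w"
    and scale: "\<And>c v. v \<in> carrier M \<Longrightarrow> f ([:c:] \<odot>\<^bsub>M\<^esub> v) = [:c:] \<odot>\<^bsub>N\<^esub> f v"
    and t: "\<And>v. v \<in> carrier M \<Longrightarrow> f (t_op M v) = t_op N (f v)"
  shows "f \<in> module_hom class_ring M N"
proof -
  interpret M: Module.module class_ring M by fact
  interpret N: Module.module class_ring N by fact
  have "f (p \<odot>\<^bsub>M\<^esub> v) = p \<odot>\<^bsub>N\<^esub> f v" if v: "v \<in> carrier M" for p v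
  proof (induction p)
    case 0
    show ?case using scale[OF v, of 0] by simp
  next
    case (pCons c p)
    show ?case
      using v pCons.IH t_op_closed[OF M, of "p \<odot>\<^bsub>M\<^esub> v"]
      by (simp add: add scale t smult_pCons[OF M v, of c p] smult_pCons[OF N f[OF v], of c p])
  qed
  then show ?thesis using f add by (simp add: module_hom_def)
qed

lemma kt_pres_isomorphic:
  assumes "kt_pres M B a" "kt_pres N B a"
  shows "kt_isomorphic M N"
proof -
  obtain \<phi> where \<phi>: "kt_coords M B a \<phi>" using assms(1) by (auto simp: kt_pres_def)
  note M = kt_coordsD(1)[OF \<phi>] and t\<phi> = kt_coordsD(3)[OF \<phi>] and \<phi> = kt_coordsD(2)[OF \<phi>]
  obtain \<psi> where \<psi>: "kt_coords N B a \<psi>" using assms(2) by (auto simp: kt_pres_def)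
  note N = kt_coordsD(1)[OF \<psi>] and t\<psi> = kt_coordsD(3)[OF \<psi>] and \<psi> = kt_coordsD(2)[OF \<psi>]
  note C = coordsD[OF \<phi>, simplified] and D = coordsD[OF \<psi>, simplified]
  interpret M: Module.module class_ring M by fact
  interpret N: Module.module class_ring N by fact
  define f where "f = inv_into (carrier N) \<psi> \<circ> \<phi>"
  have f: "f v \<in> carrier N" and \<psi>f: "\<psi> (f v) = \<phi> v" if "v \<in> carrier M" for v
  proof -
    have "\<phi> v \<in> \<psi> ` carrier N" using C(3) D(3) that by auto
    then show "f v \<in> carrier N" "\<psi> (f v) = \<phi> v"
      by (simp_all add: f_def inv_into_into f_inv_into_f)
  qed
  have eq: "v = w" if "v \<in> carrier N" "w \<in> carrier N" "\<psi> v = \<psi> w" for v w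
    using D(2) that by (simp add: inj_on_def)
  have "f \<in> module_hom class_ring M N"
    by (rule poly_linearI[OF M N f]; (rule eq)?)
      (simp_all add: f \<psi>f C D t_op_closed[OF M] t_op_closed[OF N] t\<phi> t\<psi>)
  moreover have "bij_betw f (carrier M) (carrier N)"
    unfolding f_def by (rule bij_betw_trans[OF C(4) bij_betw_inv_into[OF D(4)]])
  ultimately show ?thesis by (auto simp: kt_isomorphic_def)
qed

text \<open>Coordinates are pulled back along the inverse of the isomorphism. Together with
  \<open>kt_pres_isomorphic\<close> this makes having a given presentation the same as lying in one
  isomorphism class.\<close>

lemma kt_isomorphic_pres:
  assumes "kt_pres M B a" "kt_isomorphic M N" "Module.module class_ring N"
  shows "kt_pres N B a"
proof -
  obtain \<phi> where \<phi>: "kt_coords M B a \<phi>" using assms(1) by (auto simp: kt_pres_def)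
  note M = kt_coordsD(1)[OF \<phi>] and t\<phi> = kt_coordsD(3)[OF \<phi>] and \<phi> = kt_coordsD(2)[OF \<phi>]
  obtain f where f: "f \<in> module_hom class_ring M N" "bij_betw f (carrier M) (carrier N)"
    using assms(2) by (auto simp: kt_isomorphic_def)
  note C = coordsD[OF \<phi>, simplified]
  interpret M: Module.module class_ring M by fact
  note N = assms(3)
  interpret N: Module.module class_ring N by fact
  define g where "g = inv_into (carrier M) f"
  have g: "g w \<in> carrier M" and fg: "f (g w) = w" if "w \<in> carrier N" for w
    using f(2) that by (auto simp: g_def bij_betw_def inv_into_into f_inv_into_f)
  have gI: "g w = v" if "v \<in> carrier M" "f v = w" for v w
    using f(2) that by (auto simp: g_def bij_betw_def)
  have f_add: "f (v \<oplus>\<^bsub>M\<^esub> w) = f v \<oplus>\<^bsub>N\<^esub> f w" if "v \<in> carrier M" "w \<in> carrier M" for v w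
    using f(1) that by (simp add: module_hom_def)
  have f_smult: "f (p \<odot>\<^bsub>M\<^esub> v) = p \<odot>\<^bsub>N\<^esub> f v" if "v \<in> carrier M" for p v
    using f(1) that by (simp add: module_hom_def)
  have g_add: "g (v \<oplus>\<^bsub>N\<^esub> w) = g v \<oplus>\<^bsub>M\<^esub> g w" if "v \<in> carrier N" "w \<in> carrier N" for v w
    by (rule gI) (simp_all add: g that f_add fg)
  have g_smult: "g (p \<odot>\<^bsub>N\<^esub> v) = p \<odot>\<^bsub>M\<^esub> g v" if "v \<in> carrier N" for p v
    by (rule gI) (simp_all add: g that f_smult fg)
  have g_zero: "g \<zero>\<^bsub>N\<^esub> = \<zero>\<^bsub>M\<^esub>"
    using g_smult[of "\<zero>\<^bsub>N\<^esub>" 0] g[of "\<zero>\<^bsub>N\<^esub>"] M.smult_l_null N.smult_l_null by simp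
  have "coords (restrict_scalars N) B (\<phi> \<circ> g)"
    unfolding coords_def restrict_scalars_simps
  proof (intro conjI)
    show "bij_betw (\<phi> \<circ> g) (carrier N) (fun_on B)"
      unfolding g_def by (rule bij_betw_trans[OF bij_betw_inv_into[OF f(2)] C(4)])
  qed (simp_all add: C g g_add g_smult g_zero)
  moreover have "(\<phi> \<circ> g) (t_op N w) = mat_app B B a ((\<phi> \<circ> g) w)" if "w \<in> carrier N" for w
    using t\<phi>[OF g[OF that]] g_smult[OF that, of "[:0, 1:]"] by (simp add: t_op_def)
  ultimately show ?thesis using N unfolding kt_pres_def kt_coords_def by blast
qed

text \<open>Change of basis by mutually inverse matrices \<open>p\<close> and \<open>q\<close> with
  \<open>a p = p a'\<close>. The index sets may differ, so that reindexing, the Fourier transform of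
  a cycle and the deletion of an edge are all instances.\<close>

lemma kt_pres_intertwine:
  assumes pres: "kt_pres M B a" and B': "finite B'"
    and pq: "\<And>b d. b \<in> B \<Longrightarrow> d \<in> B \<Longrightarrow> (\<Sum>c\<in>B'. p b c * q c d) = unit_fun b d"
    and qp: "\<And>c d. c \<in> B' \<Longrightarrow> d \<in> B' \<Longrightarrow> (\<Sum>b\<in>B. q c b * p b d) = unit_fun c d"
    and int: "\<And>b d. b \<in> B \<Longrightarrow> d \<in> B' \<Longrightarrow> (\<Sum>c\<in>B. a b c * p c d) = (\<Sum>c\<in>B'. p b c * a' c d)"
  shows "kt_pres M B' a'"
proof -
  obtain \<phi> where \<phi>: "kt_coords M B a \<phi>" using pres by (auto simp: kt_pres_def)
  note M = kt_coordsD(1)[OF \<phi>] and t\<phi> = kt_coordsD(3)[OF \<phi>] and \<phi> = kt_coordsD(2)[OF \<phi>]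
  note C = coordsD[OF \<phi>, simplified]
  let ?P = "mat_app B B' p" and ?Q = "mat_app B' B q"
  have QP: "?Q (?P f) = f" if "f \<in> fun_on B" for f
    using mat_app_cong[of B B "\<lambda>b d. \<Sum>c\<in>B'. p b c * q c d" unit_fun f] pq mat_app_id[OF C(1) that]
    by (simp add: mat_app_comp)
  have PQ: "?P (?Q f) = f" if "f \<in> fun_on B'" for f
    using mat_app_cong[of B' B' "\<lambda>c d. \<Sum>b\<in>B. q c b * p b d" unit_fun f] qp mat_app_id[OF B' that]
    by (simp add: mat_app_comp)
  have bij: "bij_betw ?P (fun_on B) (fun_on B')"
    by (rule bij_betwI[where g = ?Q]) (auto simp: mat_app_fun_on QP PQ)
  have "coords (restrict_scalars M) B' (?P \<circ> \<phi>)"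
    unfolding coords_def restrict_scalars_simps
  proof (intro conjI)
    show "bij_betw (?P \<circ> \<phi>) (carrier M) (fun_on B')"
      by (rule bij_betw_trans[OF C(4) bij])
  qed (simp_all add: C B' mat_app_zero mat_app_add mat_app_scale)
  moreover have "(?P \<circ> \<phi>) (t_op M v) = mat_app B' B' a' ((?P \<circ> \<phi>) v)" if "v \<in> carrier M" for v
    using t\<phi>[OF that] mat_app_cong[of B B' _ _ "\<phi> v", OF int] by (simp add: mat_app_comp)
  ultimately show ?thesis using M unfolding kt_pres_def kt_coords_def by blast
qed

lemma kt_pres_reindex:
  assumes pres: "kt_pres M B a" and g: "bij_betw g B B'"
    and eq: "\<And>b d. b \<in> B \<Longrightarrow> d \<in> B \<Longrightarrow> a' (g b) (g d) = a b d"
  shows "kt_pres M B' a'"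
proof -
  have B: "finite B" using pres coordsD(1) by (auto simp: kt_pres_def kt_coords_def)
  have B': "finite B'" using B g bij_betw_finite by blast
  have im: "B' = g ` B" and inj: "inj_on g B" using g by (auto simp: bij_betw_def)
  have sum: "(\<Sum>c\<in>B'. f c) = (\<Sum>b\<in>B. f (g b))" for f :: "_ \<Rightarrow> 'z::comm_monoid_add"
    unfolding im using inj by (simp add: sum.reindex)
  have eqg: "g b = g d \<longleftrightarrow> b = d" if "b \<in> B" "d \<in> B" for b d
    using inj that by (auto simp: inj_on_def)
  show ?thesis
  \<comment> \<open>\<open>p\<close> is the permutation matrix of \<open>g\<close> and
    \<open>q\<close> its transpose; every sum below has at most one nonzero term.\<close>
  proof (rule kt_pres_intertwine[OF pres B', where p = "\<lambda>b c. unit_fun (g b) c"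
      and q = "\<lambda>c b. unit_fun (g b) c"])
    fix b d assume bd: "b \<in> B" "d \<in> B"
    have "(\<Sum>c\<in>B. unit_fun (g b) (g c) * unit_fun (g d) (g c)) = (\<Sum>c\<in>B. if c = b then unit_fun d b
        else 0)"
      by (rule sum.cong) (auto simp: unit_fun_def eqg bd)
    then show "(\<Sum>c\<in>B'. unit_fun (g b) c * unit_fun (g d) c) = unit_fun b d"
      unfolding sum using B bd by (auto simp: unit_fun_def)
  next
    fix c d assume "c \<in> B'" "d \<in> B'"
    then obtain x y where xy: "x \<in> B" "y \<in> B" "c = g x" "d = g y" using im by auto
    have "(\<Sum>b\<in>B. unit_fun (g b) c * unit_fun (g b) d) = (\<Sum>b\<in>B. if b = x then unit_fun x y else 0)"
      by (rule sum.cong) (auto simp: unit_fun_def eqg xy)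
    then show "(\<Sum>b\<in>B. unit_fun (g b) c * unit_fun (g b) d) = unit_fun c d"
      using B xy by (auto simp: unit_fun_def eqg)
  next
    fix b d assume b: "b \<in> B" and "d \<in> B'"
    then obtain y where y: "y \<in> B" "d = g y" using im by auto
    have "(\<Sum>c\<in>B. a b c * unit_fun (g c) d) = (\<Sum>c\<in>B. if c = y then a b y else 0)"
      by (rule sum.cong) (auto simp: unit_fun_def eqg y)
    moreover have "(\<Sum>c\<in>B. unit_fun (g b) (g c) * a' (g c) d) = (\<Sum>c\<in>B. if c = b then a b y else 0)"
      by (rule sum.cong) (auto simp: unit_fun_def eqg y b eq)
    ultimately show "(\<Sum>c\<in>B. a b c * unit_fun (g c) d) = (\<Sum>c\<in>B'. unit_fun (g b) c * a' c d)"
      unfolding sum using B b y by simp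
  qed
qed

lemma kt_cls_reindex:
  assumes g: "bij_betw g B B'" and eq: "\<And>b d. b \<in> B \<Longrightarrow> d \<in> B \<Longrightarrow> a' (g b) (g d) = a b d"
  shows "kt_cls B a = kt_cls B' a'"
proof -
  have "a (inv_into B g b) (inv_into B g d) = a' b d" if "b \<in> B'" "d \<in> B'" for b d
    using that g eq by (auto simp: bij_betw_def)
  then show ?thesis
    unfolding kt_cls_def
    using kt_pres_reindex[OF _ g, of _ a a'] kt_pres_reindex[OF _ bij_betw_inv_into[OF g], of _ a'
        a] eq by auto
qed

lemma kt_cls_cong:
  assumes "\<And>b d. b \<in> B \<Longrightarrow> d \<in> B \<Longrightarrow> a' b d = a b d"
  shows "kt_cls B a = kt_cls B a'"
  by (rule kt_cls_reindex[of id]) (use assms in auto)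

lemma kt_class_of_eq:
  assumes "kt_pres M B a"
  shows "kt_class_of M = kt_cls B a"
proof (intro equalityI subsetI)
  fix N assume "N \<in> kt_class_of M"
  then show "N \<in> kt_cls B a"
    using kt_isomorphic_pres[OF assms]
        by (auto simp: kt_class_of_def kt_cls_def finite_kt_module_def)
next
  fix N assume "N \<in> kt_cls B a"
  then show "N \<in> kt_class_of M"
    using kt_pres_isomorphic[OF assms] kt_pres_finite by (auto simp: kt_class_of_def kt_cls_def)
qed

section \<open>Polynomials acting on coordinate vectors\<close>

definition poly_act :: "'b set \<Rightarrow> ('b \<Rightarrow> 'b \<Rightarrow> 'k::field) \<Rightarrow> 'k poly \<Rightarrow> ('b \<Rightarrow> 'k) \<Rightarrow> 'b \<Rightarrow> 'k" where
  "poly_act B a p f = (\<lambda>x. \<Sum>i\<le>degree p. coeff p i * ((mat_app B B a ^^ i) f) x)"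

text \<open>Coefficients beyond the degree vanish. A common bound for the summation makes
  polynomials of different degrees comparable, as addition and \<open>pCons\<close> require.\<close>

lemma poly_act_bound:
  assumes "degree p \<le> N"
  shows "poly_act B a p f = (\<lambda>x. \<Sum>i\<le>N. coeff p i * ((mat_app B B a ^^ i) f) x)"
  unfolding poly_act_def
  by (rule ext, rule sum.mono_neutral_left) (use assms in \<open>auto simp: coeff_eq_0\<close>)

lemma mat_app_sum:
  "finite S \<Longrightarrow> mat_app B C a (\<lambda>x. \<Sum>i\<in>S. f i x) = (\<lambda>x. \<Sum>i\<in>S. mat_app B C a (f i) x)"
  by (induction S rule: finite_induct) (simp_all add: mat_app_zero mat_app_add)

lemma poly_act_pCons:
  "poly_act B a (pCons c p) f = (\<lambda>x. c * f x + mat_app B B a (poly_act B a p f) x)"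
proof -
  have "mat_app B B a (poly_act B a p f) =
      (\<lambda>x. \<Sum>i\<le>degree p. coeff p i * ((mat_app B B a ^^ Suc i) f) x)"
    unfolding poly_act_def by (subst mat_app_sum) (simp_all add: mat_app_scale)
  moreover have "degree (pCons c p) \<le> Suc (degree p)" by (rule degree_pCons_le)
  ultimately show ?thesis
    by (simp add: poly_act_bound sum.atMost_Suc_shift del: sum.atMost_Suc)
qed

lemma poly_act_0: "poly_act B a 0 f = (\<lambda>x. 0)"
  by (simp add: poly_act_def)

lemma poly_act_const: "poly_act B a [:c:] f = (\<lambda>x. c * f x)"
  by (simp add: poly_act_pCons poly_act_0 mat_app_zero)

lemma poly_act_add: "poly_act B a (p + q) f = (\<lambda>x. poly_act B a p f x + poly_act B a q f x)"
proof -
  let ?N = "max (degree p) (degree q)"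
  have "degree (p + q) \<le> ?N" by (rule degree_add_le_max)
  then show ?thesis
    by (simp add: poly_act_bound[of "p + q" ?N] poly_act_bound[of p ?N] poly_act_bound[of q ?N]
        algebra_simps sum.distrib)
qed

lemma poly_act_smult: "poly_act B a (Polynomial.smult c p) f = (\<lambda>x. c * poly_act B a p f x)"
  using poly_act_bound[of "Polynomial.smult c p" "degree p"]
  by (simp add: poly_act_def sum_distrib_left mult.assoc)

lemma poly_act_mult: "poly_act B a (p * q) f = poly_act B a p (poly_act B a q f)"
proof (induction p)
  case 0
  show ?case by (simp add: poly_act_0)
next
  case (pCons c p)
  have "poly_act B a (pCons c p * q) f = poly_act B a (Polynomial.smult c q + pCons 0 (p * q)) f"
    by simp
  also have "\<dots> = (\<lambda>x. c * poly_act B a q f x + mat_app B B a (poly_act B a (p * q) f) x)"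
    by (simp only: poly_act_add poly_act_smult poly_act_pCons) simp
  finally show ?case by (simp add: pCons.IH poly_act_pCons)
qed

lemma poly_act_fun_add:
  "poly_act B a p (\<lambda>x. f x + g x) = (\<lambda>x. poly_act B a p f x + poly_act B a p g x)"
  by (induction p) (auto simp: poly_act_0 poly_act_pCons mat_app_add algebra_simps)

text \<open>In coordinates the scalar multiplication of \<open>kt_module\<close> is
  \<open>poly_act\<close> for the matrix that describes \<open>T\<close>. The laws of
  \<open>poly_act\<close>, pulled back along the injective \<open>\<phi>\<close>, give the module
  axioms.\<close>

lemma kt_pres_kt_module:
  assumes co: "coords V B \<phi>" and T: "\<And>v. v \<in> carrier V \<Longrightarrow> T v \<in> carrier V"
    and eq: "\<And>v. v \<in> carrier V \<Longrightarrow> \<phi> (T v) = mat_app B B a (\<phi> v)"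
  shows "kt_pres (kt_module V T) B a"
proof -
  note C = coordsD[OF co]
  interpret V: Module.module class_ring V by (rule coords_module[OF co])
  have eqI: "v = w" if "v \<in> carrier V" "w \<in> carrier V" "\<phi> v = \<phi> w" for v w
    using C(2) that by (simp add: inj_on_def)
  have Ti: "(T ^^ i) v \<in> carrier V \<and> \<phi> ((T ^^ i) v) = (mat_app B B a ^^ i) (\<phi> v)"
    if "v \<in> carrier V" for i v
    by (induction i) (use that T eq in auto)
  have fs: "(\<Oplus>\<^bsub>V\<^esub>i\<in>S. g i) \<in> carrier V \<and> \<phi> (\<Oplus>\<^bsub>V\<^esub>i\<in>S. g i) = (\<lambda>x. \<Sum>i\<in>S. \<phi> (g i) x)"
    if "finite S" "g \<in> S \<rightarrow> carrier V" for S :: "nat set" and g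
    using that
  proof (induction S rule: finite_induct)
    case (insert i S)
    then have "g i \<in> carrier V" "g \<in> S \<rightarrow> carrier V" by auto
    then show ?case using insert by (simp add: V.finsum_insert C)
  qed (simp add: C)
  let ?M = "kt_module V T"
  have sm: "p \<odot>\<^bsub>?M\<^esub> v = (\<Oplus>\<^bsub>V\<^esub>i\<in>{..degree p}. coeff p i \<odot>\<^bsub>V\<^esub> (T ^^ i) v)" for p v
    by (simp add: kt_module_def)
  have smult: "p \<odot>\<^bsub>?M\<^esub> v \<in> carrier V" "\<phi> (p \<odot>\<^bsub>?M\<^esub> v) = poly_act B a p (\<phi> v)"
    if "v \<in> carrier V" for p v
    using fs[of "{..degree p}" "\<lambda>i. coeff p i \<odot>\<^bsub>V\<^esub> (T ^^ i) v"] Ti[OF that]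
    by (simp_all add: sm poly_act_def C)
  have ab: "abelian_group ?M"
    by (rule abelian_groupI) (auto simp: V.a_ac intro: V.l_neg bexI[OF _ V.a_inv_closed])
  have "Module.module class_ring ?M"
    by (rule Module.moduleI[OF class_cring ab]; (rule eqI)?)
      (simp_all add: smult C poly_act_add poly_act_mult poly_act_fun_add one_pCons poly_act_const)
  moreover have "coords (restrict_scalars ?M) B \<phi>"
    unfolding coords_def restrict_scalars_simps kt_module_simps
    by (intro conjI) (simp_all add: C smult poly_act_const)
  moreover have "\<phi> (t_op ?M v) = mat_app B B a (\<phi> v)" if "v \<in> carrier ?M" for v
    using that by (simp add: t_op_def smult poly_act_pCons poly_act_0 mat_app_zero)
  ultimately show ?thesis unfolding kt_pres_def kt_coords_def by blast
qed

text \<open>Column \<open>b\<close> of \<open>A\<close> is the image of the basis vector at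
  \<open>b\<close>, while presentations store images as rows; hence the swapped indices.\<close>

lemma kt_pres_matrix_module:
  assumes "A \<in> carrier_mat n n"
  shows "kt_pres (matrix_module A) {..<n} (\<lambda>b c. A $$ (c, b))"
  unfolding matrix_module_def
proof (rule kt_pres_kt_module)
  have dim: "dim_row A = n" "dim_col A = n" using assms by auto
  let ?\<phi> = "\<lambda>v i. if i < n then v $ i else 0"
  show "coords (module_vec TYPE('a) (dim_row A)) {..<n} ?\<phi>"
    unfolding coords_def module_vec_simps dim
  proof (intro conjI)
    show "bij_betw ?\<phi> (carrier_vec n) (fun_on {..<n})"
      by (rule bij_betwI[where g = "vec n"]) (auto simp: fun_on_def)
  qed auto
  fix v assume "v \<in> carrier (module_vec TYPE('a) (dim_row A))"
  then have v: "v \<in> carrier_vec n" by (simp add: module_vec_simps dim)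
  then show "A *\<^sub>v v \<in> carrier (module_vec TYPE('a) (dim_row A))"
    using assms by (simp add: module_vec_simps)
  show "?\<phi> (A *\<^sub>v v) = mat_app {..<n} {..<n} (\<lambda>b c. A $$ (c, b)) (?\<phi> v)"
    using v dim by (auto simp: mat_app_def scalar_prod_def row_def lessThan_atLeast0 mult.commute
        intro!: sum.cong)
qed

section \<open>Kronecker products, block sums and direct sums\<close>

definition kron :: "('b \<Rightarrow> 'b \<Rightarrow> 'k::field) \<Rightarrow> ('c \<Rightarrow> 'c \<Rightarrow> 'k) \<Rightarrow> 'b \<times> 'c \<Rightarrow> 'b \<times> 'c \<Rightarrow> 'k" where
  "kron a a' = (\<lambda>(b, c) (b', c'). a b b' * a' c c')"

definition block :: "('b \<Rightarrow> 'b \<Rightarrow> 'k::field) \<Rightarrow> ('c \<Rightarrow> 'c \<Rightarrow> 'k) \<Rightarrow> 'b + 'c \<Rightarrow> 'b + 'c \<Rightarrow> 'k" where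
  "block a a' = (\<lambda>x y. case x of
     Inl b \<Rightarrow> (case y of Inl b' \<Rightarrow> a b b' | Inr _ \<Rightarrow> 0)
   | Inr c \<Rightarrow> (case y of Inl _ \<Rightarrow> 0 | Inr c' \<Rightarrow> a' c c'))"

lemma kt_pres_direct_sum:
  assumes "kt_pres M B a" "kt_pres N C a'"
  shows "kt_pres (direct_sum M N) (Sum_Type.Plus B C) (block a a')"
proof -
  obtain \<phi> where \<phi>: "kt_coords M B a \<phi>" using assms(1) by (auto simp: kt_pres_def)
  note M = kt_coordsD(1)[OF \<phi>] and t\<phi> = kt_coordsD(3)[OF \<phi>] and \<phi> = kt_coordsD(2)[OF \<phi>]
  obtain \<psi> where \<psi>: "kt_coords N C a' \<psi>" using assms(2) by (auto simp: kt_pres_def)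
  note N = kt_coordsD(1)[OF \<psi>] and t\<psi> = kt_coordsD(3)[OF \<psi>] and \<psi> = kt_coordsD(2)[OF \<psi>]
  note P = coordsD[OF \<phi>, simplified] and Q = coordsD[OF \<psi>, simplified]
  define \<chi> where "\<chi> = (\<lambda>(v, w). case_sum (\<phi> v) (\<psi> w))"
  have ds: "carrier (direct_sum M N) = carrier M \<times> carrier N" "\<zero>\<^bsub>direct_sum M N\<^esub> = (\<zero>\<^bsub>M\<^esub>, \<zero>\<^bsub>N\<^esub>)"
    "x \<oplus>\<^bsub>direct_sum M N\<^esub> y = (fst x \<oplus>\<^bsub>M\<^esub> fst y, snd x \<oplus>\<^bsub>N\<^esub> snd y)"
    "p \<odot>\<^bsub>direct_sum M N\<^esub> x = (p \<odot>\<^bsub>M\<^esub> fst x, p \<odot>\<^bsub>N\<^esub> snd x)" for x y p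
    by (simp_all add: direct_sum_def)
  have bij: "bij_betw \<chi> (carrier M \<times> carrier N) (fun_on (Sum_Type.Plus B C))"
  proof (rule bij_betwI[where g = "\<lambda>f. (inv_into (carrier M) \<phi> (f \<circ> Inl), inv_into (carrier N) \<psi> (f
      \<circ> Inr))"])
    show "\<chi> \<in> carrier M \<times> carrier N \<rightarrow> fun_on (Sum_Type.Plus B C)"
    proof
      fix x assume "x \<in> carrier M \<times> carrier N"
      then have "\<phi> (fst x) \<in> fun_on B" "\<psi> (snd x) \<in> fun_on C" using P(3) Q(3) by auto
      then show "\<chi> x \<in> fun_on (Sum_Type.Plus B C)"
        by (auto simp: \<chi>_def fun_on_def Plus_def image_iff split: sum.split prod.split)
    qed
    have Lf: "f \<circ> Inl \<in> \<phi> ` carrier M" "f \<circ> Inr \<in> \<psi> ` carrier N" if "f \<in> fun_on (Sum_Type.Plus B C)"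
        for f
      unfolding P(3) Q(3) using that by (auto simp: fun_on_def)
    show "(\<lambda>f. (inv_into (carrier M) \<phi> (f \<circ> Inl), inv_into (carrier N) \<psi> (f \<circ> Inr)))
        \<in> fun_on (Sum_Type.Plus B C) \<rightarrow> carrier M \<times> carrier N"
      using Lf by (auto intro: inv_into_into)
    show "(inv_into (carrier M) \<phi> (\<chi> x \<circ> Inl), inv_into (carrier N) \<psi> (\<chi> x \<circ> Inr)) = x"
      if "x \<in> carrier M \<times> carrier N" for x
    proof -
      have "\<chi> x \<circ> Inl = \<phi> (fst x)" "\<chi> x \<circ> Inr = \<psi> (snd x)" by (auto simp: \<chi>_def split: prod.split)
      then show ?thesis using that P(2) Q(2) by auto
    qed
    show "\<chi> (inv_into (carrier M) \<phi> (f \<circ> Inl), inv_into (carrier N) \<psi> (f \<circ> Inr)) = f"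
      if "f \<in> fun_on (Sum_Type.Plus B C)" for f
      using Lf[OF that] by (auto simp: \<chi>_def f_inv_into_f fun_eq_iff split: sum.split)
  qed
  have "coords (restrict_scalars (direct_sum M N)) (Sum_Type.Plus B C) \<chi>"
    unfolding coords_def restrict_scalars_simps
  proof (intro conjI)
    show "bij_betw \<chi> (carrier (direct_sum M N)) (fun_on (Sum_Type.Plus B C))" using bij
        by (simp add: ds)
  qed (auto simp: ds P Q \<chi>_def fun_eq_iff split: sum.split)
  moreover have "\<chi> (t_op (direct_sum M N) x) = mat_app (Sum_Type.Plus B C) (Sum_Type.Plus B C)
      (block a a') (\<chi> x)"
    if "x \<in> carrier (direct_sum M N)" for x
  proof -
    have x: "fst x \<in> carrier M" "snd x \<in> carrier N" using that by (auto simp: ds)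
    have "t_op (direct_sum M N) x = (t_op M (fst x), t_op N (snd x))" by (simp add: t_op_def ds)
    moreover have "(\<Sum>z\<in>Sum_Type.Plus B C. \<chi> x z * block a a' z y) =
       (case y of Inl b \<Rightarrow> (\<Sum>z\<in>B. \<phi> (fst x) z * a z b) | Inr c \<Rightarrow> (\<Sum>z\<in>C. \<psi> (snd x) z * a' z c))" for y
      by (auto simp: sum.Plus P(1) Q(1) \<chi>_def block_def split: sum.split prod.split)
    ultimately show ?thesis
      using t\<phi>[OF x(1)] t\<psi>[OF x(2)] by (auto simp: \<chi>_def mat_app_def fun_eq_iff split: sum.split)
  qed
  moreover have "Module.module class_ring (direct_sum M N)"
    by (rule direct_sum_is_module[OF M N])
  ultimately show ?thesis unfolding kt_pres_def kt_coords_def by blast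
qed

section \<open>Tensor products\<close>

abbreviation single1 :: "'p \<Rightarrow> 'p \<Rightarrow>\<^sub>0 'k::field" where
  "single1 p \<equiv> Poly_Mapping.single p 1"

abbreviation keys' :: "('p \<Rightarrow>\<^sub>0 'k::zero) \<Rightarrow> 'p set" where
  "keys' \<equiv> Poly_Mapping.keys"

text \<open>The linear functional on the free space with prescribed values on basis vectors; the
  coordinates of a tensor are read off by such functionals.\<close>

definition lin :: "('p \<Rightarrow> 'k::field) \<Rightarrow> ('p \<Rightarrow>\<^sub>0 'k) \<Rightarrow> 'k" where
  "lin h x = (\<Sum>p\<in>keys' x. Poly_Mapping.lookup x p * h p)"

lemma lookup_pm_scale [simp]: "Poly_Mapping.lookup (pm_scale c x) p = c * Poly_Mapping.lookup x p"
  by (simp add: pm_scale_def Poly_Mapping.map.rep_eq when_def)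

lemma keys_pm_scale: "keys' (pm_scale c x) \<subseteq> keys' x"
  by (auto simp: in_keys_iff)

lemma keys_add_subset: "keys' x \<subseteq> S \<Longrightarrow> keys' y \<subseteq> S \<Longrightarrow> keys' (x + y) \<subseteq> S"
  using keys_add[of x y] by blast

lemma keys_pm_scale_subset: "keys' x \<subseteq> S \<Longrightarrow> keys' (pm_scale c x) \<subseteq> S"
  using keys_pm_scale[of c x] by blast

lemma keys_sum_subset: "(\<And>i. i \<in> A \<Longrightarrow> keys' (g i) \<subseteq> S) \<Longrightarrow> keys' (sum g A) \<subseteq> S"
  by (induction A rule: infinite_finite_induct) (simp_all add: keys_add_subset)

lemma lin_bound:
  assumes "finite S" "keys' x \<subseteq> S"
  shows "lin h x = (\<Sum>p\<in>S. Poly_Mapping.lookup x p * h p)"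
  unfolding lin_def by (rule sum.mono_neutral_left) (use assms in \<open>auto simp: in_keys_iff\<close>)

lemma lin_add: "lin h (x + y) = lin h x + lin h y"
proof -
  have "keys' (x + y) \<subseteq> keys' x \<union> keys' y" by (rule keys_add)
  then show ?thesis
    by (simp add: lin_bound[of "keys' x \<union> keys' y"] lookup_add algebra_simps sum.distrib)
qed

lemma lin_scale: "lin h (pm_scale c x) = c * lin h x"
  by (subst lin_bound[OF finite_keys keys_pm_scale]) (simp add: lin_def sum_distrib_left mult.assoc)

lemma lin_0 [simp]: "lin h 0 = 0"
  by (simp add: lin_def)

lemma lin_single: "lin h (Poly_Mapping.single p c) = c * h p"
  by (simp add: lin_bound[of "{p}"])

lemma pm_scale_minus: "pm_scale (-1) x = - x"
  by (rule poly_mapping_eqI) (simp add: lookup_uminus)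

lemma lin_diff: "lin h (x - y) = lin h x - lin h y"
  using lin_add[of h x "- y"] lin_scale[of h "-1" y] by (simp add: pm_scale_minus)

lemma lin_sum: "lin h (sum g A) = (\<Sum>i\<in>A. lin h (g i))"
  by (induction A rule: infinite_finite_induct) (simp_all add: lin_add)

lemma lin_cong: "(\<And>p. p \<in> keys' x \<Longrightarrow> h p = h' p) \<Longrightarrow> lin h x = lin h' x"
  by (simp add: lin_def)

lemma lin_fun_sum: "lin (\<lambda>p. \<Sum>i\<in>A. g i * h i p) x = (\<Sum>i\<in>A. g i * lin (h i) x)"
  unfolding lin_def sum_distrib_left by (subst sum.swap) (simp add: algebra_simps)

lemma lin_linear_extension: "lin h (linear_extension g x) = lin (\<lambda>p. lin h (g p)) x"
  unfolding linear_extension_def lin_sum lin_scale by (simp add: lin_def)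

lemma pm_scale_simps:
  "pm_scale (c + d) x = pm_scale c x + pm_scale d x"
  "pm_scale c (x + y) = pm_scale c x + pm_scale c y"
  "pm_scale c (pm_scale d x) = pm_scale (c * d) x" "pm_scale 1 x = x" "pm_scale 0 x = 0" "pm_scale c
      0 = 0"
  by (auto intro!: poly_mapping_eqI simp: lookup_add algebra_simps)

lemma pm_scale_diff: "pm_scale c (x - y) = pm_scale c x - pm_scale c y"
  by (auto intro!: poly_mapping_eqI simp: lookup_minus right_diff_distrib)

lemma pm_scale_sum: "pm_scale c (sum g A) = (\<Sum>i\<in>A. pm_scale c (g i))"
  by (induction A rule: infinite_finite_induct) (simp_all add: pm_scale_simps)

lemma pm_scale_sum_left: "pm_scale (sum g A) x = (\<Sum>i\<in>A. pm_scale (g i) x)"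
  by (induction A rule: infinite_finite_induct) (simp_all add: pm_scale_simps)

lemma pm_scale_single: "pm_scale c (Poly_Mapping.single p d) = Poly_Mapping.single p (c * d)"
  by (rule poly_mapping_eqI) (simp add: lookup_single when_def)

lemma poly_mapping_expansion:
  "x = (\<Sum>p\<in>keys' x. pm_scale (Poly_Mapping.lookup x p) (single1 p))"
proof (rule poly_mapping_eqI)
  fix q
  have "(\<Sum>p\<in>keys' x. Poly_Mapping.lookup x p * (1 when p = q)) = (\<Sum>p\<in>keys' x. if p = q then
      Poly_Mapping.lookup x q else 0)"
    by (rule sum.cong) (auto simp: when_def)
  then show "Poly_Mapping.lookup x q =
    Poly_Mapping.lookup (\<Sum>p\<in>keys' x. pm_scale (Poly_Mapping.lookup x p) (single1 p)) q"
    by (simp add: lookup_sum lookup_single in_keys_iff)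
qed

lemma free_space_simps [simp]:
  "carrier (free_space S) = {x. keys' x \<subseteq> S}" "\<zero>\<^bsub>free_space S\<^esub> = 0"
  "x \<oplus>\<^bsub>free_space S\<^esub> y = x + y" "c \<odot>\<^bsub>free_space S\<^esub> x = pm_scale c x"
  by (simp_all add: free_space_def)

lemma free_space_module: "Module.module class_ring (free_space S :: ('k::field, 'p \<Rightarrow>\<^sub>0 'k) module)"
proof (rule Module.moduleI[OF class_cring])
  show "abelian_group (free_space S :: ('k, 'p \<Rightarrow>\<^sub>0 'k) module)"
  proof (rule abelian_groupI)
    fix x :: "'p \<Rightarrow>\<^sub>0 'k" assume "x \<in> carrier (free_space S)"
    then show "\<exists>y\<in>carrier (free_space S). y \<oplus>\<^bsub>free_space S\<^esub> x = \<zero>\<^bsub>free_space S\<^esub>"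
      by (intro bexI[of _ "- x"]) simp_all
  qed (simp_all add: keys_add_subset add_ac)
qed (simp_all add: keys_pm_scale_subset keys_add_subset pm_scale_simps)

lemma coords_free_space:
  fixes S :: "'p set"
  assumes "finite S"
  shows "coords (free_space S :: ('k::field, 'p \<Rightarrow>\<^sub>0 'k) module) S Poly_Mapping.lookup"
  unfolding coords_def free_space_simps mem_Collect_eq
proof (intro conjI ballI allI)
  show "bij_betw Poly_Mapping.lookup {x :: 'p \<Rightarrow>\<^sub>0 'k. keys' x \<subseteq> S} (fun_on S)"
  proof (rule bij_betwI[where g = Abs_poly_mapping])
    have fin: "finite {p. f p \<noteq> 0}" if "f \<in> fun_on S" for f :: "'p \<Rightarrow> 'k"
      by (rule finite_subset[OF _ assms]) (use that in \<open>auto simp: fun_on_def\<close>)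
    show "Poly_Mapping.lookup \<in> {x :: 'p \<Rightarrow>\<^sub>0 'k. keys' x \<subseteq> S} \<rightarrow> fun_on S"
      by (auto simp: fun_on_def in_keys_iff subset_iff)
    show "Abs_poly_mapping \<in> fun_on S \<rightarrow> {x :: 'p \<Rightarrow>\<^sub>0 'k. keys' x \<subseteq> S}"
    proof
      fix f :: "'p \<Rightarrow> 'k" assume f: "f \<in> fun_on S"
      show "Abs_poly_mapping f \<in> {x :: 'p \<Rightarrow>\<^sub>0 'k. keys' x \<subseteq> S}"
        using f fin[OF f] by (auto simp: in_keys_iff fun_on_def)
    qed
    show "Poly_Mapping.lookup (Abs_poly_mapping f) = f" if "f \<in> fun_on S" for f :: "'p \<Rightarrow> 'k"
      using fin[OF that] by simp
  qed simp
qed (simp_all add: assms keys_pm_scale_subset keys_add_subset lookup_add fun_eq_iff)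

text \<open>A map that is linear modulo \<open>K\<close> is determined modulo \<open>K\<close> by
  its values on a basis. It is meant for \<open>v \<mapsto> v \<otimes> w\<close> into the free
  space, which becomes linear only modulo the bilinearity relations.\<close>

lemma subspace_approx:
  fixes K :: "('p \<Rightarrow>\<^sub>0 'k::field) set"
  assumes co: "coords V B \<phi>" and K: "0 \<in> K" "\<And>x y. x \<in> K \<Longrightarrow> y \<in> K \<Longrightarrow> x + y \<in> K"
      "\<And>c x. x \<in> K \<Longrightarrow> pm_scale c x \<in> K"
    and add: "\<And>v w. v \<in> carrier V \<Longrightarrow> w \<in> carrier V \<Longrightarrow> g (v \<oplus>\<^bsub>V\<^esub> w) - g v - g w \<in> K"
    and scale: "\<And>c v. v \<in> carrier V \<Longrightarrow> g (c \<odot>\<^bsub>V\<^esub> v) - pm_scale c (g v) \<in> K"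
    and v: "v \<in> carrier V"
  shows "g v - (\<Sum>b\<in>B. pm_scale (\<phi> v b) (g (basis_vec V \<phi> b))) \<in> K"
  using co v
proof (induction rule: coords_induct)
  note C = coordsD[OF co]
  case zero
  have "0 \<odot>\<^bsub>V\<^esub> \<zero>\<^bsub>V\<^esub> = \<zero>\<^bsub>V\<^esub>" using C by (intro inj_onD[OF C(2)]) simp_all
  then have "g \<zero>\<^bsub>V\<^esub> \<in> K" using scale[OF C(5), of 0] by (simp add: pm_scale_simps)
  then show ?case by (simp add: C pm_scale_simps)
next
  note C = coordsD[OF co]
  case (step v b c)
  note e = basis_vec[OF co step(2)]
  let ?e = "basis_vec V \<phi>" and ?v = "v \<oplus>\<^bsub>V\<^esub> c \<odot>\<^bsub>V\<^esub> basis_vec V \<phi> b"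
  have "(\<Sum>b'\<in>B. pm_scale (\<phi> ?v b') (g (?e b'))) =
      (\<Sum>b'\<in>B. pm_scale (\<phi> v b') (g (?e b')) + (if b' = b then pm_scale c (g (?e b)) else 0))"
    by (rule sum.cong) (use step e in \<open>auto simp: C unit_fun_def pm_scale_simps\<close>)
  also have "\<dots> = (\<Sum>b'\<in>B. pm_scale (\<phi> v b') (g (?e b'))) + pm_scale c (g (?e b))"
    using C(1) step(2) by (simp add: sum.distrib)
  finally have "g ?v - (\<Sum>b'\<in>B. pm_scale (\<phi> ?v b') (g (?e b'))) =
      (g ?v - g v - g (c \<odot>\<^bsub>V\<^esub> ?e b)) + (g (c \<odot>\<^bsub>V\<^esub> ?e b) - pm_scale c (g (?e b)))
      + (g v - (\<Sum>b\<in>B. pm_scale (\<phi> v b) (g (?e b))))"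
    by simp
  also have "\<dots> \<in> K"
    using step e by (intro K(2) add scale) (simp_all add: C)
  finally show ?case .
qed

lemma mem_sum_closed:
  fixes K :: "'z::comm_monoid_add set"
  assumes "0 \<in> K" "\<And>x y. x \<in> K \<Longrightarrow> y \<in> K \<Longrightarrow> x + y \<in> K" "\<And>i. i \<in> A \<Longrightarrow> f i \<in> K"
  shows "sum f A \<in> K"
  using assms(3) by (induction A rule: infinite_finite_induct) (auto intro: assms(1,2))

section \<open>Coordinates on a tensor product\<close>

locale tensor_coords =
  fixes V :: "('k::field, 'v) module" and W :: "('k, 'w) module"
    and B :: "'b set" and C :: "'c set" and \<phi> \<psi>
  assumes V: "coords V B \<phi>" and W: "coords W C \<psi>"
begin

abbreviation FS :: "('k, 'v \<times> 'w \<Rightarrow>\<^sub>0 'k) module" where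
  "FS \<equiv> free_space (carrier V \<times> carrier W)"

abbreviation K :: "('v \<times> 'w \<Rightarrow>\<^sub>0 'k) set" where
  "K \<equiv> tensor_kernel V W"

text \<open>The linear extension of \<open>(v, w) \<mapsto> \<phi> v \<otimes> \<psi> w\<close> to
  the free space. It induces coordinates on the tensor product once its kernel is known to be
  \<open>K\<close>.\<close>

definition \<Psi> :: "('v \<times> 'w \<Rightarrow>\<^sub>0 'k) \<Rightarrow> 'b \<times> 'c \<Rightarrow> 'k" where
  "\<Psi> x = (\<lambda>(b, c). lin (\<lambda>(v, w). \<phi> v b * \<psi> w c) x)"

definition fiber :: "('b \<times> 'c \<Rightarrow> 'k) \<Rightarrow> ('v \<times> 'w \<Rightarrow>\<^sub>0 'k) set" where
  "fiber g = {x \<in> carrier FS. \<Psi> x = g}"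

lemmas VD = coordsD[OF V] and WD = coordsD[OF W]

lemma \<Psi>_add: "\<Psi> (x + y) = (\<lambda>p. \<Psi> x p + \<Psi> y p)"
  by (auto simp: \<Psi>_def lin_add)

lemma \<Psi>_diff: "\<Psi> (x - y) = (\<lambda>p. \<Psi> x p - \<Psi> y p)"
  by (auto simp: \<Psi>_def lin_diff)

lemma \<Psi>_scale: "\<Psi> (pm_scale c x) = (\<lambda>p. c * \<Psi> x p)"
  by (auto simp: \<Psi>_def lin_scale)

lemma \<Psi>_single: "\<Psi> (Poly_Mapping.single (v, w) d) = (\<lambda>(b, c). d * (\<phi> v b * \<psi> w c))"
  by (auto simp: \<Psi>_def lin_single)

lemma relations_carrier: "tensor_relations V W \<subseteq> carrier FS"
proof -
  have kd: "keys' (x - y) \<subseteq> S" if "keys' x \<subseteq> S" "keys' y \<subseteq> S" for x y :: "'v \<times> 'w \<Rightarrow>\<^sub>0 'k" and S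
    using keys_diff[of x y] that by blast
  have ks: "keys' (Poly_Mapping.single p c) \<subseteq> S" if "p \<in> S" for p and c :: 'k
      and S :: "('v \<times> 'w) set"
    using that by simp
  show ?thesis
    unfolding tensor_relations_def free_space_simps
    by (rule subsetI; elim UnE CollectE exE conjE; simp only: mem_Collect_eq; intro kd ks; simp add:
        VD WD)
qed

interpretation FS: Module.module class_ring FS
  by (rule free_space_module)

lemma K_submodule: "submodule class_ring K FS"
  unfolding tensor_kernel_def by (rule FS.span_is_submodule[OF relations_carrier])

lemma relations_K: "tensor_relations V W \<subseteq> K"
  unfolding tensor_kernel_def by (rule FS.in_own_span[OF relations_carrier])

lemma K_closed: "0 \<in> K" "x \<in> K \<Longrightarrow> y \<in> K \<Longrightarrow> x + y \<in> K" "x \<in> K \<Longrightarrow> pm_scale c x \<in> K"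
  using submodule.zero_closed[OF K_submodule] submodule.m_closed[OF K_submodule, of x y]
    submodule.smult_closed[OF K_submodule, of c x] by simp_all

lemma K_subset: "K \<subseteq> fiber (\<lambda>p. 0)"
  unfolding tensor_kernel_def
proof (rule FS.span_is_subset)
  show "submodule class_ring (fiber (\<lambda>p. 0)) FS"
    by (rule submodule.intro[OF free_space_module])
      (auto simp: fiber_def \<Psi>_add \<Psi>_scale keys_pm_scale_subset keys_add_subset, simp add: \<Psi>_def
          fun_eq_iff)
  have "\<Psi> x = (\<lambda>p. 0)" if "x \<in> tensor_relations V W" for x
    using that unfolding tensor_relations_def
    by (elim UnE CollectE exE conjE; simp only: \<Psi>_diff \<Psi>_single VD WD;
        simp add: fun_eq_iff algebra_simps)
  then show "tensor_relations V W \<subseteq> fiber (\<lambda>p. 0)"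
    using relations_carrier by (auto simp: fiber_def)
qed

definition E :: "'b \<Rightarrow> 'c \<Rightarrow> 'v \<times> 'w \<Rightarrow>\<^sub>0 'k" where
  "E b c = single1 (basis_vec V \<phi> b, basis_vec W \<psi> c)"

text \<open>\<open>subspace_approx\<close> expands \<open>v\<close> with \<open>w\<close> fixed, and
  then \<open>w\<close> in each resulting term. The errors of the second expansion are multiplied by
  the coefficients of the first and stay in \<open>K\<close>.\<close>

lemma single_approx:
  assumes v: "v \<in> carrier V" and w: "w \<in> carrier W"
  shows "single1 (v, w) - (\<Sum>b\<in>B. \<Sum>c\<in>C. pm_scale (\<phi> v b * \<psi> w c) (E b c)) \<in> K"
proof -
  let ?e = "basis_vec V \<phi>" and ?f = "basis_vec W \<psi>"
  have 1: "single1 (v, w) - (\<Sum>b\<in>B. pm_scale (\<phi> v b) (single1 (?e b, w))) \<in> K"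
  proof (rule subspace_approx[OF V K_closed _ _ v, where g = "\<lambda>v. single1 (v, w)"])
    fix v1 v2 assume "v1 \<in> carrier V" "v2 \<in> carrier V"
    then show "single1 (v1 \<oplus>\<^bsub>V\<^esub> v2, w) - single1 (v1, w)
        - single1 (v2, w) \<in> K"
      using w by (intro subsetD[OF relations_K]) (unfold tensor_relations_def, blast)
  next
    fix c v1 assume "v1 \<in> carrier V"
    then show "single1 (c \<odot>\<^bsub>V\<^esub> v1, w) - pm_scale c (single1 (v1, w)) \<in> K"
      using w by (intro subsetD[OF relations_K]) (unfold tensor_relations_def pm_scale_single
          mult_1_right, blast)
  qed
  have 2: "single1 (v, w) - (\<Sum>c\<in>C. pm_scale (\<psi> w c) (single1 (v, ?f c))) \<in> K"
    if v: "v \<in> carrier V" for v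
  proof (rule subspace_approx[OF W K_closed _ _ w, where g = "\<lambda>w. single1 (v, w)"])
    fix v1 v2 assume "v1 \<in> carrier W" "v2 \<in> carrier W"
    then show "single1 (v, v1 \<oplus>\<^bsub>W\<^esub> v2) - single1 (v, v1)
        - single1 (v, v2) \<in> K"
      using v by (intro subsetD[OF relations_K]) (unfold tensor_relations_def, blast)
  next
    fix c v1 assume "v1 \<in> carrier W"
    then show "single1 (v, c \<odot>\<^bsub>W\<^esub> v1) - pm_scale c (single1 (v, v1)) \<in> K"
      using v by (intro subsetD[OF relations_K]) (unfold tensor_relations_def pm_scale_single
          mult_1_right, blast)
  qed
  have 3: "(\<Sum>b\<in>B. pm_scale (\<phi> v b) (single1 (?e b, w) -
      (\<Sum>c\<in>C. pm_scale (\<psi> w c) (single1 (?e b, ?f c))))) \<in> K"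
    by (intro mem_sum_closed K_closed 2 basis_vec(1)[OF V])
  have eq: "single1 (v, w) - (\<Sum>b\<in>B. \<Sum>c\<in>C. pm_scale (\<phi> v b * \<psi> w c) (E b c)) =
     (single1 (v, w) - (\<Sum>b\<in>B. pm_scale (\<phi> v b) (single1 (?e b, w)))) +
     (\<Sum>b\<in>B. pm_scale (\<phi> v b) (single1 (?e b, w) -
      (\<Sum>c\<in>C. pm_scale (\<psi> w c) (single1 (?e b, ?f c)))))"
    by (simp add: pm_scale_diff pm_scale_sum pm_scale_simps sum_subtractf E_def)
  show ?thesis unfolding eq by (rule K_closed(2)[OF 1 3])
qed

text \<open>One inclusion says that \<open>\<Psi>\<close> respects bilinearity. For the other, each
  pure tensor in \<open>x\<close> may be replaced modulo \<open>K\<close> by its expansion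
  \<open>R p\<close> in basis tensors; the expansions add up to the combination with coefficients
  \<open>\<Psi> x\<close>, which is 0.\<close>

lemma K_eq: "K = fiber (\<lambda>p. 0)"
proof (intro equalityI subsetI)
  fix x assume "x \<in> K" then show "x \<in> fiber (\<lambda>p. 0)" using K_subset by blast
next
  fix x assume "x \<in> fiber (\<lambda>p. 0)"
  then have x: "keys' x \<subseteq> carrier V \<times> carrier W" "\<Psi> x = (\<lambda>p. 0)" by (auto simp: fiber_def)
  let ?l = "Poly_Mapping.lookup x"
  define R where "R = (\<lambda>(v, w). \<Sum>b\<in>B. \<Sum>c\<in>C. pm_scale (\<phi> v b * \<psi> w c) (E b c))"
  have "(\<Sum>p\<in>keys' x. pm_scale (?l p) (single1 p - R p)) \<in> K"
  proof (intro mem_sum_closed K_closed)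
    fix p assume "p \<in> keys' x"
    then show "single1 p - R p \<in> K"
      using x(1) single_approx[of "fst p" "snd p"] by (auto simp: R_def split: prod.split)
  qed
  moreover have "(\<Sum>p\<in>keys' x. pm_scale (?l p) (R p)) = 0"
  proof -
    have "(\<Sum>p\<in>keys' x. pm_scale (?l p) (R p)) =
        (\<Sum>p\<in>keys' x. \<Sum>b\<in>B. \<Sum>c\<in>C. pm_scale (?l p * (\<phi> (fst p) b * \<psi> (snd p) c)) (E b c))"
      by (simp add: R_def case_prod_beta pm_scale_sum pm_scale_simps)
    also have "\<dots> = (\<Sum>b\<in>B. \<Sum>c\<in>C. \<Sum>p\<in>keys' x. pm_scale (?l p * (\<phi> (fst p) b * \<psi> (snd p) c)) (E b c))"
      by (subst sum.swap) (intro sum.cong refl sum.swap)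
    also have "\<dots> = (\<Sum>b\<in>B. \<Sum>c\<in>C. pm_scale (\<Psi> x (b, c)) (E b c))"
      by (simp add: \<Psi>_def lin_def case_prod_beta pm_scale_sum_left)
    finally show ?thesis by (simp add: x(2) pm_scale_simps)
  qed
  ultimately show "x \<in> K"
    using poly_mapping_expansion[of x] by (simp add: pm_scale_diff sum_subtractf)
qed

lemma \<Psi>_fun_on: "x \<in> carrier FS \<Longrightarrow> \<Psi> x \<in> fun_on (B \<times> C)"
proof -
  assume "x \<in> carrier FS"
  then have x: "keys' x \<subseteq> carrier V \<times> carrier W" by simp
  have "\<Psi> x (b, c) = 0" if "(b, c) \<notin> B \<times> C" for b c
  proof -
    have "\<phi> (fst p) b * \<psi> (snd p) c = 0" if "p \<in> keys' x" for p
    proof -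
      have "\<phi> (fst p) \<in> fun_on B" "\<psi> (snd p) \<in> fun_on C"
        using that x coords_fun_on[OF V, of "fst p"] coords_fun_on[OF W, of "snd p"] by auto
      then show ?thesis using \<open>(b, c) \<notin> B \<times> C\<close> by (auto simp: fun_on_def)
    qed
    then show ?thesis by (simp add: \<Psi>_def lin_def case_prod_beta)
  qed
  then show ?thesis by (auto simp: fun_on_def)
qed

lemma fiber_inhabited:
  assumes "g \<in> fun_on (B \<times> C)"
  obtains x where "x \<in> fiber g"
proof -
  define x where "x = (\<Sum>p\<in>B \<times> C. pm_scale (g p) (E (fst p) (snd p)))"
  have "\<Psi> x (b, c) = g (b, c)" for b c
  proof -
    have "\<Psi> x (b, c) = (\<Sum>p\<in>B \<times> C. g p * (unit_fun (fst p) b * unit_fun (snd p) c))"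
      unfolding x_def \<Psi>_def
      by (auto simp: lin_sum lin_scale E_def lin_single basis_vec(2)[OF V] basis_vec(2)[OF W]
          intro!: sum.cong)
    also have "\<dots> = (\<Sum>p\<in>B \<times> C. if p = (b, c) then g (b, c) else 0)"
      by (rule sum.cong) (auto simp: unit_fun_def)
    also have "\<dots> = g (b, c)"
      using assms VD(1) WD(1) by (auto simp: fun_on_def)
    finally show ?thesis .
  qed
  moreover have "x \<in> carrier FS"
    unfolding x_def free_space_simps mem_Collect_eq
    by (intro keys_sum_subset keys_pm_scale_subset) (auto simp: E_def basis_vec(1)[OF V]
        basis_vec(1)[OF W])
  ultimately have "x \<in> fiber g" by (auto simp: fiber_def)
  then show thesis by (rule that)
qed

text \<open>With \<open>K\<close> known as the kernel of \<open>\<Psi>\<close>, cosets are fibres,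
  and the quotient can be computed with functions on \<open>B \<times> C\<close>.\<close>

lemma coset_eq:
  assumes "x \<in> carrier FS"
  shows "K +>\<^bsub>FS\<^esub> x = fiber (\<Psi> x)"
proof (intro equalityI subsetI)
  fix y assume "y \<in> K +>\<^bsub>FS\<^esub> x"
  then obtain k where "k \<in> K" "y = k + x" by (auto simp: a_r_coset_def')
  then show "y \<in> fiber (\<Psi> x)"
    using assms by (simp add: K_eq fiber_def \<Psi>_add keys_add_subset)
next
  fix y assume y: "y \<in> fiber (\<Psi> x)"
  have "keys' (y - x) \<subseteq> carrier V \<times> carrier W"
    using keys_diff[of y x] y assms by (auto simp: fiber_def)
  then have "y - x \<in> K" using y by (simp add: K_eq fiber_def \<Psi>_diff)
  moreover have "y = (y - x) \<oplus>\<^bsub>FS\<^esub> x" by simp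
  ultimately show "y \<in> K +>\<^bsub>FS\<^esub> x" unfolding a_r_coset_def' by blast
qed

text \<open>\<open>\<Psi>\<close> is constant on each fibre, and the elements of the tensor space
  are nonempty fibres, so the chosen representative does not matter.\<close>

definition \<Phi> :: "('v \<times> 'w \<Rightarrow>\<^sub>0 'k) set \<Rightarrow> 'b \<times> 'c \<Rightarrow> 'k" where
  "\<Phi> X = \<Psi> (SOME x. x \<in> X)"

lemma \<Phi>_fiber: "g \<in> fun_on (B \<times> C) \<Longrightarrow> \<Phi> (fiber g) = g"
proof -
  assume "g \<in> fun_on (B \<times> C)"
  then obtain x where "x \<in> fiber g" by (rule fiber_inhabited)
  then have "(SOME x. x \<in> fiber g) \<in> fiber g" by (rule someI)
  then show ?thesis by (simp add: \<Phi>_def fiber_def)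
qed

lemma tensor_space_simps:
  "carrier (tensor_space V W) = fiber ` fun_on (B \<times> C)"
  "\<zero>\<^bsub>tensor_space V W\<^esub> = fiber (\<lambda>p. 0)"
proof -
  have "carrier (tensor_space V W) = (\<lambda>x. fiber (\<Psi> x)) ` carrier FS"
    unfolding tensor_space_def quotient_space_def A_RCOSETS_def'
    using coset_eq by (auto simp del: free_space_simps)
  also have "\<dots> = fiber ` \<Psi> ` carrier FS" by (simp add: image_image)
  also have "\<Psi> ` carrier FS = fun_on (B \<times> C)"
  proof (intro equalityI subsetI)
    fix g :: "'b \<times> 'c \<Rightarrow> 'k" assume "g \<in> \<Psi> ` carrier FS"
    then obtain x where "g = \<Psi> x" "x \<in> carrier FS" by (rule imageE)
    then show "g \<in> fun_on (B \<times> C)" using \<Psi>_fun_on by simp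
  next
    fix g :: "'b \<times> 'c \<Rightarrow> 'k" assume "g \<in> fun_on (B \<times> C)"
    then obtain x where "x \<in> fiber g" by (rule fiber_inhabited)
    then have "g = \<Psi> x" "x \<in> carrier FS" by (simp_all add: fiber_def)
    then show "g \<in> \<Psi> ` carrier FS" by (rule image_eqI)
  qed
  finally show "carrier (tensor_space V W) = fiber ` fun_on (B \<times> C)" .
  show "\<zero>\<^bsub>tensor_space V W\<^esub> = fiber (\<lambda>p. 0)"
    by (simp add: tensor_space_def quotient_space_def K_eq)
qed

lemma fiber_add:
  assumes "g \<in> fun_on (B \<times> C)"
  shows "fiber g \<oplus>\<^bsub>tensor_space V W\<^esub> fiber h = fiber (\<lambda>p. g p + h p)"
proof -
  obtain u where u: "u \<in> fiber g" using assms by (rule fiber_inhabited)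
  have "fiber g <+>\<^bsub>FS\<^esub> fiber h = fiber (\<lambda>p. g p + h p)"
  proof (intro equalityI subsetI)
    fix y assume "y \<in> fiber g <+>\<^bsub>FS\<^esub> fiber h"
    then obtain x1 x2 where x: "x1 \<in> fiber g" "x2 \<in> fiber h" "y = x1 + x2"
      by (auto simp: set_add_def')
    then show "y \<in> fiber (\<lambda>p. g p + h p)"
      by (simp add: fiber_def \<Psi>_add keys_add_subset)
  next
    fix y assume y: "y \<in> fiber (\<lambda>p. g p + h p)"
    have "keys' (y - u) \<subseteq> carrier V \<times> carrier W"
      using keys_diff[of y u] y u by (auto simp: fiber_def)
    then have "y - u \<in> fiber h" using y u by (simp add: fiber_def \<Psi>_diff)
    moreover have "y = u \<oplus>\<^bsub>FS\<^esub> (y - u)" by simp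
    ultimately show "y \<in> fiber g <+>\<^bsub>FS\<^esub> fiber h" using u unfolding set_add_def' by blast
  qed
  then show ?thesis by (simp add: tensor_space_def quotient_space_def)
qed

text \<open>Scalar multiplication and \<open>tensor_map\<close> both take a union of cosets over all
  representatives; the cosets coincide, so the union is one of them.\<close>

lemma fiber_union:
  assumes g: "g \<in> fun_on (B \<times> C)" and F: "\<And>x. x \<in> fiber g \<Longrightarrow> F x \<in> carrier FS \<and> \<Psi> (F x) = h"
  shows "(\<Union>x\<in>fiber g. K +>\<^bsub>FS\<^esub> F x) = fiber h"
proof -
  obtain u where u: "u \<in> fiber g" using g by (rule fiber_inhabited)
  have "K +>\<^bsub>FS\<^esub> F x = fiber h" if "x \<in> fiber g" for x
    using F[OF that] coset_eq[of "F x"] by simp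
  then show ?thesis using u by auto
qed

lemma fiber_smult:
  assumes g: "g \<in> fun_on (B \<times> C)"
  shows "c \<odot>\<^bsub>tensor_space V W\<^esub> fiber g = fiber (\<lambda>p. c * g p)"
proof -
  have "(\<Union>x\<in>fiber g. K +>\<^bsub>FS\<^esub> pm_scale c x) = fiber (\<lambda>p. c * g p)"
    by (rule fiber_union[OF g]) (simp add: fiber_def \<Psi>_scale keys_pm_scale_subset)
  then show ?thesis by (simp add: tensor_space_def quotient_space_def)
qed

lemma coords_tensor_space: "coords (tensor_space V W) (B \<times> C) \<Phi>"
proof -
  have zero: "(\<lambda>p. 0 :: 'k) \<in> fun_on (B \<times> C)" by (simp add: fun_on_def)
  have add: "(\<lambda>p. g p + h p) \<in> fun_on (B \<times> C)" if "g \<in> fun_on (B \<times> C)" "h \<in> fun_on (B \<times> C)"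
      for g h :: "'b \<times> 'c \<Rightarrow> 'k"
    using that by (simp add: fun_on_def)
  have scale: "(\<lambda>p. c * g p) \<in> fun_on (B \<times> C)" if "g \<in> fun_on (B \<times> C)" for g and c :: 'k
    using that by (simp add: fun_on_def)
  show ?thesis
    unfolding coords_def tensor_space_simps
  proof (intro conjI)
    show "bij_betw \<Phi> (fiber ` fun_on (B \<times> C)) (fun_on (B \<times> C))"
      by (rule bij_betwI[where g = fiber]) (auto simp: \<Phi>_fiber)
  qed (use VD(1) WD(1) zero add scale in \<open>auto simp: \<Phi>_fiber fiber_add fiber_smult\<close>)
qed

text \<open>On a pure tensor the coordinates of \<open>S v \<otimes> T w\<close> are products of two
  sums, hence a double sum with coefficients \<open>kron a a'\<close>; linearity on the free space
  does the rest.\<close>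

lemma tensor_map_fiber:
  assumes S: "\<And>v. v \<in> carrier V \<Longrightarrow> S v \<in> carrier V" and T: "\<And>w. w \<in> carrier W \<Longrightarrow> T w \<in> carrier W"
    and Sa: "\<And>v. v \<in> carrier V \<Longrightarrow> \<phi> (S v) = mat_app B B a (\<phi> v)"
    and Ta: "\<And>w. w \<in> carrier W \<Longrightarrow> \<psi> (T w) = mat_app C C a' (\<psi> w)"
    and g: "g \<in> fun_on (B \<times> C)"
  shows "tensor_map V W S T (fiber g) = fiber (mat_app (B \<times> C) (B \<times> C) (kron a a') g)"
  unfolding tensor_map_def
proof (rule fiber_union[OF g])
  fix x assume "x \<in> fiber g"
  then have x: "keys' x \<subseteq> carrier V \<times> carrier W" and \<Psi>x: "\<Psi> x = g" by (auto simp: fiber_def)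
  let ?x = "linear_extension (\<lambda>(v, w). single1 (S v, T w)) x"
  have carr: "?x \<in> carrier FS"
    unfolding linear_extension_def free_space_simps mem_Collect_eq
    by (intro keys_sum_subset keys_pm_scale_subset) (use x S T in auto)
  have "\<Psi> ?x (b', c') = mat_app (B \<times> C) (B \<times> C) (kron a a') g (b', c')" for b' c'
  proof (cases "(b', c') \<in> B \<times> C")
    case False
    then show ?thesis using \<Psi>_fun_on[OF carr] by (auto simp: fun_on_def mat_app_def)
  next
    case True
    then have bc: "b' \<in> B" "c' \<in> C" by auto
    have "\<Psi> ?x (b', c') = lin (\<lambda>p. \<phi> (S (fst p)) b' * \<psi> (T (snd p)) c') x"
      unfolding \<Psi>_def by (simp add: lin_linear_extension case_prod_beta lin_single)
    also have "\<dots> = lin (\<lambda>p. \<Sum>i\<in>B \<times> C. kron a a' i (b', c') * (\<phi> (fst p) (fst i) * \<psi> (snd p) (snd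
        i))) x"
    proof (rule lin_cong)
      fix p assume "p \<in> keys' x"
      then have p: "fst p \<in> carrier V" "snd p \<in> carrier W" using x by auto
      have "\<phi> (S (fst p)) b' * \<psi> (T (snd p)) c' =
        (\<Sum>b\<in>B. \<phi> (fst p) b * a b b') * (\<Sum>c\<in>C. \<psi> (snd p) c * a' c c')"
        using bc by (simp add: Sa[OF p(1)] Ta[OF p(2)] mat_app_def)
      also have "\<dots> = (\<Sum>i\<in>B \<times> C. kron a a' i (b', c') * (\<phi> (fst p) (fst i) * \<psi> (snd p) (snd i)))"
        by (simp add: sum_product sum.cartesian_product kron_def case_prod_beta algebra_simps)
      finally show "\<phi> (S (fst p)) b' * \<psi> (T (snd p)) c' =
        (\<Sum>i\<in>B \<times> C. kron a a' i (b', c') * (\<phi> (fst p) (fst i) * \<psi> (snd p) (snd i)))" .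
    qed
    also have "\<dots> = (\<Sum>i\<in>B \<times> C. kron a a' i (b', c') * \<Psi> x i)"
      unfolding lin_fun_sum by (simp add: \<Psi>_def case_prod_unfold)
    finally show ?thesis using True by (simp add: mat_app_def \<Psi>x mult.commute)
  qed
  then show "?x \<in> carrier FS \<and> \<Psi> ?x = mat_app (B \<times> C) (B \<times> C) (kron a a') g"
    using carr by auto
qed

end

lemma kt_pres_tensor:
  assumes "kt_pres M B a" "kt_pres N C a'"
  shows "kt_pres (kt_tensor M N) (B \<times> C) (kron a a')"
proof -
  obtain \<phi> where \<phi>: "kt_coords M B a \<phi>" using assms(1) by (auto simp: kt_pres_def)
  note M = kt_coordsD(1)[OF \<phi>] and t\<phi> = kt_coordsD(3)[OF \<phi>] and \<phi> = kt_coordsD(2)[OF \<phi>]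
  obtain \<psi> where \<psi>: "kt_coords N C a' \<psi>" using assms(2) by (auto simp: kt_pres_def)
  note N = kt_coordsD(1)[OF \<psi>] and t\<psi> = kt_coordsD(3)[OF \<psi>] and \<psi> = kt_coordsD(2)[OF \<psi>]
  interpret tensor_coords "restrict_scalars M" "restrict_scalars N" B C \<phi> \<psi>
    by (rule tensor_coords.intro[OF \<phi> \<psi>])
  let ?V = "restrict_scalars M" and ?W = "restrict_scalars N"
  have tm: "tensor_map ?V ?W (t_op M) (t_op N) (fiber g) = fiber (mat_app (B \<times> C) (B \<times> C) (kron a
      a') g)"
    if "g \<in> fun_on (B \<times> C)" for g
    by (rule tensor_map_fiber) (simp_all add: t_op_closed[OF M] t_op_closed[OF N] t\<phi> t\<psi> that)
  show ?thesis
    unfolding kt_tensor_def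
  proof (rule kt_pres_kt_module[OF coords_tensor_space])
    fix X assume "X \<in> carrier (tensor_space ?V ?W)"
    then obtain g where g: "g \<in> fun_on (B \<times> C)" "X = fiber g" by (auto simp: tensor_space_simps)
    show "tensor_map ?V ?W (t_op M) (t_op N) X \<in> carrier (tensor_space ?V ?W)"
      by (simp add: g tm tensor_space_simps mat_app_fun_on)
    show "\<Phi> (tensor_map ?V ?W (t_op M) (t_op N) X) = mat_app (B \<times> C) (B \<times> C) (kron a a') (\<Phi> X)"
      by (simp add: g tm \<Phi>_fiber mat_app_fun_on)
  qed
qed

definition partial_mat :: "('b \<Rightarrow> 'b option) \<Rightarrow> 'b \<Rightarrow> 'b \<Rightarrow> 'k::field" where
  "partial_mat s b c = (if s b = Some c then 1 else 0)"

lemma kt_pres_base_change: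
  assumes M: "finite_t_module M"
  shows "kt_pres (base_change M :: ('k::field poly, 'a \<Rightarrow>\<^sub>0 'k) module) (carrier M - {base M})
      (partial_mat (to_partial_map M))"
  unfolding base_change_def
proof (rule kt_pres_kt_module)
  let ?S = "carrier M - {base M}"
  let ?g = "\<lambda>x. if act M x = base M then 0 else single1 (act M x) :: 'a \<Rightarrow>\<^sub>0 'k"
  have fin: "finite ?S" using M by (simp add: finite_t_module_def)
  then show "coords (free_space ?S :: ('k, 'a \<Rightarrow>\<^sub>0 'k) module) ?S Poly_Mapping.lookup"
    by (rule coords_free_space)
  fix v :: "'a \<Rightarrow>\<^sub>0 'k" assume "v \<in> carrier (free_space ?S)"
  then have v: "keys' v \<subseteq> ?S" by simp
  show cl: "linear_extension ?g v \<in> carrier (free_space ?S)"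
    unfolding linear_extension_def free_space_simps mem_Collect_eq
    by (intro keys_sum_subset keys_pm_scale_subset) (use v M in \<open>auto simp: finite_t_module_def\<close>)
  show "Poly_Mapping.lookup (linear_extension ?g v) =
      mat_app ?S ?S (partial_mat (to_partial_map M)) (Poly_Mapping.lookup v)"
  proof
    fix c
    show "Poly_Mapping.lookup (linear_extension ?g v) c =
      mat_app ?S ?S (partial_mat (to_partial_map M)) (Poly_Mapping.lookup v) c"
    proof (cases "c \<in> ?S")
      case False
      then show ?thesis using cl by (auto simp: mat_app_def in_keys_iff subset_iff simp del:
          Diff_iff)
    next
      case True
      have "Poly_Mapping.lookup (linear_extension ?g v) c = lin (\<lambda>x. Poly_Mapping.lookup (?g x) c)
          v"
        by (simp add: linear_extension_def lookup_sum lin_def)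
      also have "\<dots> = lin (\<lambda>x. partial_mat (to_partial_map M) x c) v"
        using True by (intro lin_cong) (auto simp: partial_mat_def to_partial_map_def lookup_single)
      also have "\<dots> = (\<Sum>x\<in>?S. Poly_Mapping.lookup v x * partial_mat (to_partial_map M) x c)"
        by (rule lin_bound[OF fin v])
      finally show ?thesis using True by (simp add: mat_app_def)
    qed
  qed
qed

section \<open>The base change homomorphism\<close>

lemma kt_cls_inhabited:
  fixes a :: "'b \<Rightarrow> 'b \<Rightarrow> 'k::field"
  assumes "finite B"
  obtains N where "N \<in> kt_cls B a"
proof -
  obtain g where "bij_betw g {0..<card B} B"
    using ex_bij_betw_nat_finite[OF assms] by blast
  then have g: "bij_betw g {..<card B} B" by (simp add: lessThan_atLeast0)
  \<comment> \<open>The indices are swapped to undo the transposition in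
    \<open>kt_pres_matrix_module\<close>.\<close>
  define A where "A = mat (card B) (card B) (\<lambda>(i, j). a (g j) (g i))"
  have "kt_pres (matrix_module A) {..<card B} (\<lambda>b c. A $$ (c, b))"
    by (rule kt_pres_matrix_module) (simp add: A_def)
  then have "kt_pres (matrix_module A) B a"
    by (rule kt_pres_reindex[OF _ g]) (simp add: A_def)
  then show thesis using that by (simp add: kt_cls_def)
qed

lemma kt_cls_member: "N \<in> kt_cls B a \<Longrightarrow> finite_kt_module N \<and> kt_class_of N = kt_cls B a"
  using kt_class_of_eq[of N B a] kt_pres_finite[of N B a] by (simp add: kt_cls_def)

lemma kt_cls_in_classes: "finite B \<Longrightarrow> kt_cls B a \<in> kt_classes"
  using kt_cls_inhabited[of B a] kt_cls_member unfolding kt_classes_def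
  by (metis (mono_tags, lifting) image_eqI mem_Collect_eq)

text \<open>An index set inside the module has a type that varies with the module; numbering its
  elements puts all presentations on natural numbers.\<close>

lemma kt_class_of_cls:
  fixes M :: "('k::field poly, 'v) module"
  assumes "finite_kt_module M"
  obtains B :: "nat set" and a where "finite B" "kt_pres M B a"
proof -
  obtain \<beta> :: "'v set" and a where \<beta>: "kt_pres M \<beta> a"
    using finite_kt_module_pres[OF assms] .
  then have "finite \<beta>" using coordsD(1) by (auto simp: kt_pres_def kt_coords_def)
  then obtain g where g: "bij_betw g \<beta> {0..<card \<beta>}"
    using ex_bij_betw_finite_nat by blast
  have "kt_pres M {0..<card \<beta>} (\<lambda>i j. a (inv_into \<beta> g i) (inv_into \<beta> g j))"
    by (rule kt_pres_reindex[OF \<beta> g]) (use g in \<open>auto simp: bij_betw_def\<close>)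
  then show thesis using that[of "{0..<card \<beta>}"] by simp
qed

lemma kt_classesE:
  fixes X :: "'k::field kt_class"
  assumes "X \<in> kt_classes"
  obtains B :: "nat set" and a where "finite B" "X = kt_cls B a"
proof -
  obtain M :: "('k poly, 'k vec) module" where M: "finite_kt_module M" "X = kt_class_of M"
    using assms by (auto simp: kt_classes_def)
  obtain B :: "nat set" and a where "finite B" "kt_pres M B a"
    using kt_class_of_cls[OF M(1)] .
  then show thesis using that M(2) kt_class_of_eq by metis
qed

definition kt_class_add :: "'k::field kt_class \<Rightarrow> 'k kt_class \<Rightarrow> 'k kt_class" where
  "kt_class_add X Y = (\<Union>M\<in>X. \<Union>N\<in>Y. kt_class_of (direct_sum M N))"

lemma UN2_const:
  assumes "x \<in> X" "y \<in> Y" "\<And>x y. x \<in> X \<Longrightarrow> y \<in> Y \<Longrightarrow> f x y = A"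
  shows "(\<Union>x\<in>X. \<Union>y\<in>Y. f x y) = A"
  using assms by auto

lemma kt_class_mult_cls:
  assumes "finite B" "finite C"
  shows "kt_class_mult (kt_cls B a) (kt_cls C a') = kt_cls (B \<times> C) (kron a a')"
proof -
  obtain M N where "M \<in> kt_cls B a" "N \<in> kt_cls C a'"
    using kt_cls_inhabited[OF assms(1)] kt_cls_inhabited[OF assms(2)] by metis
  then show ?thesis
    unfolding kt_class_mult_def
  proof (rule UN2_const)
    fix M N assume "M \<in> kt_cls B a" "N \<in> kt_cls C a'"
    then show "kt_class_of (kt_tensor M N) = kt_cls (B \<times> C) (kron a a')"
      by (intro kt_class_of_eq kt_pres_tensor) (simp_all add: kt_cls_def)
  qed
qed

lemma kt_class_add_cls:
  assumes "finite B" "finite C"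
  shows "kt_class_add (kt_cls B a) (kt_cls C a') = kt_cls (Sum_Type.Plus B C) (block a a')"
proof -
  obtain M N where "M \<in> kt_cls B a" "N \<in> kt_cls C a'"
    using kt_cls_inhabited[OF assms(1)] kt_cls_inhabited[OF assms(2)] by metis
  then show ?thesis
    unfolding kt_class_add_def
  proof (rule UN2_const)
    fix M N assume "M \<in> kt_cls B a" "N \<in> kt_cls C a'"
    then show "kt_class_of (direct_sum M N) = kt_cls (Sum_Type.Plus B C) (block a a')"
      by (intro kt_class_of_eq kt_pres_direct_sum) (simp_all add: kt_cls_def)
  qed
qed

lemma kt_class_of_kt_unit: "kt_class_of (kt_unit :: ('k::field poly, 'k vec) module) = kt_cls
    {0::nat} (\<lambda>_ _. 1)"
proof -
  have "kt_pres (matrix_module (1\<^sub>m 1 :: 'k mat)) {..<1} (\<lambda>b c. (1\<^sub>m 1 :: 'k mat) $$ (c, b))"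
    by (rule kt_pres_matrix_module) simp
  then have "kt_class_of (kt_unit :: ('k poly, 'k vec) module) = kt_cls {..<1} (\<lambda>b c. (1\<^sub>m 1 :: 'k
      mat) $$ (c, b))"
    unfolding kt_unit_def by (rule kt_class_of_eq)
  also have "\<dots> = kt_cls {0::nat} (\<lambda>_ _. 1)"
    by (rule kt_cls_reindex[where g = id]) (auto simp: bij_betw_def)
  finally show ?thesis .
qed

text \<open>The bijections are those used for pointed modules; the laws of the field match the
  matrix entries.\<close>

lemma kt_split_grothendieck:
  "split_grothendieck (kt_classes :: 'k::field kt_class set) kt_class_mult kt_class_add (kt_class_of
      kt_unit)"
proof
  fix X :: "'k kt_class" assume "X \<in> kt_classes"
  then obtain B :: "nat set" and a where B: "finite B" "X = kt_cls B a" by (rule kt_classesE)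
  have u: "finite {0::nat}" by simp
  show "kt_class_mult (kt_class_of kt_unit) X = X"
    unfolding kt_class_of_kt_unit B(2) kt_class_mult_cls[OF u B(1)]
    by (rule kt_cls_reindex[where g = snd]) (auto simp: bij_betw_def inj_on_def kron_def)
  fix Y :: "'k kt_class" assume "Y \<in> kt_classes"
  then obtain C :: "nat set" and a' where C: "finite C" "Y = kt_cls C a'" by (rule kt_classesE)
  have BC: "finite (B \<times> C)" "finite (Sum_Type.Plus B C)" using B C by auto
  show "kt_class_mult X Y \<in> kt_classes" "kt_class_add X Y \<in> kt_classes"
    unfolding B(2) C(2) kt_class_mult_cls[OF B(1) C(1)] kt_class_add_cls[OF B(1) C(1)]
    by (rule kt_cls_in_classes, rule BC)+
  show "kt_class_mult X Y = kt_class_mult Y X"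
    unfolding B(2) C(2) kt_class_mult_cls[OF B(1) C(1)] kt_class_mult_cls[OF C(1) B(1)]
    by (rule kt_cls_reindex[where g = prod.swap])
      (auto simp: bij_betw_def inj_on_def kron_def product_swap)
  fix Z :: "'k kt_class" assume "Z \<in> kt_classes"
  then obtain D :: "nat set" and a'' where D: "finite D" "Z = kt_cls D a''" by (rule kt_classesE)
  have fin: "finite (B \<times> D)" "finite (C \<times> D)" "finite (Sum_Type.Plus C D)" using B C D by auto
  show "kt_class_mult (kt_class_mult X Y) Z = kt_class_mult X (kt_class_mult Y Z)"
    unfolding B(2) C(2) D(2) kt_class_mult_cls[OF B(1) C(1)] kt_class_mult_cls[OF C(1) D(1)]
      kt_class_mult_cls[OF BC(1) D(1)] kt_class_mult_cls[OF B(1) fin(2)]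
    by (rule kt_cls_reindex[OF bij_assoc_map]) (auto simp: assoc_map_def kron_def)
  show "kt_class_mult X (kt_class_add Y Z) = kt_class_add (kt_class_mult X Y) (kt_class_mult X Z)"
    unfolding B(2) C(2) D(2) kt_class_mult_cls[OF B(1) C(1)] kt_class_mult_cls[OF B(1) D(1)]
      kt_class_add_cls[OF C(1) D(1)] kt_class_mult_cls[OF B(1) fin(3)] kt_class_add_cls[OF BC(1)
          fin(1)]
    by (rule kt_cls_reindex[OF bij_distrib_map])
      (auto simp: distrib_map_def kron_def block_def split: sum.split)
next
  show "kt_class_of kt_unit \<in> (kt_classes :: 'k kt_class set)"
    unfolding kt_class_of_kt_unit by (rule kt_cls_in_classes) simp
qed

interpretation KT: split_grothendieck "kt_classes :: 'k::field kt_class set" kt_class_mult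
    kt_class_add "kt_class_of kt_unit"
  by (rule kt_split_grothendieck)

section \<open>Identification with the two rings as defined\<close>

lemma t_class_add_class_of:
  assumes "finite_t_module M" "finite_t_module N"
  shows "t_class_add (t_class_of M) (t_class_of N) = t_class_of (wedge M N)"
  using t_class_of_wedge[OF assms partial_map_to_partial_map[OF assms(1)]
      partial_map_to_partial_map[OF assms(2)]
      t_isomorphic_opt_module[OF assms(1)] t_isomorphic_opt_module[OF assms(2)]]
    t_class_add_cls[OF partial_map_to_partial_map[OF assms(1)] partial_map_to_partial_map[OF
        assms(2)]]
    t_class_of_eq_t_cls[OF assms(1)] t_class_of_eq_t_cls[OF assms(2)]
  by simp

lemma kt_class_add_class_of:
  assumes "finite_kt_module M" "finite_kt_module N"
  shows "kt_class_add (kt_class_of M) (kt_class_of N) = kt_class_of (direct_sum M N)"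
proof -
  obtain B :: "nat set" and a where B: "finite B" "kt_pres M B a"
      using kt_class_of_cls[OF assms(1)] .
  obtain C :: "nat set" and a' where C: "finite C" "kt_pres N C a'"
      using kt_class_of_cls[OF assms(2)] .
  show ?thesis
    unfolding kt_class_of_eq[OF B(2)] kt_class_of_eq[OF C(2)] kt_class_add_cls[OF B(1) C(1)]
      kt_class_of_eq[OF kt_pres_direct_sum[OF B(2) C(2)]] ..
qed

text \<open>The relations of the locale range over classes, those of the defining ideals over
  modules. A sum of two modules lives on another type than its summands, so the class map occurs in
  two type instances, \<open>cl\<close> and \<open>cl'\<close>.\<close>

lemma relations_image:
  assumes C: "C = cl ` {M. fin M}"
    and s: "\<And>M N. fin M \<Longrightarrow> fin N \<Longrightarrow> s (cl M) (cl N) = cl' (pl M N)"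
  shows "{frag_of (s X Y) - frag_of X - frag_of Y | X Y. X \<in> C \<and> Y \<in> C} =
    {frag_of (cl' (pl M N)) - frag_of (cl M) - frag_of (cl N) | M N. fin M \<and> fin N}"
proof (intro equalityI subsetI)
  fix x assume "x \<in> {frag_of (s X Y) - frag_of X - frag_of Y | X Y. X \<in> C \<and> Y \<in> C}"
  then obtain X Y where x: "x = frag_of (s X Y) - frag_of X - frag_of Y" and "X \<in> C" "Y \<in> C"
    by blast
  then obtain M N where "X = cl M" "fin M" "Y = cl N" "fin N"
    unfolding C by (elim imageE CollectE) metis
  then show "x \<in> {frag_of (cl' (pl M N)) - frag_of (cl M) - frag_of (cl N) | M N. fin M \<and> fin N}"
    using x s[of M N] by (intro CollectI exI[of _ M] exI[of _ N]) simp
next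
  fix x assume "x \<in> {frag_of (cl' (pl M N)) - frag_of (cl M) - frag_of (cl N) | M N. fin M \<and> fin N}"
  then obtain M N where "x = frag_of (cl' (pl M N)) - frag_of (cl M) - frag_of (cl N)" "fin M" "fin
      N"
    by blast
  then show "x \<in> {frag_of (s X Y) - frag_of X - frag_of Y | X Y. X \<in> C \<and> Y \<in> C}"
    unfolding C using s[of M N] by (intro CollectI exI[of _ "cl M"] exI[of _ "cl N"]) simp
qed

lemma F1_relations:
  "F1.relations = {frag_of (t_class_of (wedge M N)) - frag_of (t_class_of M) - frag_of (t_class_of
      N) |
        (M :: nat t_module) (N :: nat t_module). finite_t_module M \<and> finite_t_module N}"
  unfolding F1.relations_def
  by (rule relations_image) (simp_all add: t_classes_def t_class_add_class_of)

lemma KT_relations: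
  "(KT.relations :: ('k::field kt_class \<Rightarrow>\<^sub>0 int) set) =
     {frag_of (kt_class_of (direct_sum M N)) - frag_of (kt_class_of M) - frag_of (kt_class_of N) |
        (M :: ('k poly, 'k vec) module) (N :: ('k poly, 'k vec) module).
        finite_kt_module M \<and> finite_kt_module N}"
  unfolding KT.relations_def
  by (rule relations_image) (simp_all add: kt_classes_def kt_class_add_class_of)

lemma split_ideal_F1_eq: "split_ideal_F1 = F1.I"
  unfolding split_ideal_F1_def F1.I_def F1.F_def free_ring_F1_def F1_relations ..

lemma split_ideal_kt_eq: "split_ideal_kt = KT.I"
  unfolding split_ideal_kt_def KT.I_def KT.F_def free_ring_kt_def KT_relations ..

lemma K0_F1_eq: "K0_F1 = F1.F Quot F1.I"
  unfolding K0_F1_def split_ideal_F1_eq by (simp add: F1.F_def free_ring_F1_def)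

lemma K0_kt_eq: "K0_kt = KT.F Quot KT.I"
  unfolding K0_kt_def split_ideal_kt_eq by (simp add: KT.F_def free_ring_kt_def)

lemma K0_F1_class_eq: "K0_F1_class M = F1.cls (t_class_of M)"
  unfolding K0_F1_class_def split_ideal_F1_eq F1.cls_def by (simp add: F1.F_def free_ring_F1_def)

lemma K0_kt_class_eq: "K0_kt_class M = KT.cls (kt_class_of M)"
  unfolding K0_kt_class_def split_ideal_kt_eq KT.cls_def by (simp add: KT.F_def free_ring_kt_def)

text \<open>Off the base points the isomorphism restricts to a bijection of bases under which the
  two 0-1 matrices correspond. The class of a base change can thus be computed from any partial map
  that represents \<open>M\<close>.\<close>

lemma kt_class_of_base_change:
  assumes M: "finite_t_module M" and iso: "t_isomorphic M (opt_module B s)"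
  shows "kt_class_of (base_change M :: ('k::field poly, 'a \<Rightarrow>\<^sub>0 'k) module) = kt_cls B (partial_mat
      s)"
proof -
  obtain f where f: "f \<in> t_hom M (opt_module B s)" "bij_betw f (carrier M) (insert None (Some ` B))"
    using iso by (auto simp: t_isomorphic_def opt_module_def)
  let ?S = "carrier M - {base M}"
  have fb: "f (base M) = None" using f(1) by (simp add: t_hom_def opt_module_def)
  have bM: "base M \<in> carrier M" using M by (simp add: finite_t_module_def)
  have "bij_betw f ?S (insert None (Some ` B) - {f (base M)})"
    using bij_betw_DiffI[OF f(2), of "{base M}" "{f (base M)}"] bM by (simp add: fb bij_betw_def)
  then have fS: "bij_betw f ?S (Some ` B)" by (simp add: fb)
  have "bij_betw the (Some ` B) B" by (auto simp: bij_betw_def inj_on_def image_image)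
  then have g: "bij_betw (the \<circ> f) ?S B" by (rule bij_betw_trans[OF fS])
  have Some: "f x = Some ((the \<circ> f) x)" if "x \<in> ?S" for x
  proof -
    have "f x \<in> Some ` B" using imageI[OF that, of f] fS by (simp add: bij_betw_def)
    then show ?thesis by auto
  qed
  have "kt_class_of (base_change M :: ('k poly, 'a \<Rightarrow>\<^sub>0 'k) module) = kt_cls ?S (partial_mat
      (to_partial_map M))"
    by (rule kt_class_of_eq[OF kt_pres_base_change[OF M]])
  also have "\<dots> = kt_cls B (partial_mat s)"
  proof (rule kt_cls_reindex[OF g])
    fix b d assume b: "b \<in> ?S" and d: "d \<in> ?S"
    have act: "act M b \<in> carrier M" using b M by (auto simp: finite_t_module_def)
    have "f (act M b) = Option.bind (f b) s" using f(1) b by (simp add: t_hom_def opt_module_def)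
    then have "f (act M b) = s ((the \<circ> f) b)" using Some[OF b] by (metis bind.bind_lunit)
    moreover have "f (act M b) = Some ((the \<circ> f) d) \<longleftrightarrow> act M b = d"
      using Some[OF d] f(2) act d by (auto simp: bij_betw_def inj_on_def)
    ultimately show "partial_mat s ((the \<circ> f) b) ((the \<circ> f) d) = (partial_mat (to_partial_map M) b d
        :: 'k)"
      using d by (auto simp: partial_mat_def to_partial_map_def)
  qed
  finally show ?thesis .
qed

lemma kt_class_of_base_change_member:
  assumes "partial_map B s" "M \<in> t_cls B s"
  shows "kt_class_of (base_change M :: ('k::field poly, nat \<Rightarrow>\<^sub>0 'k) module) = kt_cls B (partial_mat
      s)"
  by (rule kt_class_of_base_change[OF t_cls_member[OF assms]])

type_synonym 'k K0_map = "(t_class \<Rightarrow>\<^sub>0 int) set \<Rightarrow> ('k kt_class \<Rightarrow>\<^sub>0 int) set"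

text \<open>Defined through an arbitrary representative; \<open>base_change_class_cls\<close> shows
  that the choice has no influence.\<close>

definition base_change_class :: "t_class \<Rightarrow> ('k::field kt_class \<Rightarrow>\<^sub>0 int) set" where
  "base_change_class X = KT.cls (kt_class_of (base_change (SOME M. M \<in> X)))"

lemma base_change_class_cls:
  assumes "partial_map B s"
  shows "base_change_class (t_cls B s) = KT.cls (kt_cls B (partial_mat s) :: 'k::field kt_class)"
proof -
  have "(SOME M. M \<in> t_cls B s) \<in> t_cls B s"
    using t_cls_nonempty[OF assms] by (simp add: some_in_eq)
  then show ?thesis
    by (simp add: base_change_class_def kt_class_of_base_change_member[OF assms])
qed

text \<open>Compatibility with products and sums comes down to two identities, checked entry by
  entry: the 0-1 matrix of \<open>prod_map\<close> is a Kronecker product, and that of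
  \<open>sum_map\<close> is a block sum. The unit is a single loop, with the 1 by 1 identity
  matrix.\<close>

lemma base_change_hom_exists:
  "\<exists>\<Phi> :: 'k::field K0_map.
     ring_hom_ring K0_F1 K0_kt \<Phi> \<and> (\<forall>X\<in>t_classes. \<Phi> (F1.cls X) = base_change_class X)"
proof -
  have fin: "finite B" if "partial_map B s" for B :: "'b set" and s using that
      by (simp add: partial_map_def)
  let ?h = "base_change_class :: t_class \<Rightarrow> ('k kt_class \<Rightarrow>\<^sub>0 int) set"
  obtain \<Phi> where "ring_hom_ring (F1.F Quot F1.I) (KT.F Quot KT.I) \<Phi>" "\<And>X. X \<in> t_classes \<Longrightarrow> \<Phi> (F1.cls
      X) = ?h X"
  proof (rule F1.hom_exists[of "KT.F Quot KT.I" ?h])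
    show "ring (KT.F Quot KT.I)" by (rule KT.Q_ring)
    show "?h \<in> t_classes \<rightarrow> carrier (KT.F Quot KT.I)"
    proof
      fix X assume "X \<in> t_classes"
      then obtain B :: "nat set" and s where B: "partial_map B s" "X = t_cls B s"
          by (rule t_classesE)
      show "?h X \<in> carrier (KT.F Quot KT.I)"
        unfolding B(2) base_change_class_cls[OF B(1)]
        by (intro KT.cls_closed kt_cls_in_classes fin[OF B(1)])
    qed
    have unit: "partial_map {1::nat} Some" by (simp add: partial_map_def)
    have "kt_cls {1::nat} (partial_mat Some) = (kt_class_of kt_unit :: 'k kt_class)"
      unfolding kt_class_of_kt_unit
      by (rule kt_cls_reindex[where g = "\<lambda>_. 0"]) (auto simp: partial_mat_def bij_betw_def)
    then show "?h (t_class_of t_unit) = \<one>\<^bsub>KT.F Quot KT.I\<^esub>"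
      unfolding t_class_of_t_unit base_change_class_cls[OF unit] by (simp add: KT.cls_one)
  next
    fix X Y assume "X \<in> t_classes" and Y: "Y \<in> t_classes"
    then obtain B :: "nat set" and s where B: "partial_map B s" "X = t_cls B s" using t_classesE
        by blast
    obtain C :: "nat set" and r where C: "partial_map C r" "Y = t_cls C r" using t_classesE[OF Y] .
    have cls: "(kt_cls B (partial_mat s) :: 'k kt_class) \<in> kt_classes" "(kt_cls C (partial_mat r) ::
        'k kt_class) \<in> kt_classes"
      by (intro kt_cls_in_classes fin[OF B(1)] fin[OF C(1)])+
    have "(kt_cls (B \<times> C) (partial_mat (prod_map s r)) :: 'k kt_class) =
        kt_cls (B \<times> C) (kron (partial_mat s) (partial_mat r))"
      by (rule kt_cls_cong) (auto simp: kron_def partial_mat_def prod_map_Pair split: option.splits)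
    then show "?h (t_class_mult X Y) = ?h X \<otimes>\<^bsub>KT.F Quot KT.I\<^esub> ?h Y"
      unfolding B(2) C(2) t_class_mult_cls[OF B(1) C(1)] base_change_class_cls[OF B(1)]
        base_change_class_cls[OF C(1)] base_change_class_cls[OF partial_map_prod[OF B(1) C(1)]]
      using cls by (simp add: kt_class_mult_cls fin[OF B(1)] fin[OF C(1)] flip: KT.cls_mult)
    have "(kt_cls (Sum_Type.Plus B C) (partial_mat (sum_map s r)) :: 'k kt_class) =
        kt_cls (Sum_Type.Plus B C) (block (partial_mat s) (partial_mat r))"
      by (rule kt_cls_cong) (auto simp: block_def partial_mat_def sum_map_def split: sum.split)
    then show "?h (t_class_add X Y) = ?h X \<oplus>\<^bsub>KT.F Quot KT.I\<^esub> ?h Y"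
      unfolding B(2) C(2) t_class_add_cls[OF B(1) C(1)] base_change_class_cls[OF B(1)]
        base_change_class_cls[OF C(1)] base_change_class_cls[OF partial_map_sum[OF B(1) C(1)]]
      using cls by (simp add: kt_class_add_cls fin[OF B(1)] fin[OF C(1)] flip: KT.cls_add)
  next
    fix \<Psi> assume "ring_hom_ring (F1.F Quot F1.I) (KT.F Quot KT.I) \<Psi>"
      and "\<And>X. X \<in> t_classes \<Longrightarrow> \<Psi> (F1.cls X) = ?h X"
    then show thesis by (rule that)
  qed
  then show ?thesis unfolding K0_F1_eq K0_kt_eq by (intro exI[of _ \<Phi>]) simp
qed

lemma is_base_change_hom_iff:
  "is_base_change_hom (\<Phi> :: 'k::field K0_map) \<longleftrightarrow>
     ring_hom_ring K0_F1 K0_kt \<Phi> \<and> (\<forall>X\<in>t_classes. \<Phi> (F1.cls X) = base_change_class X)"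
proof -
  have "base_change_class (t_class_of M) = KT.cls (kt_class_of (base_change M :: ('k poly, nat \<Rightarrow>\<^sub>0
      'k) module))"
    if "finite_t_module M" for M :: "nat t_module"
    unfolding t_class_of_eq_t_cls[OF that] base_change_class_cls[OF partial_map_to_partial_map[OF
        that]]
      kt_class_of_base_change[OF that t_isomorphic_opt_module[OF that]] ..
  then show ?thesis
    unfolding is_base_change_hom_def t_classes_def K0_F1_class_eq K0_kt_class_eq by auto
qed

lemma base_change_hom_unique:
  fixes \<Phi> \<Phi>' :: "'k::field K0_map"
  assumes "is_base_change_hom \<Phi>" "is_base_change_hom \<Phi>'" "x \<in> carrier K0_F1"
  shows "\<Phi> x = \<Phi>' x"
proof (rule F1.hom_unique)
  show "ring_hom_ring (F1.F Quot F1.I) K0_kt \<Phi>" "ring_hom_ring (F1.F Quot F1.I) K0_kt \<Phi>'"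
    using assms by (simp_all add: is_base_change_hom_iff flip: K0_F1_eq)
  show "\<Phi> (F1.cls X) = \<Phi>' (F1.cls X)" if "X \<in> t_classes" for X
    using assms that by (simp add: is_base_change_hom_iff)
  show "x \<in> carrier (F1.F Quot F1.I)" using assms(3) by (simp flip: K0_F1_eq)
qed

text \<open>The values on classes determine a homomorphism on the carrier only. Uniqueness as a
  function needs a fixed value elsewhere, which \<open>extensional\<close> provides.\<close>

theorem ex1_base_change_hom:
  "\<exists>!\<Phi> :: 'k::field K0_map.
     \<Phi> \<in> extensional (carrier K0_F1) \<and> is_base_change_hom \<Phi>"
proof (rule ex_ex1I)
  obtain \<Phi> :: "'k K0_map"
    where \<Phi>: "ring_hom_ring K0_F1 K0_kt \<Phi>" "\<forall>X\<in>t_classes. \<Phi> (F1.cls X) = base_change_class X"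
    using base_change_hom_exists by blast
  interpret \<Phi>: ring_hom_ring K0_F1 K0_kt \<Phi> by fact
  have "ring_hom_ring K0_F1 K0_kt (restrict \<Phi> (carrier K0_F1))"
    by (rule ring_hom_ringI) (auto simp: \<Phi>.R.ring_axioms \<Phi>.S.ring_axioms)
  then have "is_base_change_hom (restrict \<Phi> (carrier K0_F1))"
    using \<Phi>(2) F1.cls_closed by (auto simp: is_base_change_hom_iff K0_F1_eq)
  then show "\<exists>\<Phi> :: 'k K0_map.
      \<Phi> \<in> extensional (carrier K0_F1) \<and> is_base_change_hom \<Phi>"
    by (intro exI[of _ "restrict \<Phi> (carrier K0_F1)"]) simp
next
  fix \<Phi> \<Phi>' :: "'k K0_map"
  assume "\<Phi> \<in> extensional (carrier K0_F1) \<and> is_base_change_hom \<Phi>"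
    "\<Phi>' \<in> extensional (carrier K0_F1) \<and> is_base_change_hom \<Phi>'"
  then show "\<Phi> = \<Phi>'"
    using base_change_hom_unique[of \<Phi> \<Phi>'] by (intro extensionalityI[of _ "carrier K0_F1"]) auto
qed

section \<open>Decomposition into paths and cycles\<close>

text \<open>One module with both presentations already makes the two classes equal, so
  \<open>kt_pres_intertwine\<close> is applied in one direction to an arbitrary member.\<close>

lemma kt_cls_eq_intertwine:
  assumes "finite B" "finite B'"
    and "\<And>b d. b \<in> B \<Longrightarrow> d \<in> B \<Longrightarrow> (\<Sum>c\<in>B'. p b c * q c d) = unit_fun b d"
    and "\<And>c d. c \<in> B' \<Longrightarrow> d \<in> B' \<Longrightarrow> (\<Sum>b\<in>B. q c b * p b d) = unit_fun c d"
    and "\<And>b d. b \<in> B \<Longrightarrow> d \<in> B' \<Longrightarrow> (\<Sum>c\<in>B. a b c * p c d) = (\<Sum>c\<in>B'. p b c * a' c d)"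
  shows "kt_cls B a = kt_cls B' a'"
proof -
  obtain N where N: "N \<in> kt_cls B a" using kt_cls_inhabited[OF assms(1)] .
  then have "kt_pres N B' a'"
    unfolding kt_cls_def using kt_pres_intertwine[OF _ assms(2-5)] by simp
  then show ?thesis using kt_cls_member[OF N] kt_class_of_eq[of N B' a'] by simp
qed

section \<open>Iterates and periodic points of a partial map\<close>

definition iter :: "('b \<Rightarrow> 'b option) \<Rightarrow> nat \<Rightarrow> 'b \<Rightarrow> 'b option" where
  "iter s i x = ((\<lambda>u. Option.bind u s) ^^ i) (Some x)"

lemma iter_0 [simp]: "iter s 0 x = Some x"
  by (simp add: iter_def)

lemma iter_Suc: "iter s (Suc i) x = Option.bind (iter s i x) s"
  by (simp add: iter_def)

lemma iter_add: "iter s (i + j) x = Option.bind (iter s i x) (iter s j)"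
  by (induction j) (cases "iter s i x"; simp add: iter_Suc)+

lemma iter_Suc': "iter s (Suc i) x = Option.bind (s x) (iter s i)"
  using iter_add[of s 1 i x] by (simp add: iter_Suc)

lemma iter_in:
  assumes "partial_map B s" "x \<in> B" "iter s i x = Some y"
  shows "y \<in> B"
  using assms(3)
proof (induction i arbitrary: y)
  case (Suc i)
  then obtain z where "iter s i x = Some z" "s z = Some y"
      by (auto simp: iter_Suc bind_eq_Some_conv)
  then show ?case using Suc.IH assms(1) by (auto simp: partial_map_def)
qed (use assms(2) in simp)

definition periodic :: "('b \<Rightarrow> 'b option) \<Rightarrow> 'b \<Rightarrow> bool" where
  "periodic s x \<longleftrightarrow> (\<exists>j>0. iter s j x = Some x)"

lemma iter_mult: "iter s j x = Some x \<Longrightarrow> iter s (k * j) x = Some x"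
  by (induction k) (simp_all add: iter_add)

lemma periodic_iter:
  assumes "periodic s x" "iter s i x = Some y"
  shows "periodic s y"
proof -
  obtain j where j: "j > 0" "iter s j x = Some x" using assms(1) by (auto simp: periodic_def)
  have "iter s j y = Option.bind (iter s i x) (iter s j)" using assms(2) by simp
  also have "\<dots> = Option.bind (iter s j x) (iter s i)"
    by (simp only: iter_add[symmetric] add.commute)
  also have "\<dots> = Some y" using j assms(2) by simp
  finally show ?thesis using j by (auto simp: periodic_def)
qed

text \<open>The product of two periods is a common period. The orbits of \<open>x\<close> and
  \<open>y\<close> agree after the first step, hence also after that many steps, when they are back
  at \<open>x\<close> and \<open>y\<close>.\<close>

lemma not_both_periodic:
  assumes "periodic s x" "periodic s y" "s x = s y"
  shows "x = y"
proof -
  obtain j k where jk: "j > 0" "iter s j x = Some x" "k > 0" "iter s k y = Some y"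
    using assms(1,2) by (auto simp: periodic_def)
  then obtain m where m: "k * j = Suc m" by (metis gr0_conv_Suc nat_0_less_mult_iff)
  have "iter s (k * j) x = Some x" using jk by (simp add: iter_mult)
  moreover have "iter s (k * j) y = Some y" using jk iter_mult[of s k y j]
      by (simp add: mult.commute)
  moreover have "iter s (k * j) x = iter s (k * j) y" using assms(3) by (simp add: m iter_Suc')
  ultimately show ?thesis by (metis option.inject)
qed

text \<open>Pigeonhole: \<open>card B + 1\<close> iterates, all defined, lie in a set of
  \<open>card B\<close> elements.\<close>

lemma iter_collision:
  assumes "partial_map B s" "x \<in> B" "iter s (card B) x \<noteq> None"
  obtains i j where "i < j" "j \<le> card B" "iter s i x = iter s j x" "iter s j x \<noteq> None"
proof -
  have fin: "finite B" using assms(1) by (simp add: partial_map_def)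
  have nn: "iter s i x \<noteq> None" if "i \<le> card B" for i
    using iter_add[of s i "card B - i" x] that assms(3) by (cases "iter s i x") auto
  have "(\<lambda>i. iter s i x) ` {..card B} \<subseteq> Some ` B"
    using nn iter_in[OF assms(1,2)] by fastforce
  then have "card ((\<lambda>i. iter s i x) ` {..card B}) \<le> card (Some ` B)"
    using fin by (intro card_mono) auto
  also have "\<dots> < card {..card B}" by (simp add: card_image)
  finally have "\<not> inj_on (\<lambda>i. iter s i x) {..card B}" by (metis card_image less_irrefl)
  then obtain i j where "i \<le> card B" "j \<le> card B" "i \<noteq> j" "iter s i x = iter s j x"
    by (auto simp: inj_on_def)
  then show thesis
    using that[of i j] that[of j i] nn by (cases "i < j") auto
qed

definition reaches :: "'b set \<Rightarrow> ('b \<Rightarrow> 'b option) \<Rightarrow> nat \<Rightarrow> 'b \<Rightarrow> bool" where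
  "reaches B s n x \<longleftrightarrow> (\<exists>w\<in>B. iter s n w = Some x)"

text \<open>A chain with \<open>card B\<close> edges visits some vertex twice. That vertex is
  periodic, and so is everything after it, including the end of the chain.\<close>

lemma nonperiodic_depth:
  assumes B: "partial_map B s" and x: "\<not> periodic s x"
  shows "\<not> reaches B s (card B) x"
proof
  assume "reaches B s (card B) x"
  then obtain w where w: "w \<in> B" "iter s (card B) w = Some x" by (auto simp: reaches_def)
  obtain i j where ij: "i < j" "j \<le> card B" "iter s i w = iter s j w" "iter s j w \<noteq> None"
    using iter_collision[OF B w(1)] w(2) by auto
  then obtain u where u: "iter s i w = Some u" "iter s j w = Some u" by auto
  have "iter s (j - i) u = Some u"
    using iter_add[of s i "j - i" w] ij(1) u by simp
  then have "periodic s u" using ij(1) by (auto simp: periodic_def intro!: exI[of _ "j - i"])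
  moreover have "iter s (card B - j) u = Some x"
    using iter_add[of s j "card B - j" w] ij(2) u w(2) by simp
  ultimately show False using x periodic_iter by metis
qed

lemma reaches_mono:
  assumes B: "partial_map B s" and "reaches B s n x" "m \<le> n"
  shows "reaches B s m x"
proof -
  obtain w where w: "w \<in> B" "iter s n w = Some x" using assms(2) by (auto simp: reaches_def)
  then obtain u where "iter s (n - m) w = Some u" "iter s m u = Some x"
    using iter_add[of s "n - m" m w] assms(3) by (cases "iter s (n - m) w") auto
  then show ?thesis using iter_in[OF B w(1)] by (auto simp: reaches_def)
qed

text \<open>Subtracting from every ancestor of \<open>x\<close> the vertex at the same distance below on a chain
  ending in \<open>y\<close> is a change of basis that removes the edge \<open>x \<mapsto> s x = s y\<close>.\<close>

lemma kt_cls_remove_edge: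
  assumes B: "partial_map B s" and xy: "x \<in> B" "y \<in> B" "x \<noteq> y" "s x = Some z" "s y = Some z"
    and x: "\<not> periodic s x" and depth: "\<not> reaches B s (Suc h) x"
    and w: "w \<in> B" "iter s h w = Some y" and per: "periodic s y \<Longrightarrow> periodic s w"
  shows "(kt_cls B (partial_mat s) :: 'k::field kt_class) = kt_cls B (partial_mat (s(x := None)))"
proof -
  have fin: "finite B" using B by (simp add: partial_map_def)
  have sB: "c \<in> B" if "b \<in> B" "s b = Some c" for b c using B that by (auto simp: partial_map_def)
  have x_cycle: "iter s j x \<noteq> Some x" if "j > 0" for j using x that unfolding periodic_def by blast
  have chain: "\<exists>v. iter s (h - i) w = Some v \<and> iter s i v = Some y" if "i \<le> h" for i
    using iter_add[of s "h - i" i w] w(2) that by (cases "iter s (h - i) w") auto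
  \<comment> \<open>\<open>Y i\<close> is the vertex of the chain from which \<open>y\<close> is
    reached in \<open>i\<close> steps; it becomes the partner of the ancestors of \<open>x\<close>
    at distance \<open>i\<close>.\<close>
  define Y where "Y i = the (iter s (h - i) w)" for i
  have Y: "iter s (h - i) w = Some (Y i)" "iter s i (Y i) = Some y" "Y i \<in> B" if "i \<le> h" for i
    using chain[OF that] iter_in[OF B w(1)] by (auto simp: Y_def)
  have Y0: "Y 0 = y" using Y(2)[of 0] by simp
  have Y_step: "s (Y (Suc i)) = Some (Y i)" if "Suc i \<le> h" for i
  proof -
    have "iter s (h - i) w = Option.bind (iter s (h - Suc i) w) s"
      using that by (simp flip: iter_Suc) (metis Suc_diff_Suc Suc_le_lessD)
    then show ?thesis using Y(1)[of i] Y(1)[of "Suc i"] that by simp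
  qed
  \<comment> \<open>No partner is an ancestor of \<open>x\<close>. If \<open>y\<close> is periodic,
    so is the chain, and \<open>x\<close> would be too. Otherwise compare the distances
    \<open>j\<close> to \<open>x\<close> and \<open>i\<close> to \<open>y\<close>: equality gives
    \<open>x = y\<close>, and if one of \<open>x\<close>, \<open>y\<close> lies behind the other on
    the way, then \<open>s x = s y\<close> closes a cycle through the later one.\<close>
  have Y_T: "iter s j (Y i) \<noteq> Some x" if i: "i \<le> h" for i j
  proof
    assume j: "iter s j (Y i) = Some x"
    consider "periodic s y" | "\<not> periodic s y" "j = i" | "\<not> periodic s y" "j < i" | "\<not> periodic s y"
        "j > i"
      by linarith
    then show False
    proof cases
      case 1
      then have "periodic s (Y i)" using per periodic_iter[OF _ Y(1)[OF i]] by simp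
      then show False using periodic_iter[OF _ j] x by simp
    next
      case 2
      then show False using j Y(2)[OF i] xy(3) by simp
    next
      case 3
      then obtain m where m: "i = j + Suc m" using less_imp_Suc_add by fastforce
      have "iter s (Suc m) x = Some y" using Y(2)[OF i] j iter_add[of s j "Suc m" "Y i"] m by simp
      then have "iter s (Suc m) y = Some y" using xy(4,5) by (simp add: iter_Suc')
      then show False using 3 by (auto simp: periodic_def)
    next
      case 4
      then obtain m where m: "j = i + Suc m" using less_imp_Suc_add by fastforce
      have "iter s (Suc m) y = Some x" using Y(2)[OF i] j iter_add[of s i "Suc m" "Y i"] m by simp
      then have "iter s (Suc m) x = Some x" using xy(4,5) by (simp add: iter_Suc')
      then show False using x_cycle by blast
    qed
  qed
  \<comment> \<open>The ancestors of \<open>x\<close>, with \<open>x\<close> itself. As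
    \<open>x\<close> is not periodic, each has exactly one distance \<open>D v\<close> to
    \<open>x\<close>; by the depth bound it is at most \<open>h\<close>, so the partner
    exists.\<close>
  define T where "T = {v \<in> B. \<exists>d. iter s d v = Some x}"
  define D where "D v = (SOME d. iter s d v = Some x)" for v
  have D: "iter s (D v) v = Some x" if "v \<in> T" for v
    using that unfolding T_def D_def by (auto intro: someI)
  have D_unique: "d = d'" if "iter s d v = Some x" "iter s d' v = Some x" for d d' v
  proof -
    have False if "d < d'" "iter s d v = Some x" "iter s d' v = Some x" for d d'
    proof -
      have "iter s d' v = iter s (d' - d) x" using iter_add[of s d "d' - d" v] that(1,2) by simp
      moreover have "iter s (d' - d) x \<noteq> Some x" by (rule x_cycle) (use that(1) in simp)
      ultimately show False using that(3) by metis
    qed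
    note lt = this
    show ?thesis using that lt[of d d'] lt[of d' d] by (cases d d' rule: linorder_cases) auto
  qed
  have D_le: "D v \<le> h" if "v \<in> T" for v
  proof (rule ccontr)
    assume "\<not> D v \<le> h"
    moreover have "reaches B s (D v) x" using D[OF that] that by (auto simp: reaches_def T_def)
    ultimately show False using depth reaches_mono[OF B] by (meson not_less_eq_eq)
  qed
  define g where "g v = Y (D v)" for v
  have gB: "g v \<in> B" and gT: "g v \<notin> T" if "v \<in> T" for v
    using Y(3)[OF D_le[OF that]] Y_T[OF D_le[OF that]] by (auto simp: g_def T_def)
  have xT: "x \<in> T" unfolding T_def using xy(1) iter_0[of s x] by blast
  have Dx: "D x = 0" by (rule D_unique[OF D[OF xT] iter_0])
  have gx: "g x = y" by (simp add: g_def Dx Y0)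
  have T_step: "c \<in> T \<and> D b = Suc (D c)" if b: "b \<in> T" "b \<noteq> x" "s b = Some c" for b c
  proof -
    obtain m where m: "D b = Suc m" using D[OF b(1)] b(2) by (cases "D b") auto
    then have c: "iter s m c = Some x" using D[OF b(1)] b(3) by (simp add: iter_Suc')
    moreover have "c \<in> B" using b sB by (auto simp: T_def)
    ultimately have "c \<in> T" by (auto simp: T_def)
    then show ?thesis using D_unique[OF c D] m by simp
  qed
  have T_back: "b \<in> T" if "b \<in> B" "s b = Some c" "c \<in> T" for b c
  proof -
    have "iter s (Suc (D c)) b = Some x" using that D by (simp add: iter_Suc')
    then show ?thesis using that unfolding T_def by blast
  qed
  have T_some: "s b \<noteq> None" if "b \<in> T" for b
    using D[OF that] xy(4) by (cases "D b"; cases "s b") (auto simp: iter_Suc')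
  \<comment> \<open>\<open>N\<close> sends an ancestor to its partner and kills all other basis
    vectors. Partners lie outside \<open>T\<close>, hence \<open>N\<close> squares to zero and
    \<open>unit_fun + N\<close> has the inverse \<open>unit_fun - N\<close>.\<close>
  define N where "N b c = (if b \<in> T \<and> c = g b then 1 else 0 :: 'k)" for b c
  have sum_unit: "(\<Sum>c\<in>B. unit_fun b c * f c) = f b" if "b \<in> B" for b and f :: "'a \<Rightarrow> 'k"
    using that fin by (simp add: unit_fun_def if_distrib if_distribR cong: if_cong)
  have sum_N: "(\<Sum>c\<in>B. N b c * f c) = (if b \<in> T then f (g b) else 0)" for b and f :: "'a \<Rightarrow> 'k"
    using fin gB by (simp add: N_def if_distrib if_distribR cong: if_cong)
  have sum_partial: "(\<Sum>c\<in>B. partial_mat s b c * f c) = (case s b of None \<Rightarrow> 0 | Some c \<Rightarrow> f c)"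
    if "b \<in> B" for b and f :: "'a \<Rightarrow> 'k"
  proof (cases "s b")
    case (Some c)
    then have "(\<Sum>c'\<in>B. partial_mat s b c' * f c') = (\<Sum>c'\<in>B. unit_fun c c' * f c')"
      by (intro sum.cong) (auto simp: partial_mat_def unit_fun_def)
    then show ?thesis using sB[OF that Some] Some by (simp add: sum_unit)
  qed (simp add: partial_mat_def)
  show ?thesis
  \<comment> \<open>The new basis subtracts from each ancestor its partner. The matrix
    \<open>p\<close> writes the old basis in terms of the new one, whence its plus sign.\<close>
  proof (rule kt_cls_eq_intertwine[OF fin fin, where p = "\<lambda>b c. unit_fun b c + N b c"
      and q = "\<lambda>b c. unit_fun b c - N b c"])
    fix b d assume b: "b \<in> B" and d: "d \<in> B"
    show "(\<Sum>c\<in>B. (unit_fun b c + N b c) * (unit_fun c d - N c d)) = (unit_fun b d :: 'k)"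
      using gT gB b by (simp add: distrib_right sum.distrib sum_unit sum_N) (auto simp: N_def
          unit_fun_def)
    show "(\<Sum>c\<in>B. (unit_fun b c - N b c) * (unit_fun c d + N c d)) = (unit_fun b d :: 'k)"
      using gT gB b by (simp add: left_diff_distrib sum_subtractf sum_unit sum_N) (auto simp: N_def
          unit_fun_def)
    \<comment> \<open>A partner is never \<open>x\<close>, so deleting the edge at \<open>x\<close>
      leaves the row of the partner unchanged.\<close>
    have R: "(\<Sum>c\<in>B. (unit_fun b c + N b c) * partial_mat (s(x := None)) c d) =
        partial_mat (s(x := None)) b d + (if b \<in> T then partial_mat s (g b) d else (0::'k))"
      using gT[of b] xT b by (simp add: distrib_right sum.distrib sum_unit sum_N) (auto simp:
          partial_mat_def)
    have L: "(\<Sum>c\<in>B. partial_mat s b c * (unit_fun c d + N c d)) =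
        (case s b of None \<Rightarrow> 0 | Some c \<Rightarrow> unit_fun c d + N c d)"
      by (rule sum_partial[OF b])
    show "(\<Sum>c\<in>B. partial_mat s b c * (unit_fun c d + N c d)) =
        (\<Sum>c\<in>B. (unit_fun b c + N b c) * (partial_mat (s(x := None)) c d :: 'k))"
    proof (cases "b \<in> T")
      case False
      then have "s b = Some c \<Longrightarrow> c \<notin> T" for c using T_back b by blast
      moreover have "b \<noteq> x" using False xT by auto
      ultimately show ?thesis
        unfolding L R using b False by (auto simp: partial_mat_def N_def unit_fun_def split:
            option.split)
    next
      case True
      show ?thesis
      proof (cases "b = x")
        \<comment> \<open>At \<open>x\<close> the edge is gone on the right, but the partner
          \<open>g x = y\<close> contributes the same target \<open>z\<close>. On the left
          \<open>z\<close> receives no correction, as it is not an ancestor of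
          \<open>x\<close>.\<close>
        case True
        have "z \<notin> T"
        proof
          assume "z \<in> T"
          then have "iter s (Suc (D z)) x = Some x" using D xy(4) by (simp add: iter_Suc')
          then show False using x_cycle by blast
        qed
        then show ?thesis
          unfolding L R using xT xy by (simp add: True gx partial_mat_def N_def unit_fun_def)
      next
        case False
        obtain c where c: "s b = Some c" using T_some[OF True] by auto
        note cT = T_step[OF True False c]
        \<comment> \<open>One step towards \<open>x\<close> moves the partner one step towards
          \<open>y\<close>.\<close>
        have "s (g b) = Some (g c)"
          using cT Y_step[of "D c"] D_le[OF True] by (simp add: g_def)
        then show ?thesis
          unfolding L R using True False b c cT by (auto simp: partial_mat_def N_def unit_fun_def)
      qed
    qed
  qed
qed

text \<open>At most one of \<open>x\<close>, \<open>y\<close> is periodic. If one is, it has chains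
  of every length and the edge of the other is removed. If neither is, both have a longest chain,
  and the edge is removed at the vertex whose longest chain does not exceed that of the
  other.\<close>

lemma exists_removable_edge:
  assumes B: "partial_map B s" and xy: "x \<in> B" "y \<in> B" "x \<noteq> y" "s x = Some z" "s y = Some z"
  shows "\<exists>v\<in>B. s v \<noteq> None \<and>
    (kt_cls B (partial_mat s) :: 'k::field kt_class) = kt_cls B (partial_mat (s(v := None)))"
proof -
  \<comment> \<open>\<open>h\<close> is the length of a longest chain ending in \<open>v\<close>,
    one less than the least length that does not occur; that length is positive because
    \<open>v\<close> alone is a chain of length 0.\<close>
  have least: "\<exists>h. reaches B s h v \<and> \<not> reaches B s (Suc h) v \<and> (\<forall>n. \<not> reaches B s n v \<longrightarrow> h < n)"
    if "v \<in> B" "\<not> periodic s v" for v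
  proof -
    define n where "n = (LEAST n. \<not> reaches B s n v)"
    have n: "\<not> reaches B s n v" "\<And>m. \<not> reaches B s m v \<Longrightarrow> n \<le> m"
      unfolding n_def by (rule LeastI[where P = "\<lambda>n. \<not> reaches B s n v", OF nonperiodic_depth[OF B
          that(2)]], rule Least_le)
    have "reaches B s 0 v" using that(1) by (auto simp: reaches_def)
    then obtain h where h: "n = Suc h" using n(1) by (cases n) auto
    then have "reaches B s h v" using n(2)[of h] by auto
    then show ?thesis using n h by (intro exI[of _ h]) (auto simp: Suc_le_eq)
  qed
  have both: ?thesis if x: "x \<in> B" and y: "y \<in> B"
      and "x \<noteq> y" "s x = Some z" "s y = Some z" "\<not> periodic s x" "\<not> periodic s y"
    "reaches B s h x" "\<not> reaches B s (Suc h) x" and r: "reaches B s h y" for x y h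
  proof -
    obtain w where "w \<in> B" "iter s h w = Some y" using r by (auto simp: reaches_def)
    then have "(kt_cls B (partial_mat s) :: 'k kt_class) = kt_cls B (partial_mat (s(x := None)))"
      using that by (intro kt_cls_remove_edge[OF B, of x y z h w]) auto
    then show ?thesis using that by (intro bexI[of _ x]) auto
  qed
  have one: ?thesis if x: "x \<in> B" and y: "y \<in> B"
      and "x \<noteq> y" "s x = Some z" "s y = Some z" "\<not> periodic s x" and p: "periodic s y" for x y
  proof -
    obtain h where h: "\<not> reaches B s (Suc h) x" using least[OF x \<open>\<not> periodic s x\<close>] by blast
    obtain j where j: "j > 0" "iter s j y = Some y" using p by (auto simp: periodic_def)
    \<comment> \<open>\<open>h * j\<close> is a multiple of the period and at least
      \<open>h\<close>. Stopping \<open>h\<close> steps earlier gives a vertex \<open>w\<close> on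
      the cycle from which \<open>y\<close> is reached in exactly \<open>h\<close> steps.\<close>
    have "h \<le> h * j" using j(1) by simp
    then have "Option.bind (iter s (h * j - h) y) (iter s h) = Some y"
      using iter_add[of s "h * j - h" h y] iter_mult[OF j(2), of h] by simp
    then obtain w where w: "iter s (h * j - h) y = Some w" "iter s h w = Some y"
      by (cases "iter s (h * j - h) y") auto
    then have "(kt_cls B (partial_mat s) :: 'k kt_class) = kt_cls B (partial_mat (s(x := None)))"
      using that h iter_in[OF B y w(1)] periodic_iter[OF p w(1)]
      by (intro kt_cls_remove_edge[OF B, of x y z h w]) auto
    then show ?thesis using that by (intro bexI[of _ x]) auto
  qed
  consider "periodic s x" "\<not> periodic s y" | "\<not> periodic s x" "periodic s y" | "\<not> periodic s x" "\<not>
      periodic s y"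
    using not_both_periodic[of s x y] xy by auto
  then show ?thesis
  proof cases
    case 1
    then show ?thesis using one[of y x] xy by auto
  next
    case 2
    then show ?thesis using one[of x y] xy by auto
  next
    case 3
    obtain h where h: "reaches B s h x" "\<not> reaches B s (Suc h) x" "\<And>n. \<not> reaches B s n x \<Longrightarrow> h < n"
      using least[OF xy(1) 3(1)] by blast
    obtain h' where h': "reaches B s h' y" "\<not> reaches B s (Suc h') y" "\<And>n. \<not> reaches B s n y \<Longrightarrow> h' <
        n"
      using least[OF xy(2) 3(2)] by blast
    show ?thesis
    proof (cases "h \<le> h'")
      case True
      then have "reaches B s h y" using reaches_mono[OF B h'(1)] by simp
      then show ?thesis using both[of x y h] xy 3 h by auto
    next
      case False
      then have "reaches B s h' x" using reaches_mono[OF B h(1)] by simp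
      then show ?thesis using both[of y x h'] xy 3 h' by auto
    qed
  qed
qed

section \<open>Splitting a partial injection into paths and cycles\<close>

definition path_map :: "nat \<Rightarrow> nat \<Rightarrow> nat option" where
  "path_map n i = (if Suc i < n then Some (Suc i) else None)"

definition cycle_map :: "nat \<Rightarrow> nat \<Rightarrow> nat option" where
  "cycle_map n i = Some (if Suc i < n then Suc i else 0)"

lemma iter_cancel:
  assumes B: "partial_map B s" and inj: "\<forall>v\<in>B. \<forall>w\<in>B. s v = s w \<longrightarrow> s v \<noteq> None \<longrightarrow> v = w"
  shows "v \<in> B \<Longrightarrow> w \<in> B \<Longrightarrow> iter s i v = iter s i w \<Longrightarrow> iter s i v \<noteq> None \<Longrightarrow> v = w"
proof (induction i)
  case (Suc i)
  obtain v' w' where v': "iter s i v = Some v'" "iter s i w = Some w'"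
    using Suc.prems(3,4) by (cases "iter s i v"; cases "iter s i w") (auto simp: iter_Suc)
  then have "v' = w'"
    using Suc.prems inj iter_in[OF B _ v'(1)] iter_in[OF B _ v'(2)] by (simp add: iter_Suc)
  then show ?case using Suc v' by simp
qed simp

text \<open>The orbit of \<open>x\<close> splits off: it is a cycle if \<open>s\<close> is a permutation, and otherwise a path,
  provided that \<open>x\<close> is chosen outside of the image of \<open>s\<close>.\<close>

lemma partial_injection_split:
  assumes B: "partial_map B s" and ne: "B \<noteq> {}"
    and inj_on: "\<forall>v\<in>B. \<forall>w\<in>B. s v = s w \<longrightarrow> s v \<noteq> None \<longrightarrow> v = w"
  obtains n P \<sigma> where "n \<ge> 1" "P \<subseteq> B" "P \<noteq> {}" "\<sigma> = path_map n \<or> \<sigma> = cycle_map n"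
    "partial_map (B - P) s"
    "(kt_cls B (partial_mat s) :: 'k::field kt_class) =
      kt_cls (Sum_Type.Plus {..<n} (B - P)) (block (partial_mat \<sigma>) (partial_mat s))"
proof -
  have fin: "finite B" using B by (simp add: partial_map_def)
  have sB: "c \<in> B" if "b \<in> B" "s b = Some c" for b c using B that by (auto simp: partial_map_def)
  have inj: "v = w" if "v \<in> B" "w \<in> B" "s v = s w" "s v \<noteq> None" for v w using inj_on that by blast
  obtain x where x: "x \<in> B" "(\<forall>v\<in>B. s v \<noteq> None) \<or> (\<forall>v\<in>B. s v \<noteq> Some x)"
  proof (cases "\<forall>v\<in>B. s v \<noteq> None")
    case True
    then show thesis using that ne by blast
  next
    case False
    \<comment> \<open>An undefined value of \<open>s\<close> leaves too few values to cover
      \<open>B\<close>, so some \<open>x\<close> is not hit; a path has to be entered at such a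
      vertex.\<close>
    define dom where "dom = {v \<in> B. s v \<noteq> None}"
    from False obtain v where "v \<in> B" "s v = None" by auto
    then have "dom \<subset> B" unfolding dom_def by blast
    then have "card dom < card B" by (rule psubset_card_mono[OF fin])
    moreover have "card ((\<lambda>v. the (s v)) ` dom) \<le> card dom"
      using fin by (intro card_image_le) (simp add: dom_def)
    ultimately have "card ((\<lambda>v. the (s v)) ` dom) < card B" by simp
    then have "\<not> B \<subseteq> (\<lambda>v. the (s v)) ` dom"
      using card_mono[of "(\<lambda>v. the (s v)) ` dom" B] fin by (auto simp: dom_def)
    then obtain x where x: "x \<in> B" "x \<notin> (\<lambda>v. the (s v)) ` dom" by blast
    have "s v \<noteq> Some x" if "v \<in> B" for v
      using x(2) that by (force simp: dom_def image_iff)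
    then show thesis using that x(1) by blast
  qed
  \<comment> \<open>The orbit of \<open>x\<close> stops or returns to \<open>x\<close>, and the
    least time \<open>n\<close> at which this happens is its number of vertices. An orbit that does
    not stop within \<open>card B\<close> steps collides with itself, and cancelling the first
    \<open>i\<close> steps shows that it returns.\<close>
  define Q where "Q n \<longleftrightarrow> n \<ge> 1 \<and> (iter s n x = None \<or> iter s n x = Some x)" for n
  have "\<exists>n. Q n"
  proof (cases "iter s (card B) x = None")
    case True
    have "card B \<ge> 1" using x(1) fin by (metis One_nat_def Suc_leI card_gt_0_iff empty_iff)
    then show ?thesis using True unfolding Q_def by blast
  next
    case False
    obtain i j where ij: "i < j" "iter s i x = iter s j x" "iter s j x \<noteq> None"
      using iter_collision[OF B x(1) False] by metis
    obtain u where u: "iter s (j - i) x = Some u" "iter s i u = iter s j x"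
      using iter_add[of s "j - i" i x] ij(1,3) by (cases "iter s (j - i) x") auto
    have "x = u"
      using iter_cancel[OF B inj_on x(1) iter_in[OF B x(1) u(1)], of i] u(2) ij(2,3) by metis
    then show ?thesis using u(1) ij(1) unfolding Q_def by (intro exI[of _ "j - i"]) simp
  qed
  define n where "n = (LEAST n. Q n)"
  have "Q n" unfolding n_def by (rule LeastI_ex[OF \<open>\<exists>n. Q n\<close>])
  then have n: "n \<ge> 1" "iter s n x = None \<or> iter s n x = Some x" by (simp_all add: Q_def)
  have n_min: "n \<le> i" if "Q i" for i unfolding n_def by (rule Least_le[of Q, OF that])
  have early: "iter s i x \<noteq> None" "iter s i x \<noteq> Some x \<or> i = 0" if "i < n" for i
  proof -
    have "\<not> Q i" using n_min[of i] that by auto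
    then show "iter s i x \<noteq> None" "iter s i x \<noteq> Some x \<or> i = 0"
      unfolding Q_def by (cases "i = 0", simp_all) (cases i, simp_all)
  qed
  define e where "e i = the (iter s i x)" for i
  have e: "iter s i x = Some (e i)" if "i < n" for i using early(1)[OF that] by (simp add: e_def)
  have eB: "e i \<in> B" if "i < n" for i using iter_in[OF B x(1) e[OF that]] .
  have e0: "e 0 = x" using e[of 0] n by simp
  have e_inj: "i = j" if "i < n" "j < n" "e i = e j" for i j
  proof -
    have False if ij: "i < j" "j < n" "e i = e j" for i j
    proof -
      have d: "j - i < n" using ij by simp
      have "iter s i (e (j - i)) = iter s j x"
        using iter_add[of s "j - i" i x] ij e[OF d] by simp
      moreover have "iter s j x = iter s i x" using e[of i] e[of j] ij by simp
      ultimately have "e (j - i) = x"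
        using iter_cancel[OF B inj_on eB[OF d] x(1), of i] early(1)[of i] ij
            by (metis order.strict_trans)
      then show False using early(2)[OF d] e[OF d] ij by simp
    qed
    then show ?thesis using that by (cases i j rule: linorder_cases) (auto dest: sym)
  qed
  have s_e: "s (e i) = iter s (Suc i) x" if "i < n" for i
    using e[OF that] by (simp add: iter_Suc)
  have s_e_Suc: "s (e i) = Some (e (Suc i))" if "Suc i < n" for i
    using s_e[of i] e[of "Suc i"] that by simp
  define P where "P = e ` {..<n}"
  have PB: "P \<subseteq> B" using eB by (auto simp: P_def)
  have "P \<noteq> {}" using n(1) by (auto simp: P_def lessThan_empty_iff)
  \<comment> \<open>No edge enters the orbit from outside. At \<open>e (Suc j)\<close> injectivity
    forces the predecessor \<open>e j\<close>. At \<open>e 0 = x\<close> a predecessor exists only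
    if \<open>s\<close> is total; then the orbit closes up and the predecessor is its last
    vertex.\<close>
  have compl: "u \<notin> P" if v: "v \<in> B - P" "s v = Some u" for v u
  proof
    assume "u \<in> P"
    then obtain i where i: "i < n" "u = e i" by (auto simp: P_def)
    show False
    proof (cases i)
      case (Suc j)
      then have "s (e j) = s v" using s_e_Suc[of j] i v(2) by simp
      then have "v = e j" using inj[of v "e j"] v eB[of j] i(1) Suc by simp
      then show False using v(1) i(1) Suc by (auto simp: P_def)
    next
      case 0
      then have sv: "s v = Some x" using v(2) i e0 by simp
      obtain m where m: "n = Suc m" using n(1) by (cases n) auto
      have "s (e m) = iter s n x" using s_e[of m] m by simp
      moreover have "s (e m) \<noteq> None" using x(2) sv v(1) eB[of m] m by auto
      ultimately have "s (e m) = s v" using n(2) sv by auto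
      then have "v = e m" using inj[of v "e m"] v eB[of m] m by simp
      then show False using v(1) m by (auto simp: P_def)
    qed
  qed
  define \<sigma> where "\<sigma> = (if iter s n x = None then path_map n else cycle_map n)"
  have \<sigma>: "s (e i) = map_option e (\<sigma> i)" if "i < n" for i
  proof (cases "Suc i < n")
    case True
    then show ?thesis using s_e_Suc by (simp add: \<sigma>_def path_map_def cycle_map_def)
  next
    case False
    then have "Suc i = n" using that by simp
    then show ?thesis using s_e[OF that] n(2) e0 by (auto simp: \<sigma>_def path_map_def cycle_map_def)
  qed
  have \<sigma>_less: "j < n" if "\<sigma> i = Some j" for i j
    using that n(1) by (auto simp: \<sigma>_def path_map_def cycle_map_def split: if_splits)
  have bij: "bij_betw (case_sum e id) (Sum_Type.Plus {..<n} (B - P)) B"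
  proof (rule bij_betw_imageI)
    show "inj_on (case_sum e id) (Sum_Type.Plus {..<n} (B - P))"
      using e_inj by (auto simp: inj_on_def P_def)
    show "case_sum e id ` Sum_Type.Plus {..<n} (B - P) = B"
      using PB unfolding Plus_def image_Un image_image by (auto simp: P_def)
  qed
  have "kt_cls (Sum_Type.Plus {..<n} (B - P)) (block (partial_mat \<sigma>) (partial_mat s)) = (kt_cls B
      (partial_mat s) :: 'k kt_class)"
  proof (rule kt_cls_reindex[OF bij])
    fix b d assume "b \<in> Sum_Type.Plus {..<n} (B - P)" and "d \<in> Sum_Type.Plus {..<n} (B - P)"
    then consider i j where "b = Inl i" "d = Inl j" "i < n" "j < n"
      | i v where "b = Inl i" "d = Inr v" "i < n" "v \<in> B - P"
      | v i where "b = Inr v" "d = Inl i" "v \<in> B - P" "i < n"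
      | v w where "b = Inr v" "d = Inr w" "v \<in> B - P" "w \<in> B - P"
      by auto
    then show "partial_mat s (case_sum e id b) (case_sum e id d) = (block (partial_mat \<sigma>)
        (partial_mat s) b d :: 'k)"
    proof cases
      case (1 i j)
      then show ?thesis
        using \<sigma>[of i] \<sigma>_less[of i] e_inj[of _ j]
            by (cases "\<sigma> i") (auto simp: partial_mat_def block_def)
    next
      case (2 i v)
      then have "s (e i) \<noteq> Some v"
        using \<sigma>[of i] \<sigma>_less[of i] by (cases "\<sigma> i") (auto simp: P_def)
      then show ?thesis using 2 by (simp add: partial_mat_def block_def)
    next
      case (3 v i)
      then have "s v \<noteq> Some (e i)" using compl[of v "e i"] by (auto simp: P_def)
      then show ?thesis using 3 by (simp add: partial_mat_def block_def)
    next
      case (4 v w)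
      then show ?thesis by (simp add: partial_mat_def block_def)
    qed
  qed
  moreover have "partial_map (B - P) s"
    using fin sB compl by (auto simp: partial_map_def)
  moreover have "\<sigma> = path_map n \<or> \<sigma> = cycle_map n" by (simp add: \<sigma>_def)
  ultimately show thesis using that[of n P \<sigma>] n(1) PB \<open>P \<noteq> {}\<close> by simp
qed

text \<open>Two inductions: on the number of edges until \<open>s\<close> is injective where it is
  defined, and then on the size of \<open>B\<close> to split off orbits. The property concerns
  matrix classes, since these are what the deletion of an edge preserves.\<close>

lemma kt_class_induct:
  fixes Prop :: "'k::field kt_class \<Rightarrow> bool" and B :: "nat set"
  assumes B: "partial_map B s"
    and empty: "\<And>a. Prop (kt_cls ({} :: nat set) a)"
    and path: "\<And>n. n \<ge> 1 \<Longrightarrow> Prop (kt_cls {..<n} (partial_mat (path_map n)))"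
    and cycle: "\<And>n. n \<ge> 1 \<Longrightarrow> Prop (kt_cls {..<n} (partial_mat (cycle_map n)))"
    and add: "\<And>X Y. X \<in> kt_classes \<Longrightarrow> Y \<in> kt_classes \<Longrightarrow> Prop X \<Longrightarrow> Prop Y \<Longrightarrow> Prop (kt_class_add X Y)"
  shows "Prop (kt_cls B (partial_mat s))"
proof -
  have injective: "Prop (kt_cls B (partial_mat s))"
    if "partial_map B s" "\<forall>v\<in>B. \<forall>w\<in>B. s v = s w \<longrightarrow> s v \<noteq> None \<longrightarrow> v = w"
    for B :: "nat set" and s
    using that
  proof (induction "card B" arbitrary: B rule: less_induct)
    case less
    show ?case
    proof (cases "B = {}")
      case True
      then show ?thesis using empty by simp
    next
      case False
      obtain n P \<sigma> where P: "n \<ge> 1" "P \<subseteq> B" "P \<noteq> {}" "\<sigma> = path_map n \<or> \<sigma> = cycle_map n"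
        "partial_map (B - P) s"
        "(kt_cls B (partial_mat s) :: 'k kt_class) =
          kt_cls (Sum_Type.Plus {..<n} (B - P)) (block (partial_mat \<sigma>) (partial_mat s))"
        using partial_injection_split[where 'k = 'k, OF less.prems(1) False less.prems(2)] .
      have fin: "finite B" "finite (B - P)" using less.prems(1) by (auto simp: partial_map_def)
      have "B - P \<subset> B" using P(2,3) by blast
      then have "card (B - P) < card B" by (rule psubset_card_mono[OF fin(1)])
      then have "Prop (kt_cls (B - P) (partial_mat s))"
        using less.hyps[of "B - P"] P(5) less.prems(2) by blast
      moreover have "Prop (kt_cls {..<n} (partial_mat \<sigma>))" using P(1,4) path cycle by auto
      ultimately show ?thesis
        unfolding P(6) kt_class_add_cls[OF finite_lessThan fin(2), symmetric]
        using fin by (intro add kt_cls_in_classes) simp_all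
    qed
  qed
  show ?thesis using B
  proof (induction "card {v \<in> B. s v \<noteq> None}" arbitrary: s rule: less_induct)
    case less
    show ?case
    proof (cases "\<forall>v\<in>B. \<forall>w\<in>B. s v = s w \<longrightarrow> s v \<noteq> None \<longrightarrow> v = w")
      case True
      then show ?thesis using injective[OF less.prems] by blast
    next
      case False
      then obtain x y z where "x \<in> B" "y \<in> B" "x \<noteq> y" "s x = Some z" "s y = Some z" by force
      then obtain v where v: "v \<in> B" "s v \<noteq> None"
        "(kt_cls B (partial_mat s) :: 'k kt_class) = kt_cls B (partial_mat (s(v := None)))"
        using exists_removable_edge[where 'k = 'k, OF less.prems] by blast
      have "finite B" using less.prems by (simp add: partial_map_def)
      then have "card {w \<in> B. (s(v := None)) w \<noteq> None} < card {w \<in> B. s w \<noteq> None}"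
        using v(1,2) by (intro psubset_card_mono) auto
      moreover have "partial_map B (s(v := None))" using less.prems by (auto simp: partial_map_def)
      ultimately show ?thesis unfolding v(3) by (rule less.hyps)
    qed
  qed
qed

section \<open>The matrices of paths and cycles\<close>

lemma kt_class_jordan_block:
  "kt_class_of (matrix_module (jordan_block n (0 :: 'k::field))) = kt_cls {..<n} (partial_mat
      (path_map n))"
proof -
  have "kt_pres (matrix_module (jordan_block n (0 :: 'k))) {..<n} (\<lambda>b c. jordan_block n (0 :: 'k) $$
      (c, b))"
    by (rule kt_pres_matrix_module) simp
  then have "kt_class_of (matrix_module (jordan_block n (0 :: 'k))) = kt_cls {..<n} (\<lambda>b c.
      jordan_block n (0 :: 'k) $$ (c, b))"
    by (rule kt_class_of_eq)
  also have "\<dots> = kt_cls {..<n} (partial_mat (path_map n))"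
  \<comment> \<open>With ones above the diagonal the block sends each basis vector to the preceding
    one, whereas \<open>path_map\<close> counts upwards; reversing the indices matches them.\<close>
  proof (rule kt_cls_reindex[where g = "\<lambda>i. n - Suc i"])
    show "bij_betw (\<lambda>i. n - Suc i) {..<n} {..<n}"
      by (rule bij_betwI[where g = "\<lambda>i. n - Suc i"]) auto
    fix b d assume "b \<in> {..<n}" "d \<in> {..<n}"
    then show "partial_mat (path_map n) (n - Suc b) (n - Suc d) = jordan_block n (0 :: 'k) $$ (d,
        b)"
      by (auto simp: partial_mat_def path_map_def jordan_block_def)
  qed
  finally show ?thesis .
qed

text \<open>If \<open>of_nat n\<close> were 0, the characteristic \<open>p\<close> would be a prime
  and the assumption would give a primitive root \<open>z\<close> of order \<open>p\<close>. By
  Frobenius \<open>(z - 1) ^ p = z ^ p - 1 = 0\<close>, so \<open>z = 1\<close>, which is not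
  primitive as \<open>p > 1\<close>.\<close>

lemma of_nat_neq_0_of_primitive_roots:
  fixes \<zeta> :: "nat \<Rightarrow> 'k::field"
  assumes "\<And>n. n \<ge> 1 \<Longrightarrow> primitive_root_of_unity n (\<zeta> n)" and "n \<ge> 1"
  shows "of_nat n \<noteq> (0 :: 'k)"
proof
  assume "of_nat n = (0 :: 'k)"
  then have dvd: "CHAR('k) dvd n" by (simp add: of_nat_eq_0_iff_char_dvd)
  then have pos: "CHAR('k) > 0" using assms(2) by (auto intro: Nat.gr0I)
  then have prime: "prime CHAR('k)" by (rule prime_CHAR_semidom)
  let ?p = "CHAR('k)" and ?z = "\<zeta> CHAR('k)"
  have z: "?z ^ ?p = 1" "\<And>m. 0 < m \<Longrightarrow> m < ?p \<Longrightarrow> ?z ^ m \<noteq> 1"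
    using assms(1)[of ?p] pos by (auto simp: primitive_root_of_unity_def)
  have "((?z - 1) + 1) ^ ?p = (?z - 1) ^ ?p + 1 ^ ?p"
    by (rule freshmans_dream[OF prime refl])
  then have "?z = 1" using z(1) by simp
  moreover have "?z ^ 1 \<noteq> 1" using z(2)[of 1] prime_gt_1_nat[OF prime] by simp
  ultimately show False by simp
qed

text \<open>In an eigenbasis \<open>f\<close> the vertex \<open>b\<close> of the cycle is the sum of
  \<open>z ^ (b * Suc d) f d\<close> over \<open>d\<close>; multiplying each term by the eigenvalue
  \<open>z ^ Suc d\<close> shifts \<open>b\<close> by one.\<close>

lemma kt_class_root_matrix:
  fixes z :: "'k::field"
  assumes n: "n \<ge> 1" and z: "primitive_root_of_unity n z" and n0: "of_nat n \<noteq> (0 :: 'k)"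
  shows "kt_class_of (matrix_module (root_matrix n z)) = kt_cls {..<n} (partial_mat (cycle_map n))"
proof -
  have zn: "z ^ n = 1" and z_min: "\<And>m. 0 < m \<Longrightarrow> m < n \<Longrightarrow> z ^ m \<noteq> 1"
    using z by (auto simp: primitive_root_of_unity_def)
  have z0: "z \<noteq> 0" using zn n by (auto simp: power_0_left)
  have z_inj: "i = j" if "i < n" "j < n" "z ^ i = z ^ j" for i j
  proof -
    have "False" if "i < j" "j < n" "z ^ i = z ^ j" for i j
    proof -
      have "z ^ j = z ^ i * z ^ (j - i)" using that(1) by (simp flip: power_add)
      then have "z ^ (j - i) = 1" using that(3) z0 by simp
      then show False using z_min[of "j - i"] that by simp
    qed
    then show ?thesis using that by (cases i j rule: linorder_cases) (auto dest: sym)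
  qed
  \<comment> \<open>Orthogonality of characters: for \<open>i \<noteq> j\<close> the ratio is an
    \<open>n\<close>-th root of unity other than 1, so its geometric sum vanishes.\<close>
  have geo: "(\<Sum>k<n. (z ^ i / z ^ j) ^ k) = (if i = j then of_nat n else 0)" if "i < n" "j < n"
      for i j
  proof (cases "i = j")
    case False
    then have ne: "z ^ i / z ^ j \<noteq> 1" using z_inj[OF that] z0 by auto
    have "(z ^ i / z ^ j) ^ n = (z ^ n) ^ i / (z ^ n) ^ j"
      by (simp add: power_divide flip: power_mult add: mult.commute)
    then have "(z ^ i / z ^ j) ^ n = 1" using zn by simp
    then show ?thesis using geometric_sum[OF ne, of n] False by simp
  qed (use z0 in simp)
  \<comment> \<open>\<open>p\<close> is the Fourier matrix and \<open>q\<close> its inverse, by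
    orthogonality. The exponent has \<open>Suc d\<close> because the diagonal of
    \<open>root_matrix\<close> starts with \<open>z\<close> and not with 1.\<close>
  define p where "p b d = z ^ (b * Suc d)" for b d :: nat
  define q where "q d b = inverse (of_nat n * z ^ (b * Suc d))" for d b :: nat
  define a where "a b d = (if b = d then z ^ Suc d else 0)" for b d :: nat
  have "kt_pres (matrix_module (root_matrix n z)) {..<n} (\<lambda>b c. root_matrix n z $$ (c, b))"
    by (rule kt_pres_matrix_module) (simp add: root_matrix_def)
  then have "kt_class_of (matrix_module (root_matrix n z)) = kt_cls {..<n} (\<lambda>b c. root_matrix n z $$
      (c, b))"
    by (rule kt_class_of_eq)
  also have "\<dots> = kt_cls {..<n} a"
    by (rule kt_cls_cong) (auto simp: root_matrix_def a_def)
  also have "kt_cls {..<n} (partial_mat (cycle_map n)) = kt_cls {..<n} a"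
  proof (rule kt_cls_eq_intertwine[where p = p and q = q])
    fix b d assume "b \<in> {..<n}" "d \<in> {..<n}"
    then have bd: "b < n" "d < n" by auto
    have "(\<Sum>c<n. p b c * q c d) = (\<Sum>c<n. (z ^ b / z ^ d) / of_nat n * (z ^ b / z ^ d) ^ c)"
      by (rule sum.cong) (auto simp: p_def q_def power_mult power_divide power_add divide_inverse
          algebra_simps
          power_inverse simp flip: power_mult)
    also have "\<dots> = (z ^ b / z ^ d) / of_nat n * (if b = d then of_nat n else 0)"
      unfolding sum_distrib_left[symmetric] geo[OF bd] ..
    finally show "(\<Sum>c\<in>{..<n}. p b c * q c d) = unit_fun b d"
      using n0 z0 by (auto simp: unit_fun_def)
    have "(\<Sum>c<n. q b c * p c d) = (\<Sum>c<n. inverse (of_nat n) * (z ^ d / z ^ b) ^ c)"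
    proof (rule sum.cong)
      fix c
      have "z ^ (c * Suc d) / z ^ (c * Suc b) = (z ^ Suc d / z ^ Suc b) ^ c"
        by (simp only: power_divide power_mult[symmetric] mult.commute)
      also have "z ^ Suc d / z ^ Suc b = z ^ d / z ^ b" using z0 by simp
      finally show "q b c * p c d = inverse (of_nat n) * (z ^ d / z ^ b) ^ c"
        by (simp add: p_def q_def divide_inverse algebra_simps)
    qed simp
    also have "\<dots> = inverse (of_nat n) * (if d = b then of_nat n else 0)"
      unfolding sum_distrib_left[symmetric] geo[OF bd(2,1)] ..
    finally show "(\<Sum>c\<in>{..<n}. q b c * p c d) = unit_fun b d"
      using n0 by (auto simp: unit_fun_def)
    \<comment> \<open>The successor of \<open>b\<close> on the cycle. At the wrap-around the
      exponent \<open>Suc b * Suc d\<close> is a multiple of \<open>n\<close>, so the power is 1, in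
      agreement with row 0 of \<open>p\<close>.\<close>
    define b' where "b' = (if Suc b < n then Suc b else 0)"
    have "(\<Sum>c<n. partial_mat (cycle_map n) b c * p c d) = (\<Sum>c<n. if c = b' then p b' d else 0)"
      by (rule sum.cong) (auto simp: partial_mat_def cycle_map_def b'_def)
    also have "\<dots> = p b' d" using n by (simp add: b'_def)
    also have "\<dots> = p b d * z ^ Suc d"
    proof (cases "Suc b < n")
      case True
      then show ?thesis by (simp add: b'_def p_def power_add mult.commute)
    next
      case False
      then have b: "Suc b = n" using bd by simp
      have "p b d * z ^ Suc d = z ^ (Suc b * Suc d)" by (simp add: p_def power_add mult.commute)
      also have "\<dots> = 1" unfolding b power_mult zn by simp
      finally show ?thesis using False by (simp add: b'_def p_def)
    qed
    also have "\<dots> = (\<Sum>c<n. if c = d then p b d * z ^ Suc d else 0)" using bd by simp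
    also have "\<dots> = (\<Sum>c<n. p b c * a c d)"
      by (rule sum.cong) (auto simp: a_def)
    finally show "(\<Sum>c\<in>{..<n}. partial_mat (cycle_map n) b c * p c d) = (\<Sum>c\<in>{..<n}. p b c * a c d)" .
  qed simp_all
  then show ?thesis using calculation by simp
qed

theorem theorem3p9:
  fixes \<zeta> :: "nat \<Rightarrow> 'k::field"
  assumes "\<And>n. n \<ge> 1 \<Longrightarrow> primitive_root_of_unity n (\<zeta> n)"
  shows "(\<exists>!\<Phi> :: (t_class \<Rightarrow>\<^sub>0 int) set \<Rightarrow> ('k kt_class \<Rightarrow>\<^sub>0 int) set.
            \<Phi> \<in> extensional (carrier K0_F1) \<and> is_base_change_hom \<Phi>) \<and>
         (\<forall>\<Phi> :: (t_class \<Rightarrow>\<^sub>0 int) set \<Rightarrow> ('k kt_class \<Rightarrow>\<^sub>0 int) set.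
            is_base_change_hom \<Phi> \<longrightarrow>
            \<Phi> ` carrier K0_F1 =
              generate_ring K0_kt
                ({K0_kt_class (matrix_module (jordan_block n 0)) | n. n \<ge> 1} \<union>
                 {K0_kt_class (matrix_module (root_matrix n (\<zeta> n))) | n. n \<ge> 1}))"
proof (intro conjI allI impI)
  show "\<exists>!\<Phi> :: (t_class \<Rightarrow>\<^sub>0 int) set \<Rightarrow> ('k kt_class \<Rightarrow>\<^sub>0 int) set.
      \<Phi> \<in> extensional (carrier K0_F1) \<and> is_base_change_hom \<Phi>"
    by (rule ex1_base_change_hom)
  fix \<Phi> :: "(t_class \<Rightarrow>\<^sub>0 int) set \<Rightarrow> ('k kt_class \<Rightarrow>\<^sub>0 int) set"
  assume "is_base_change_hom \<Phi>"
  then have hom: "ring_hom_ring K0_F1 K0_kt \<Phi>"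
    and \<Phi>_cls: "\<And>X. X \<in> t_classes \<Longrightarrow> \<Phi> (F1.cls X) = base_change_class X"
    by (simp_all add: is_base_change_hom_iff)
  interpret \<Phi>: ring_hom_ring K0_F1 K0_kt \<Phi> by (rule hom)
  let ?path = "\<lambda>n. KT.cls (kt_cls {..<n} (partial_mat (path_map n)) :: 'k kt_class)"
  let ?cycle = "\<lambda>n. KT.cls (kt_cls {..<n} (partial_mat (cycle_map n)) :: 'k kt_class)"
  define H where "H = {K0_kt_class (matrix_module (jordan_block n (0::'k))) | n. n \<ge> 1} \<union>
      {K0_kt_class (matrix_module (root_matrix n (\<zeta> n))) | n. n \<ge> 1}"
  have root: "K0_kt_class (matrix_module (root_matrix n (\<zeta> n))) = ?cycle n" if "n \<ge> 1" for n
    unfolding K0_kt_class_eq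
    using kt_class_root_matrix[OF that assms[OF that] of_nat_neq_0_of_primitive_roots[OF assms
        that]] by simp
  have H: "H = {?path n | n. n \<ge> 1} \<union> {?cycle n | n. n \<ge> 1}"
  proof -
    have "{K0_kt_class (matrix_module (root_matrix n (\<zeta> n))) | n. n \<ge> 1} = {?cycle n | n. n \<ge> 1}"
      using root by (intro Collect_cong iff_exI) auto
    then show ?thesis unfolding H_def by (simp add: K0_kt_class_eq kt_class_jordan_block)
  qed
  have image: "KT.cls (kt_cls B (partial_mat s) :: 'k kt_class) \<in> \<Phi> ` carrier K0_F1"
    if "partial_map B s" for B :: "nat set" and s
  proof -
    have "\<Phi> (F1.cls (t_cls B s)) = KT.cls (kt_cls B (partial_mat s))"
      using \<Phi>_cls[OF t_cls_in_classes[OF that]] base_change_class_cls[OF that] by simp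
    moreover have "F1.cls (t_cls B s) \<in> carrier K0_F1"
      unfolding K0_F1_eq by (rule F1.cls_closed[OF t_cls_in_classes[OF that]])
    ultimately show ?thesis by (metis imageI)
  qed
  \<comment> \<open>Paths and cycles are themselves partial maps, so every generator is the image of
    a class.\<close>
  have "H \<subseteq> \<Phi> ` carrier K0_F1"
  proof -
    have "partial_map {..<n} (path_map n)" "n \<ge> 1 \<Longrightarrow> partial_map {..<n} (cycle_map n)" for n
      by (auto simp: partial_map_def path_map_def cycle_map_def split: if_splits)
    then show ?thesis unfolding H using image by blast
  qed
  moreover have "subring (\<Phi> ` carrier K0_F1) K0_kt"
    by (rule \<Phi>.img_is_subring[OF \<Phi>.R.carrier_is_subring])
  moreover have H_carrier: "H \<subseteq> carrier K0_kt"
    using calculation(1) \<Phi>.hom_closed by blast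
  ultimately have sub: "generate_ring K0_kt H \<subseteq> \<Phi> ` carrier K0_F1"
    by (intro \<Phi>.S.generate_ring_min_subring1)
  \<comment> \<open>The decomposition enters here: the class of the matrix of a partial map is a
    finite sum of generators and of the class of the empty matrix.\<close>
  have closed: "KT.cls (kt_cls B (partial_mat s) :: 'k kt_class) \<in> generate_ring K0_kt H"
    if "partial_map B s" for B :: "nat set" and s
    using that
  proof (rule kt_class_induct)
    fix a :: "nat \<Rightarrow> nat \<Rightarrow> 'k"
    let ?E = "kt_cls ({} :: nat set) a"
    have E: "?E \<in> kt_classes" by (rule kt_cls_in_classes) simp
    \<comment> \<open>The empty matrix is its own double, so its class is idempotent for addition
      and hence zero.\<close>
    have "kt_class_add ?E ?E = ?E"
      unfolding kt_class_add_cls[OF finite.emptyI finite.emptyI]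
      by (rule kt_cls_reindex[where g = "case_sum id id"]) (auto simp: bij_betw_def inj_on_def
          Plus_def)
    then have "KT.cls ?E = KT.cls ?E \<oplus>\<^bsub>K0_kt\<^esub> KT.cls ?E"
      using KT.cls_add[OF E E] by (simp add: K0_kt_eq)
    moreover have "KT.cls ?E \<in> carrier K0_kt" unfolding K0_kt_eq by (rule KT.cls_closed[OF E])
    ultimately have "KT.cls ?E = \<zero>\<^bsub>K0_kt\<^esub>" using \<Phi>.S.add.l_cancel_one' by metis
    then show "KT.cls ?E \<in> generate_ring K0_kt H"
      using \<Phi>.S.zero_in_generate by simp
  next
    fix X Y :: "'k kt_class" assume "X \<in> kt_classes" "Y \<in> kt_classes"
      "KT.cls X \<in> generate_ring K0_kt H" "KT.cls Y \<in> generate_ring K0_kt H"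
    then show "KT.cls (kt_class_add X Y) \<in> generate_ring K0_kt H"
      using KT.cls_add[of X Y] generate_ring.eng_add[of "KT.cls X" K0_kt H "KT.cls Y"]
          by (simp add: K0_kt_eq)
  qed (auto intro!: generate_ring.incl simp: H)
  \<comment> \<open>Elements of the domain are integer combinations of classes, and the generated
    ring is closed under differences, so it suffices to treat classes of partial maps.\<close>
  have sup: "\<Phi> Z \<in> generate_ring K0_kt H" if "Z \<in> carrier K0_F1" for Z
    using that unfolding K0_F1_eq
  proof (induction rule: F1.quotient_induct)
    case zero
    then show ?case using \<Phi>.S.zero_in_generate \<Phi>.hom_zero by (simp add: K0_F1_eq)
  next
    case (diff x y)
    then have "\<Phi> (x \<ominus>\<^bsub>F1.F Quot F1.I\<^esub> y) = \<Phi> x \<oplus>\<^bsub>K0_kt\<^esub> \<ominus>\<^bsub>K0_kt\<^esub> \<Phi> y"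
      by (simp add: a_minus_def flip: K0_F1_eq)
    then show ?case
      using diff by (simp add: generate_ring.eng_add generate_ring.a_inv)
  next
    case (cls X)
    then obtain B :: "nat set" and s where B: "partial_map B s" "X = t_cls B s" by (rule t_classesE)
    then show ?case
      using closed[OF B(1)] \<Phi>_cls[OF cls] by (simp add: base_change_class_cls[OF B(1)])
  qed
  have "\<Phi> ` carrier K0_F1 = generate_ring K0_kt H"
    using sub sup by blast
  then show "\<Phi> ` carrier K0_F1 = generate_ring K0_kt
      ({K0_kt_class (matrix_module (jordan_block n 0)) | n. n \<ge> 1} \<union>
       {K0_kt_class (matrix_module (root_matrix n (\<zeta> n))) | n. n \<ge> 1})"
    by (simp only: H_def)
qed

end
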